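(* Let $\mathbb{X}$ be a complex Banach space, let $J,\tilde J\in\{\mathbb{R}_+,\mathbb{R}\}$ with $\tilde J\subset J$, let $A$ be a closed linear operator on $\mathbb{X}$ with domain $D(A)$ and spectrum $\sigma(A)$, and let $\phi\in L^\infty(J,\mathbb{X})$. Let $\mathcal{F}\subset L^1_{loc}(\tilde J,\mathbb{X})$ be a linear subspace that is uniformly closed and $BUC$-invariant, and suppose that: (i) $\gamma_\lambda\psi\in\mathcal{F}$ for all $\lambda\in\mathbb{R}$ and $\psi\in\mathcal{F}$, where $\gamma_\lambda(t)=e^{i\lambda t}$; (ii) $\mathcal{F}$ contains all constant functions; (iii) $B\circ\psi\in\mathcal{F}$ for every bounded linear operator $B$ on $\mathbb{X}$ and every $\psi\in\mathcal{F}$. If $u\in BC(J,\mathbb{X})$ is a mild solution of $u'(t)=Au(t)+\phi(t)$, $u(0)=x\in\mathbb{X}$, $t\in J$, then $$ i\,sp_{\mathcal{F}}(u)\subset(\sigma(A)\cap i\mathbb{R})\cup i\,sp_{\mathcal{F}}(\phi).$$ If moreover $\phi\in\mathcal{M}\mathcal{F}$, then $$ i\,sp_{\mathcal{F}}(u)\subset\sigma(A)\cap i\mathbb{R}.$$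
   Context: Notation: $\mathbb{R}_+=[0,\infty)$. Elements of function spaces are functions (not equivalence classes), with pointwise operations. $L^\infty(J,\mathbb{X})$ is the space of bounded measurable functions $J\to\mathbb{X}$ with sup-norm, $BC(J,\mathbb{X})$ the bounded continuous functions, $BUC(J,\mathbb{X})$ the bounded uniformly continuous functions, $L^1_{loc}(J,\mathbb{X})$ the locally Bochner integrable functions. For $f\in L^1(\mathbb{R},\mathbb{C})$, $\hat f(\lambda)=\int_{-\infty}^\infty e^{-i\lambda t}f(t)\,dt$. Convolution: $(\Phi*f)(t)=\int_{\mathbb{R}}\Phi(t-s)f(s)\,ds$. Translate: $\phi_a(t)=\phi(t+a)$. For a class $\mathcal{F}$ of functions $\tilde J\to\mathbb{X}$: - $\mathcal{F}$ is uniformly closed if $\phi_n\in\mathcal{F}$ and $\phi_n\to\phi$ uniformly on $\tilde J$ imply $\phi\in\mathcal{F}$. - $\mathcal{F}$ is $BUC$-invariant if $\psi\in BUC(\mathbb{R},\mathbb{X})$ and $\psi|_{\tilde J}\in\mathcal{F}$ imply $\psi_a|_{\tilde J}\in\mathcal{F}$ for all $a\in\mathbb{R}$. - $\mathcal{M}\mathcal{F}=\{\psi\in L^1_{loc}(\tilde J,\mathbb{X}): M_h\psi\in\mathcal{F}\text{ for all }h>0\}$, where $M_h\psi(t)=\frac1h\int_0^h\psi(t+s)\,ds$. For $\phi$ defined on $J\supset\tilde J$, $\phi\in\mathcal{M}\mathcal{F}$ means $\phi|_{\tilde J}\in\mathcal{M}\mathcal{F}$. Reduced spectrum: for $\phi\in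 L^\infty(J,\mathbb{X})$ with $\tilde J\subset J$, let $\Phi=\phi$ on $\tilde J$ and $\Phi=0$ on $\mathbb{R}\setminus\tilde J$; then $$sp_{\mathcal{F}}(\phi)=\{\lambda\in\mathbb{R}:\ \text{for every } f\in L^1(\mathbb{R},\mathbb{C}),\ (\Phi*f)|_{\tilde J}\in\mathcal{F}\text{ implies }\hat f(\lambda)=0\}.$$ For $S\subset\mathbb{R}$, $iS=\{is:s\in S\}$. Mild solution: $u\in C(J,\mathbb{X})$ is a mild solution of $u'(t)=Au(t)+\phi(t)$, $u(0)=x$, $t\in J$, if for all $t\in J$ one has $\int_0^t u(s)\,ds\in D(A)$ and $u(t)-x=A\int_0^t u(s)\,ds+\int_0^t\phi(s)\,ds$. *)

theory Defs
  imports "HOL-Analysis.Analysis"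
begin

section \<open>Complex Banach spaces\<close>

class complex_banach = banach +
  fixes scaleC :: "complex \<Rightarrow> 'a \<Rightarrow> 'a" (infixr "*\<^sub>C" 75)
  assumes scaleC_add_right: "c *\<^sub>C (x + y) = c *\<^sub>C x + c *\<^sub>C y"
    and scaleC_add_left: "(c + d) *\<^sub>C x = c *\<^sub>C x + d *\<^sub>C x"
    and scaleC_scaleC: "c *\<^sub>C d *\<^sub>C x = (c * d) *\<^sub>C x"
    and scaleC_of_real: "complex_of_real r *\<^sub>C x = r *\<^sub>R x"
    and norm_scaleC: "norm (c *\<^sub>C x) = cmod c * norm x"

definition bounded_clinear :: "('a::complex_banach \<Rightarrow> 'a) \<Rightarrow> bool" where
  "bounded_clinear B \<longleftrightarrow> bounded_linear B \<and> (\<forall>c x. B (c *\<^sub>C x) = c *\<^sub>C B x)"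


section \<open>Bochner integral without separability\<close>

text \<open>
  The library's Bochner integral is restricted to second countable, i.e. separable, Banach spaces.
  The three definitions below are those of \<^const>\<open>has_bochner_integral\<close>,
  \<^const>\<open>integrable\<close> and \<^const>\<open>lebesgue_integral\<close> with that sort constraint dropped.
  In a nonseparable space the existence of the approximating simple functions is a genuine
  condition; it forces \<open>f\<close> to be almost everywhere separably valued.
\<close>

definition bochner_has_integral ::
    "'b measure \<Rightarrow> ('b \<Rightarrow> 'a::real_normed_vector) \<Rightarrow> 'a \<Rightarrow> bool" where
  "bochner_has_integral M f x \<longleftrightarrow> f \<in> borel_measurable M \<and>
     (\<exists>s :: nat \<Rightarrow> 'b \<Rightarrow> 'a.
        (\<forall>i. Bochner_Integration.simple_bochner_integrable M (s i)) \<and>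
        (\<lambda>i. \<integral>\<^sup>+ t. norm (f t - s i t) \<partial>M) \<longlonglongrightarrow> 0 \<and>
        (\<lambda>i. Bochner_Integration.simple_bochner_integral M (s i)) \<longlonglongrightarrow> x)"

definition bochner_integrable :: "'b measure \<Rightarrow> ('b \<Rightarrow> 'a::real_normed_vector) \<Rightarrow> bool" where
  "bochner_integrable M f \<longleftrightarrow> (\<exists>x. bochner_has_integral M f x)"

definition bochner_integral :: "'b measure \<Rightarrow> ('b \<Rightarrow> 'a::real_normed_vector) \<Rightarrow> 'a" where
  "bochner_integral M f =
     (if bochner_integrable M f then THE x. bochner_has_integral M f x else 0)"

definition bochner_set_integrable :: "real set \<Rightarrow> (real \<Rightarrow> 'a::real_normed_vector) \<Rightarrow> bool" where
  "bochner_set_integrable S f \<longleftrightarrow> bochner_integrable lebesgue (\<lambda>t. indicator S t *\<^sub>R f t)"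

definition bochner_set_integral :: "real set \<Rightarrow> (real \<Rightarrow> 'a::real_normed_vector) \<Rightarrow> 'a" where
  "bochner_set_integral S f = bochner_integral lebesgue (\<lambda>t. indicator S t *\<^sub>R f t)"

text \<open>The oriented integral of \<open>f\<close> from \<open>0\<close> to \<open>t\<close>, where \<open>t\<close> may be negative.\<close>

definition integral_from_0 :: "real \<Rightarrow> (real \<Rightarrow> 'a::real_normed_vector) \<Rightarrow> 'a" where
  "integral_from_0 t f =
     (if 0 \<le> t then bochner_set_integral {0..t} f else - bochner_set_integral {t..0} f)"

definition strongly_measurable_on :: "real set \<Rightarrow> (real \<Rightarrow> 'a::real_normed_vector) \<Rightarrow> bool" where
  "strongly_measurable_on S f \<longleftrightarrow>
     (\<exists>s :: nat \<Rightarrow> real \<Rightarrow> 'a. (\<forall>n. simple_function lebesgue (s n)) \<and>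
        (AE t in lebesgue. t \<in> S \<longrightarrow> (\<lambda>n. s n t) \<longlonglongrightarrow> f t))"


section \<open>Function spaces\<close>

text \<open>
  A function \<open>J \<rightarrow> X\<close> is represented, as in \<^theory>\<open>HOL-Library.FuncSet\<close>, by an element of
  \<^term>\<open>extensional J\<close>; restriction to \<open>J\<close> is \<^term>\<open>restrict f J\<close>. All spaces consist of
  functions, not of equivalence classes.
\<close>

definition L_infinity :: "real set \<Rightarrow> (real \<Rightarrow> 'a::complex_banach) set" where
  "L_infinity J = {f \<in> extensional J. strongly_measurable_on J f \<and> bounded (f ` J)}"

definition BC :: "real set \<Rightarrow> (real \<Rightarrow> 'a::complex_banach) set" where
  "BC J = {f \<in> extensional J. continuous_on J f \<and> bounded (f ` J)}"

definition BUC :: "real set \<Rightarrow> (real \<Rightarrow> 'a::complex_banach) set" where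
  "BUC J = {f \<in> extensional J. uniformly_continuous_on J f \<and> bounded (f ` J)}"

definition L1_loc :: "real set \<Rightarrow> (real \<Rightarrow> 'a::complex_banach) set" where
  "L1_loc J = {f \<in> extensional J. \<forall>a b. {a..b} \<subseteq> J \<longrightarrow> bochner_set_integrable {a..b} f}"

definition function_subspace :: "real set \<Rightarrow> (real \<Rightarrow> 'a::complex_banach) set \<Rightarrow> bool" where
  "function_subspace J F \<longleftrightarrow>
     (\<lambda>t\<in>J. 0) \<in> F \<and>
     (\<forall>f\<in>F. \<forall>g\<in>F. (\<lambda>t\<in>J. f t + g t) \<in> F) \<and>
     (\<forall>c. \<forall>f\<in>F. (\<lambda>t\<in>J. c *\<^sub>C f t) \<in> F)"

definition uniformly_closed :: "real set \<Rightarrow> (real \<Rightarrow> 'a::complex_banach) set \<Rightarrow> bool" where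
  "uniformly_closed J F \<longleftrightarrow>
     (\<forall>\<phi>s \<phi>. (\<forall>n::nat. \<phi>s n \<in> F) \<and> \<phi> \<in> extensional J \<and> uniform_limit J \<phi>s \<phi> sequentially
        \<longrightarrow> \<phi> \<in> F)"

definition BUC_invariant :: "real set \<Rightarrow> (real \<Rightarrow> 'a::complex_banach) set \<Rightarrow> bool" where
  "BUC_invariant J F \<longleftrightarrow>
     (\<forall>\<psi>\<in>BUC UNIV. restrict \<psi> J \<in> F \<longrightarrow> (\<forall>a. restrict (\<lambda>t. \<psi> (t + a)) J \<in> F))"

definition mean_op :: "real \<Rightarrow> (real \<Rightarrow> 'a::complex_banach) \<Rightarrow> real \<Rightarrow> 'a" where
  "mean_op h \<psi> t = (1 / h) *\<^sub>R bochner_set_integral {0..h} (\<lambda>s. \<psi> (t + s))"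

definition mean_class ::
    "real set \<Rightarrow> (real \<Rightarrow> 'a::complex_banach) set \<Rightarrow> (real \<Rightarrow> 'a) set" where
  "mean_class J F = {\<psi> \<in> L1_loc J. \<forall>h>0. restrict (mean_op h \<psi>) J \<in> F}"


section \<open>Reduced spectrum\<close>

definition fourier :: "(real \<Rightarrow> complex) \<Rightarrow> real \<Rightarrow> complex" where
  "fourier f l = (LINT t|lebesgue. exp (- \<i> * complex_of_real (l * t)) * f t)"

definition convolution ::
    "(real \<Rightarrow> 'a::complex_banach) \<Rightarrow> (real \<Rightarrow> complex) \<Rightarrow> real \<Rightarrow> 'a" where
  "convolution \<Phi> f t = bochner_integral lebesgue (\<lambda>s. f s *\<^sub>C \<Phi> (t - s))"

text \<open>The first argument is the domain \<open>J'\<close> of the functions in \<open>F\<close>.\<close>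

definition reduced_spectrum ::
    "real set \<Rightarrow> (real \<Rightarrow> 'a::complex_banach) set \<Rightarrow> (real \<Rightarrow> 'a) \<Rightarrow> real set" where
  "reduced_spectrum J' F \<phi> =
     (let \<Phi> = (\<lambda>t. if t \<in> J' then \<phi> t else 0) in
      {l. \<forall>f. integrable lebesgue f \<and> restrict (convolution \<Phi> f) J' \<in> F \<longrightarrow> fourier f l = 0})"


section \<open>Closed operators and mild solutions\<close>

text \<open>An unbounded operator is given by its domain \<open>D\<close> and a total function \<open>A\<close> whose values
  outside \<open>D\<close> are irrelevant.\<close>

definition closed_operator :: "'a::complex_banach set \<Rightarrow> ('a \<Rightarrow> 'a) \<Rightarrow> bool" where
  "closed_operator D A \<longleftrightarrow>
     0 \<in> D \<and>
     (\<forall>x\<in>D. \<forall>y\<in>D. x + y \<in> D \<and> A (x + y) = A x + A y) \<and>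
     (\<forall>c. \<forall>x\<in>D. c *\<^sub>C x \<in> D \<and> A (c *\<^sub>C x) = c *\<^sub>C A x) \<and>
     closed ((\<lambda>x. (x, A x)) ` D)"

definition resolvent_set :: "'a::complex_banach set \<Rightarrow> ('a \<Rightarrow> 'a) \<Rightarrow> complex set" where
  "resolvent_set D A =
     {z. \<exists>R. bounded_clinear R \<and>
           (\<forall>y. R y \<in> D \<and> z *\<^sub>C R y - A (R y) = y) \<and>
           (\<forall>x\<in>D. R (z *\<^sub>C x - A x) = x)}"

definition op_spectrum :: "'a::complex_banach set \<Rightarrow> ('a \<Rightarrow> 'a) \<Rightarrow> complex set" where
  "op_spectrum D A = - resolvent_set D A"

definition mild_solution ::
    "real set \<Rightarrow> 'a::complex_banach set \<Rightarrow> ('a \<Rightarrow> 'a) \<Rightarrow> (real \<Rightarrow> 'a) \<Rightarrow> 'a \<Rightarrow> (real \<Rightarrow> 'a) \<Rightarrow> bool"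
  where
  "mild_solution J D A \<phi> x u \<longleftrightarrow> continuous_on J u \<and>
     (\<forall>t\<in>J. integral_from_0 t u \<in> D \<and>
        u t - x = A (integral_from_0 t u) + integral_from_0 t \<phi>)"

definition i_times :: "real set \<Rightarrow> complex set" where
  "i_times S = (\<lambda>s. \<i> * complex_of_real s) ` S"

end

theory Submission
  imports Defs
begin

text \<open>
  For \<open>\<i> l\<close> in the resolvent set put \<open>R = (\<i> l - A)\<inverse>\<close>. Then \<open>w = R u\<close> satisfies
  \<open>w' = \<i> l w - u + R \<phi>\<close> in integrated form, so for a smooth kernel \<open>g\<close>, up to a boundary term which
  vanishes at infinity,
  \<open>u * g = R (\<phi> * g) - R (u * (g' - \<i> l g))\<close>.
  If \<open>\<phi> * f\<close> is in \<open>F\<close> and \<open>g = f * k\<close>, then \<open>\<phi> * g\<close> is in \<open>F\<close>, because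
  the integrable kernels mapping \<open>\<phi>\<close> into \<open>F\<close> form a closed translation invariant subspace, hence an
  ideal. Taking for \<open>k\<close> a squared sinc function with spectrum in a small neighbourhood of \<open>l\<close>, the norms
  of the iterates of \<open>g \<mapsto> g' - \<i> l g\<close> decay faster than the powers of \<open>R\<close> grow, and the iterated identity
  is a Neumann series showing that \<open>u * g\<close> is in \<open>F\<close>.
\<close>

text \<open>A mild solution involves \<open>A\<close> only through integrals, because
  \<open>u t\<close> need not lie in \<open>D\<close>; applying \<open>R\<close> removes
  \<open>A\<close> altogether. What remains is an equation with a right-hand side that is merely
  bounded and strongly measurable, so integration by parts has to work without pointwise
  derivatives. The space may be nonseparable. Strong measurability, unlike Borel measurability, is
  stable under sums there, and integrals are computed as gauge integrals, which are linear in every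
  Banach space. A single sinc decays like \<open>1 / t\<close> and is not integrable; its square is
  integrable, and after demodulation it is nonnegative, so its Fourier transform at \<open>l\<close>
  is not zero. If the frequencies lie in the interval from \<open>l - a\<close> to
  \<open>l + a\<close>, each application of \<open>g' - i l g\<close> costs a factor
  \<open>2 * a\<close> in the bound for the norm. Hence \<open>a\<close> depends only on
  \<open>onorm R\<close>, and \<open>a = 1 / (4 * (onorm R + 1))\<close> gives the Neumann series a
  ratio of at most 1/2. The partial sums approximate \<open>u * g\<close> uniformly on
  \<open>J'\<close>, which is where uniform closedness of \<open>F\<close> enters.\<close>

section \<open>The Bochner integral as a gauge integral\<close>

text \<open>Over one tagged division the Riemann sums of \<open>f\<close> and \<open>s i\<close>
  differ in norm by at most a Riemann sum of \<open>norm (f - s i)\<close>, which is close to a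
  small integral. So the Cauchy criterion passes from \<open>s i\<close> to
  \<open>f\<close>.\<close>

lemma has_integral_L1_limit_cbox:
  fixes f :: "real \<Rightarrow> 'a::banach"
  assumes s: "\<And>i. s i integrable_on cbox a b"
    and h: "\<And>i. (\<lambda>t. norm (f t - s i t)) integrable_on cbox a b"
    and lim: "(\<lambda>i. integral (cbox a b) (\<lambda>t. norm (f t - s i t))) \<longlonglongrightarrow> 0"
  shows "f integrable_on cbox a b"
  unfolding integrable_Cauchy
proof (intro allI impI)
  fix e :: real assume "e > 0"
  let ?h = "\<lambda>i t. norm (f t - s i t)"
  have "eventually (\<lambda>i. integral (cbox a b) (?h i) < e / 8) sequentially"
    using order_tendstoD(2)[OF lim, of "e / 8"] \<open>e > 0\<close> by simp
  then obtain i where i: "integral (cbox a b) (?h i) < e / 8"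
    by (auto simp: eventually_sequentially)
  obtain \<gamma>1 where g1: "gauge \<gamma>1"
    "\<And>D. D tagged_division_of (cbox a b) \<Longrightarrow> \<gamma>1 fine D \<Longrightarrow>
      norm ((\<Sum>(x, k)\<in>D. measure lborel k *\<^sub>R s i x) - integral (cbox a b) (s i)) < e / 8"
    using integrable_integral[OF s[of i], unfolded has_integral, rule_format, of "e / 8"] \<open>e > 0\<close>
    by auto
  obtain \<gamma>2 where g2: "gauge \<gamma>2"
    "\<And>D. D tagged_division_of (cbox a b) \<Longrightarrow> \<gamma>2 fine D \<Longrightarrow>
      norm ((\<Sum>(x, k)\<in>D. measure lborel k *\<^sub>R ?h i x) - integral (cbox a b) (?h i)) < e / 8"
    using integrable_integral[OF h[of i], unfolded has_integral, rule_format, of "e / 8"] \<open>e > 0\<close>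
    by auto
  let ?S = "\<lambda>D f. (\<Sum>(x, k)\<in>D. measure lborel k *\<^sub>R f x)"
  \<comment> \<open>The integral of \<open>?h i\<close> and its Riemann error give
    \<open>e / 4\<close>, the Riemann error of \<open>s i\<close> another \<open>e / 8\<close>. Two
    such bounds add up to \<open>3 * e / 4\<close>.\<close>
  have key: "norm (?S D f - integral (cbox a b) (s i)) < 3 * e / 8"
    if D: "D tagged_division_of (cbox a b)" "\<gamma>1 fine D" "\<gamma>2 fine D" for D
  proof -
    have "norm (?S D f - ?S D (s i)) = norm (\<Sum>(x, k)\<in>D. measure lborel k *\<^sub>R (f x - s i x))"
      by (simp add: sum_subtractf[symmetric] scaleR_diff_right split_beta)
    also have "\<dots> \<le> (\<Sum>(x, k)\<in>D. measure lborel k *\<^sub>R ?h i x)"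
      by (rule order_trans[OF norm_sum]) (auto intro!: sum_mono)
    also have "\<dots> < e / 4"
      using g2(2)[OF D(1,3)] i by (simp only: real_norm_def)
    finally have "norm (?S D f - ?S D (s i)) < e / 4" .
    with g1(2)[OF D(1,2)] show ?thesis
      using norm_triangle_ineq[of "?S D f - ?S D (s i)" "?S D (s i) - integral (cbox a b) (s i)"]
      by simp
  qed
  show "\<exists>\<gamma>. gauge \<gamma> \<and> (\<forall>\<D>1 \<D>2. \<D>1 tagged_division_of cbox a b \<and> \<gamma> fine \<D>1 \<and>
      \<D>2 tagged_division_of cbox a b \<and> \<gamma> fine \<D>2 \<longrightarrow> norm (?S \<D>1 f - ?S \<D>2 f) < e)"
  proof (intro exI[of _ "\<lambda>x. \<gamma>1 x \<inter> \<gamma>2 x"] conjI allI impI)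
    show "gauge (\<lambda>x. \<gamma>1 x \<inter> \<gamma>2 x)" using g1(1) g2(1) by (rule gauge_Int)
    fix D1 D2
    assume "D1 tagged_division_of cbox a b \<and> (\<lambda>x. \<gamma>1 x \<inter> \<gamma>2 x) fine D1 \<and>
      D2 tagged_division_of cbox a b \<and> (\<lambda>x. \<gamma>1 x \<inter> \<gamma>2 x) fine D2"
    then have "D1 tagged_division_of cbox a b" "\<gamma>1 fine D1" "\<gamma>2 fine D1"
      "D2 tagged_division_of cbox a b" "\<gamma>1 fine D2" "\<gamma>2 fine D2"
      by (simp_all only: fine_Int)
    from key[OF this(1-3)] key[OF this(4-6)] show "norm (?S D1 f - ?S D2 f) < e"
      using norm_triangle_ineq4[of "?S D1 f - integral (cbox a b) (s i)" "?S D2 f - integral (cbox a b) (s i)"] \<open>e > 0\<close>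
      by simp
  qed
qed

text \<open>The integral of \<open>norm (f - s i)\<close> over the line bounds the error on all
  bounded intervals at once, so a single index \<open>i\<close> serves for every large interval in
  \<open>has_integral_alt'\<close>.\<close>

lemma has_integral_L1_limit:
  fixes f :: "real \<Rightarrow> 'a::banach"
  assumes s: "\<And>i. (s i has_integral x i) UNIV"
    and h: "\<And>i. integrable lebesgue (\<lambda>t. norm (f t - s i t))"
    and lim: "(\<lambda>i. \<integral>t. norm (f t - s i t) \<partial>lebesgue) \<longlonglongrightarrow> 0"
    and x: "x \<longlonglongrightarrow> y"
  shows "(f has_integral y) UNIV"
proof -
  let ?h = "\<lambda>i t. norm (f t - s i t)"
  let ?e = "\<lambda>i. \<integral>t. norm (f t - s i t) \<partial>lebesgue"
  have hU: "(?h i has_integral ?e i) UNIV" for i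
    by (rule has_integral_integral_lebesgue[OF h])
  have hab: "?h i integrable_on cbox a b" for i a b
    using hU[of i] by (meson has_integral_integrable integrable_on_subcbox subset_UNIV)
  have hle: "integral (cbox a b) (?h i) \<le> ?e i" for i a b
    using integral_subset_le[OF subset_UNIV hab has_integral_integrable[OF hU]] integral_unique[OF hU]
    by (metis norm_ge_zero)
  have sab: "s i integrable_on cbox a b" for i a b
    using s[of i] by (meson has_integral_integrable integrable_on_subcbox subset_UNIV)
  have fab: "f integrable_on cbox a b" for a b
  proof (rule has_integral_L1_limit_cbox[OF sab hab])
    show "(\<lambda>i. integral (cbox a b) (?h i)) \<longlonglongrightarrow> 0"
    proof (rule tendsto_sandwich[OF _ _ tendsto_const lim])
      show "\<forall>\<^sub>F i in sequentially. 0 \<le> integral (cbox a b) (?h i)"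
        by (intro always_eventually allI integral_nonneg hab) simp
      show "\<forall>\<^sub>F i in sequentially. integral (cbox a b) (?h i) \<le> ?e i"
        by (intro always_eventually allI hle)
    qed
  qed
  show ?thesis
    unfolding has_integral_alt'
  proof (intro conjI allI impI)
    show "(\<lambda>x. if x \<in> UNIV then f x else 0) integrable_on cbox a b" for a b
      using fab by simp
    fix e :: real assume "e > 0"
    have "eventually (\<lambda>i. ?e i < e / 3) sequentially"
      using order_tendstoD(2)[OF lim, of "e / 3"] \<open>e > 0\<close> by simp
    moreover have "eventually (\<lambda>i. dist (x i) y < e / 3) sequentially"
      using tendstoD[OF x, of "e / 3"] \<open>e > 0\<close> by simp
    ultimately have "eventually (\<lambda>i. ?e i < e / 3 \<and> dist (x i) y < e / 3) sequentially"
      by (rule eventually_conj)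
    then obtain i where i: "?e i < e / 3" "norm (x i - y) < e / 3"
      by (auto simp: eventually_sequentially dist_norm)
    obtain B where B: "B > 0" "\<And>a b. ball 0 B \<subseteq> cbox a b \<Longrightarrow> norm (integral (cbox a b) (s i) - x i) < e / 3"
      using s[of i, unfolded has_integral_alt'] \<open>e > 0\<close>
      by (auto dest!: spec[of "\<lambda>e. 0 < e \<longrightarrow> P e" "e/3" for P])
    show "\<exists>B>0. \<forall>a b. ball 0 B \<subseteq> cbox a b \<longrightarrow>
        norm (integral (cbox a b) (\<lambda>x. if x \<in> UNIV then f x else 0) - y) < e"
    proof (intro exI[of _ B] conjI allI impI B(1))
      fix a b :: real assume *: "ball 0 B \<subseteq> cbox a b"
      have "norm (integral (cbox a b) f - integral (cbox a b) (s i)) = norm (integral (cbox a b) (\<lambda>t. f t - s i t))"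
        by (subst Henstock_Kurzweil_Integration.integral_diff[OF fab sab]) (rule refl)
      also have "\<dots> \<le> integral (cbox a b) (?h i)"
        by (rule integral_norm_bound_integral[OF Henstock_Kurzweil_Integration.integrable_diff[OF fab sab] hab order_refl])
      also have "\<dots> < e / 3" using hle i(1) by (rule le_less_trans)
      finally show "norm (integral (cbox a b) (\<lambda>x. if x \<in> UNIV then f x else 0) - y) < e"
        using B(2)[OF *] i(2)
          norm_triangle_ineq[of "integral (cbox a b) f - integral (cbox a b) (s i)" "integral (cbox a b) (s i) - x i"]
          norm_triangle_ineq[of "integral (cbox a b) f - x i" "x i - y"]
        by simp
    qed
  qed
qed

lemma has_integral_simple_bochner_integral:
  fixes s :: "real \<Rightarrow> 'a::real_normed_vector"
  assumes "Bochner_Integration.simple_bochner_integrable lebesgue s"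
  shows "(s has_integral Bochner_Integration.simple_bochner_integral lebesgue s) UNIV"
proof -
  have sf: "simple_function lebesgue s" and fin: "emeasure lebesgue {y. s y \<noteq> 0} \<noteq> \<infinity>"
    using assms by (auto elim: Bochner_Integration.simple_bochner_integrable.cases)
  have "finite (range s)" using simple_functionD(1)[OF sf] by simp
  have m: "{x. s x = y} \<in> sets lebesgue" for y
    using simple_functionD(2)[OF sf, of "{y}"] by (simp add: vimage_def)
  have *: "((\<lambda>t. indicator {x. s x = y} t *\<^sub>R y) has_integral measure lebesgue {x. s x = y} *\<^sub>R y) UNIV" for y
  \<comment> \<open>The level set of 0 may have infinite measure, but its term is a multiple of
    0.\<close>
  proof (cases "y = 0")
    case False
    have "{y. s y \<noteq> 0} = s -` (- {0}) \<inter> space lebesgue" by auto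
    then have m0: "{y. s y \<noteq> 0} \<in> sets lebesgue"
      using simple_functionD(2)[OF sf, of "- {0}"] by simp
    have "emeasure lebesgue {x. s x = y} \<le> emeasure lebesgue {y. s y \<noteq> 0}"
      using False by (intro emeasure_mono m0) auto
    then have "{x. s x = y} \<in> lmeasurable"
      using fin m by (intro fmeasurableI) (auto simp: less_top top_unique)
    then show ?thesis
      by (auto simp: lmeasurable_iff_has_integral intro: has_integral_scaleR_left)
  qed simp
  have "((\<lambda>t. \<Sum>y\<in>range s. indicator {x. s x = y} t *\<^sub>R y) has_integral
    (\<Sum>y\<in>range s. measure lebesgue {x. s x = y} *\<^sub>R y)) UNIV"
    by (intro has_integral_sum \<open>finite (range s)\<close> *)
  moreover have "(\<Sum>y\<in>range s. indicator {x. s x = y} t *\<^sub>R y) = s t" for t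
  proof -
    have "(\<Sum>y\<in>range s. indicator {x. s x = y} t *\<^sub>R y) = (\<Sum>y\<in>range s. if y = s t then y else 0)"
      by (intro sum.cong) (auto simp: indicator_def)
    then show ?thesis using \<open>finite (range s)\<close> by simp
  qed
  ultimately show ?thesis
    by (simp add: Bochner_Integration.simple_bochner_integral_def)
qed

text \<open>In a nonseparable space sums of Borel functions need not be Borel; adding a simple function is
  harmless.\<close>

lemma borel_measurable_norm_diff_simple:
  fixes f :: "'b \<Rightarrow> 'a::real_normed_vector"
  assumes f: "f \<in> borel_measurable M" and s: "simple_function M s"
  shows "(\<lambda>t. norm (f t - s t)) \<in> borel_measurable M"
proof -
  have [measurable]: "s \<in> measurable M (count_space UNIV)" using s by (rule measurable_simple_function)
  have fin: "finite (s ` space M)" using s by (rule simple_functionD)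
  \<comment> \<open>On each level set of \<open>s\<close> a constant \<open>y\<close> is subtracted,
    and \<open>norm (f t - y)\<close> is a continuous real function of \<open>f t\<close>, hence
    Borel. Finitely many such real functions may be added.\<close>
  have "(\<lambda>t. \<Sum>y\<in>s ` space M. indicator (s -` {y} \<inter> space M) t * norm (f t - y)) \<in> borel_measurable M"
  proof (intro borel_measurable_sum borel_measurable_times borel_measurable_indicator)
    show "s -` {y} \<inter> space M \<in> sets M" for y by measurable
    have "(\<lambda>x. norm (x - y)) \<in> borel_measurable borel" for y :: 'a
      by (intro borel_measurable_continuous_onI continuous_intros)
    from measurable_compose[OF f this] show "(\<lambda>t. norm (f t - y)) \<in> borel_measurable M" for y .
  qed
  moreover have "(\<Sum>y\<in>s ` space M. indicator (s -` {y} \<inter> space M) t * norm (f t - y)) = norm (f t - s t)"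
    if "t \<in> space M" for t
  proof -
    have "(\<Sum>y\<in>s ` space M. indicator (s -` {y} \<inter> space M) t * norm (f t - y)) =
      (\<Sum>y\<in>s ` space M. if y = s t then norm (f t - y) else 0)"
      using that by (intro sum.cong) (auto simp: indicator_def)
    then show ?thesis using fin that by simp
  qed
  ultimately show ?thesis
    by (subst measurable_cong[OF sym]) auto
qed

lemma bochner_has_integral_imp_has_integral:
  fixes f :: "real \<Rightarrow> 'a::banach"
  assumes "bochner_has_integral lebesgue f y"
  shows "(f has_integral y) UNIV"
proof -
  obtain s where f: "f \<in> borel_measurable lebesgue"
    and s: "\<And>i. Bochner_Integration.simple_bochner_integrable lebesgue (s i)"
    and lim: "(\<lambda>i. \<integral>\<^sup>+ t. norm (f t - s i t) \<partial>lebesgue) \<longlonglongrightarrow> 0"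
    and x: "(\<lambda>i. Bochner_Integration.simple_bochner_integral lebesgue (s i)) \<longlonglongrightarrow> y"
    using assms by (auto simp: bochner_has_integral_def)
  have sf: "simple_function lebesgue (s i)" for i
    using s by (auto elim: Bochner_Integration.simple_bochner_integrable.cases)
  \<comment> \<open>The convergence takes place in \<open>ennreal\<close>, where early terms may be
    infinite; shifting the index by \<open>N\<close> leaves only finite ones.\<close>
  have "eventually (\<lambda>i. (\<integral>\<^sup>+ t. norm (f t - s i t) \<partial>lebesgue) < 1) sequentially"
    using order_tendstoD(2)[OF lim, of 1] by simp
  then obtain N where N: "\<And>i. i \<ge> N \<Longrightarrow> (\<integral>\<^sup>+ t. norm (f t - s i t) \<partial>lebesgue) < 1"
    by (auto simp: eventually_sequentially)
  have h: "integrable lebesgue (\<lambda>t. norm (f t - s (i + N) t))" for i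
  proof (rule integrableI_bounded)
    show "(\<lambda>t. norm (f t - s (i + N) t)) \<in> borel_measurable lebesgue"
      by (rule borel_measurable_norm_diff_simple[OF f sf])
    have "(\<integral>\<^sup>+ t. norm (f t - s (i + N) t) \<partial>lebesgue) < 1" by (rule N) simp
    then show "(\<integral>\<^sup>+ t. ennreal (norm (norm (f t - s (i + N) t))) \<partial>lebesgue) < \<infinity>"
      by (simp add: order_less_trans[OF _ ennreal_one_less_top])
  qed
  show ?thesis
  proof (rule has_integral_L1_limit)
    show "(s (i + N) has_integral Bochner_Integration.simple_bochner_integral lebesgue (s (i + N))) UNIV" for i
      by (rule has_integral_simple_bochner_integral[OF s])
    show "integrable lebesgue (\<lambda>t. norm (f t - s (i + N) t))" for i by (rule h)
    show "(\<lambda>i. Bochner_Integration.simple_bochner_integral lebesgue (s (i + N))) \<longlonglongrightarrow> y"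
      using x by (rule LIMSEQ_ignore_initial_segment)
    have "(\<integral>\<^sup>+ t. norm (f t - s (i + N) t) \<partial>lebesgue) = ennreal (\<integral>t. norm (f t - s (i + N) t) \<partial>lebesgue)" for i
      by (rule nn_integral_eq_integral[OF h]) simp
    then have "(\<lambda>i. ennreal (\<integral>t. norm (f t - s (i + N) t) \<partial>lebesgue)) \<longlonglongrightarrow> ennreal 0"
      using LIMSEQ_ignore_initial_segment[OF lim, of N] by simp
    then show "(\<lambda>i. \<integral>t. norm (f t - s (i + N) t) \<partial>lebesgue) \<longlonglongrightarrow> 0"
      by (subst (asm) tendsto_ennreal_iff) auto
  qed
qed

text \<open>From here on, linearity, additivity over intervals and substitution are those of the
  gauge integral. Its uniqueness also shows that the \<open>THE\<close> in
  \<open>bochner_integral\<close> is well defined.\<close>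

lemma bochner_integral_eq_integral:
  fixes f :: "real \<Rightarrow> 'a::banach"
  assumes "bochner_integrable lebesgue f"
  shows "f integrable_on UNIV" "bochner_integral lebesgue f = integral UNIV f"
proof -
  obtain y where y: "bochner_has_integral lebesgue f y"
    using assms by (auto simp: bochner_integrable_def)
  note hy = bochner_has_integral_imp_has_integral[OF y]
  show "f integrable_on UNIV" using hy by blast
  have "(THE x. bochner_has_integral lebesgue f x) = y"
    using y hy bochner_has_integral_imp_has_integral has_integral_unique by (intro the_equality) blast+
  with assms hy show "bochner_integral lebesgue f = integral UNIV f"
    by (simp add: bochner_integral_def integral_unique)
qed

text \<open>All functions are made constant on a null set containing the exceptional points, so that
  the limit holds everywhere. Completeness of \<open>lebesgue\<close> then carries measurability
  back to \<open>f\<close>.\<close>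

lemma borel_measurable_AE_limit_metric:
  fixes f :: "real \<Rightarrow> 'a::metric_space"
  assumes s: "\<And>n. s n \<in> borel_measurable lebesgue" and lim: "AE t in lebesgue. (\<lambda>n. s n t) \<longlonglongrightarrow> f t"
  shows "f \<in> borel_measurable lebesgue"
proof -
  obtain N where N: "{t. \<not> (\<lambda>n. s n t) \<longlonglongrightarrow> f t} \<subseteq> N" "N \<in> null_sets lebesgue"
    using lim by (auto simp: eventually_ae_filter)
  define g where "g t = (if t \<in> N then undefined else f t)" for t
  have Nm: "N \<in> sets lebesgue" using N(2) by auto
  have "g \<in> borel_measurable lebesgue"
  proof (rule borel_measurable_LIMSEQ_metric)
    show "(\<lambda>t. if t \<in> N then undefined else s n t) \<in> borel_measurable lebesgue" for n
      using s[of n] Nm by (intro measurable_If_set) auto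
    show "(\<lambda>n. if t \<in> N then undefined else s n t) \<longlonglongrightarrow> g t" for t
      using N(1) by (auto simp: g_def)
  qed
  moreover have ae: "AE t in lebesgue. g t = f t"
    using AE_not_in[OF N(2)] by eventually_elim (simp add: g_def)
  ultimately show ?thesis
  proof (intro measurableI)
    fix S :: "'a set" assume "S \<in> sets borel"
    with \<open>g \<in> borel_measurable lebesgue\<close> have "g -` S \<in> sets lebesgue"
      using measurable_sets[of g lebesgue borel S] by simp
    moreover have "AE t in lebesgue. t \<in> g -` S \<longleftrightarrow> t \<in> f -` S"
      using ae by eventually_elim simp
    ultimately show "f -` S \<inter> space lebesgue \<in> sets lebesgue"
      using completion.in_sets_AE[where A = "g -` S" and B = "f -` S"] by simp
  qed simp
qed

text \<open>Truncating \<open>s n\<close> where it exceeds \<open>2 * norm f\<close> makes the approximation dominated.\<close>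

lemma bochner_integrableI:
  fixes f :: "real \<Rightarrow> 'a::banach"
  assumes sm: "strongly_measurable_on UNIV f"
    and G: "integrable lebesgue G" "\<And>t. norm (f t) \<le> G t"
  shows "bochner_integrable lebesgue f"
proof -
  let ?I = "Bochner_Integration.simple_bochner_integral lebesgue"
  obtain s :: "nat \<Rightarrow> real \<Rightarrow> 'a" where s: "\<And>n. simple_function lebesgue (s n)"
    and lim: "AE t in lebesgue. (\<lambda>n. s n t) \<longlonglongrightarrow> f t"
    using sm by (auto simp: strongly_measurable_on_def)
  have f: "f \<in> borel_measurable lebesgue"
    by (rule borel_measurable_AE_limit_metric[OF borel_measurable_simple_function[OF s] lim])
  have nf: "(\<lambda>t. norm (f t)) \<in> borel_measurable lebesgue"
    using borel_measurable_norm_diff_simple[OF f simple_function_const[of _ 0]] by simp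
  have ns: "(\<lambda>t. norm (s n t)) \<in> borel_measurable lebesgue" for n
    by (rule borel_measurable_simple_function[OF simple_function_compose1[OF s]])
  define A where "A n = {t. norm (s n t) \<le> 2 * norm (f t)}" for n
  have Am: "A n \<in> sets lebesgue" for n
    using borel_measurable_le[OF ns[of n] borel_measurable_times[OF borel_measurable_const nf, of 2]]
    by (simp add: A_def)
  define s' where "s' n t = (if t \<in> A n then s n t else 0)" for n t
  have s'_sf: "simple_function lebesgue (s' n)" for n
    unfolding s'_def using simple_function_If_set[OF s[of n] simple_function_const[of _ 0], of "A n"] Am
    by simp
  have s'_le: "norm (s' n t) \<le> 2 * norm (f t)" for n t
    by (auto simp: s'_def A_def)
  have s'_lim: "AE t in lebesgue. (\<lambda>n. s' n t) \<longlonglongrightarrow> f t"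
    using lim
  proof eventually_elim
    fix t assume t: "(\<lambda>n. s n t) \<longlonglongrightarrow> f t"
    show "(\<lambda>n. s' n t) \<longlonglongrightarrow> f t"
    proof (cases "f t = 0")
      case True
      then have "s' n t = 0" for n using s'_le[of n t] by simp
      then show ?thesis using True by simp
    next
      case False
      then have "norm (f t) < 2 * norm (f t)" by simp
      then have "\<forall>\<^sub>F n in sequentially. norm (s n t) < 2 * norm (f t)"
        by (rule order_tendstoD(2)[OF tendsto_norm[OF t]])
      then have "\<forall>\<^sub>F n in sequentially. s n t = s' n t"
        by eventually_elim (simp add: s'_def A_def)
      with t show ?thesis by (rule Lim_transform_eventually)
    qed
  qed
  have "0 \<le> G t" for t using G(2)[of t] norm_ge_zero order_trans by blast
  then have Gnn: "(\<integral>\<^sup>+ t. ennreal (2 * G t) \<partial>lebesgue) < \<infinity>"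
    using nn_integral_eq_integral[OF integrable_mult_right[OF G(1), of 2]] by simp
  have nle: "norm (f t - s' n t) \<le> 3 * G t" for n t
    using norm_triangle_ineq4[of "f t" "s' n t"] s'_le[of n t] G(2)[of t] by simp
  have s'_int: "Bochner_Integration.simple_bochner_integrable lebesgue (s' n)" for n
  proof (rule Bochner_Integration.simple_bochner_integrableI_bounded[OF s'_sf])
    have "(\<integral>\<^sup>+ t. ennreal (norm (s' n t)) \<partial>lebesgue) \<le> (\<integral>\<^sup>+ t. ennreal (2 * G t) \<partial>lebesgue)"
      using s'_le G(2) by (intro nn_integral_mono ennreal_leI) (smt (verit))
    then show "(\<integral>\<^sup>+ t. ennreal (norm (s' n t)) \<partial>lebesgue) < \<infinity>"
      using Gnn by (simp add: order_le_less_trans)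
  qed
  have d_meas: "(\<lambda>t. norm (f t - s' n t)) \<in> borel_measurable lebesgue" for n
    by (rule borel_measurable_norm_diff_simple[OF f s'_sf])
  have dint: "integrable lebesgue (\<lambda>t. norm (f t - s' n t))" for n
    by (rule Bochner_Integration.integrable_bound[OF integrable_mult_right[OF G(1), of 3] d_meas])
      (use nle in \<open>auto intro!: AE_I2 order_trans[OF nle]\<close>)
  have "(\<lambda>n. \<integral>t. norm (f t - s' n t) \<partial>lebesgue) \<longlonglongrightarrow> (\<integral>t. 0 \<partial>(lebesgue :: real measure))"
  proof (rule Bochner_Integration.integral_dominated_convergence[where w = "\<lambda>t. 3 * G t"])
    show "AE t in lebesgue. (\<lambda>n. norm (f t - s' n t)) \<longlonglongrightarrow> 0"
      using s'_lim
    proof eventually_elim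
      fix t assume "(\<lambda>n. s' n t) \<longlonglongrightarrow> f t"
      from tendsto_norm[OF tendsto_diff[OF tendsto_const[of "f t"] this]]
      show "(\<lambda>n. norm (f t - s' n t)) \<longlonglongrightarrow> 0" by simp
    qed
    show "AE t in lebesgue. norm (norm (f t - s' n t)) \<le> 3 * G t" for n
      using nle by simp
    show "integrable lebesgue (\<lambda>t. 3 * G t)" using G(1) by simp
  qed (use d_meas in simp_all)
  then have e0: "(\<lambda>n. \<integral>t. norm (f t - s' n t) \<partial>lebesgue) \<longlonglongrightarrow> 0" by simp
  have dnn: "(\<integral>\<^sup>+ t. norm (f t - s' n t) \<partial>lebesgue) = ennreal (\<integral>t. norm (f t - s' n t) \<partial>lebesgue)" for n
    by (rule nn_integral_eq_integral[OF dint]) simp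
  \<comment> \<open>The integrals of the truncated simple functions form a Cauchy sequence because
    both functions are close to \<open>f\<close> in mean; completeness of the space supplies the
    value of the integral.\<close>
  have *: "norm (?I (s' m) - ?I (s' n)) \<le> (\<integral>t. norm (f t - s' m t) \<partial>lebesgue) + (\<integral>t. norm (f t - s' n t) \<partial>lebesgue)" for m n
  proof -
    have "ennreal (norm (?I (s' m) - ?I (s' n))) = norm (?I (\<lambda>t. s' m t - s' n t))"
      by (simp add: Bochner_Integration.simple_bochner_integral_diff[OF s'_int s'_int])
    also have "\<dots> \<le> ?I (\<lambda>t. norm (s' m t - s' n t))"
      using Bochner_Integration.simple_bochner_integrable_compose2[of "(-)", OF _ s'_int s'_int]
      by (auto intro!: ennreal_leI Bochner_Integration.simple_bochner_integral_norm_bound)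
    also have "\<dots> = (\<integral>\<^sup>+ t. norm (s' m t - s' n t) \<partial>lebesgue)"
      using Bochner_Integration.simple_bochner_integrable_compose2[of "\<lambda>x y. norm (x - y)", OF _ s'_int s'_int]
      by (auto intro!: Bochner_Integration.simple_bochner_integral_eq_nn_integral)
    also have "\<dots> \<le> (\<integral>\<^sup>+ t. ennreal (norm (f t - s' m t)) + ennreal (norm (f t - s' n t)) \<partial>lebesgue)"
    proof (rule nn_integral_mono)
      fix t
      have "norm (s' m t - s' n t) \<le> norm (f t - s' m t) + norm (f t - s' n t)"
        by (metis dual_order.refl norm_diff_triangle_le norm_minus_commute)
      then show "ennreal (norm (s' m t - s' n t)) \<le> ennreal (norm (f t - s' m t)) + ennreal (norm (f t - s' n t))"
        by (simp flip: ennreal_plus)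
    qed
    also have "\<dots> = ennreal (\<integral>t. norm (f t - s' m t) \<partial>lebesgue) + ennreal (\<integral>t. norm (f t - s' n t) \<partial>lebesgue)"
      using d_meas by (subst nn_integral_add) (auto simp: dnn)
    finally show ?thesis by (simp flip: ennreal_plus)
  qed
  have "Cauchy (\<lambda>n. ?I (s' n))"
  proof (rule metric_CauchyI)
    fix e :: real assume "e > 0"
    then obtain M where M: "\<And>n. n \<ge> M \<Longrightarrow> (\<integral>t. norm (f t - s' n t) \<partial>lebesgue) < e / 2"
      using order_tendstoD(2)[OF e0, of "e / 2"] by (auto simp: eventually_sequentially)
    show "\<exists>M. \<forall>m\<ge>M. \<forall>n\<ge>M. dist (?I (s' m)) (?I (s' n)) < e"
    proof (intro exI[of _ M] allI impI)
      fix m n assume "m \<ge> M" "n \<ge> M"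
      with M[of m] M[of n] *[of m n] show "dist (?I (s' m)) (?I (s' n)) < e"
        by (simp add: dist_norm)
    qed
  qed
  then obtain y where "(\<lambda>n. ?I (s' n)) \<longlonglongrightarrow> y"
    using Cauchy_convergent convergent_def by blast
  moreover have "(\<lambda>n. \<integral>\<^sup>+ t. norm (f t - s' n t) \<partial>lebesgue) \<longlonglongrightarrow> 0"
    unfolding dnn using e0 by (subst ennreal_0[symmetric], subst tendsto_ennreal_iff) auto
  ultimately show ?thesis
    unfolding bochner_integrable_def bochner_has_integral_def using f s'_int by blast
qed

section \<open>Strong measurability and scalar multiplication\<close>

lemma bounded_bilinear_scaleC: "bounded_bilinear (scaleC :: complex \<Rightarrow> 'a \<Rightarrow> 'a::complex_banach)"
proof
  fix c d :: complex and x y :: 'a and r :: real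
  show "(c + d) *\<^sub>C x = c *\<^sub>C x + d *\<^sub>C x" by (rule scaleC_add_left)
  show "c *\<^sub>C (x + y) = c *\<^sub>C x + c *\<^sub>C y" by (rule scaleC_add_right)
  show "(r *\<^sub>R c) *\<^sub>C x = r *\<^sub>R c *\<^sub>C x"
    by (simp add: scaleC_of_real[symmetric] scaleC_scaleC scaleR_conv_of_real)
  show "c *\<^sub>C r *\<^sub>R x = r *\<^sub>R c *\<^sub>C x"
    by (simp add: scaleC_of_real[symmetric] scaleC_scaleC mult.commute)
  show "\<exists>K. \<forall>a b. norm (a *\<^sub>C (b::'a)) \<le> norm a * norm b * K"
    by (rule exI[of _ 1]) (simp add: norm_scaleC)
qed

interpretation scaleC: bounded_bilinear "scaleC :: complex \<Rightarrow> 'a \<Rightarrow> 'a::complex_banach"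
  by (rule bounded_bilinear_scaleC)

lemma scaleC_one [simp]: "1 *\<^sub>C (x::'a::complex_banach) = x"
  using scaleC_of_real[of 1 x] by simp

text \<open>Applying \<open>p\<close> to simple functions gives simple functions, and sequential
  continuity preserves the limits. Sums, scalar multiples and, with \<open>p\<close> ignoring an
  argument, bounded operators are all instances.\<close>

lemma strongly_measurable_compose2:
  fixes f :: "real \<Rightarrow> 'a::real_normed_vector" and g :: "real \<Rightarrow> 'b::real_normed_vector"
    and p :: "'a \<Rightarrow> 'b \<Rightarrow> 'c::real_normed_vector"
  assumes f: "strongly_measurable_on UNIV f" and g: "strongly_measurable_on UNIV g"
    and p: "\<And>a b X Y. X \<longlonglongrightarrow> a \<Longrightarrow> Y \<longlonglongrightarrow> b \<Longrightarrow> (\<lambda>n. p (X n) (Y n)) \<longlonglongrightarrow> p a b"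
  shows "strongly_measurable_on UNIV (\<lambda>t. p (f t) (g t))"
proof -
  obtain s :: "nat \<Rightarrow> real \<Rightarrow> 'a" where s: "\<And>n. simple_function lebesgue (s n)"
    "AE t in lebesgue. (\<lambda>n. s n t) \<longlonglongrightarrow> f t"
    using f by (auto simp: strongly_measurable_on_def)
  obtain r :: "nat \<Rightarrow> real \<Rightarrow> 'b" where r: "\<And>n. simple_function lebesgue (r n)"
    "AE t in lebesgue. (\<lambda>n. r n t) \<longlonglongrightarrow> g t"
    using g by (auto simp: strongly_measurable_on_def)
  have "AE t in lebesgue. (\<lambda>n. p (s n t) (r n t)) \<longlonglongrightarrow> p (f t) (g t)"
    using s(2) r(2) by eventually_elim (rule p)
  moreover have "simple_function lebesgue (\<lambda>t. p (s n t) (r n t))" for n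
    by (rule simple_function_compose2[OF s(1) r(1)])
  ultimately show ?thesis
    unfolding strongly_measurable_on_def by (intro exI[of _ "\<lambda>n t. p (s n t) (r n t)"]) auto
qed

lemma strongly_measurable_borel:
  fixes f :: "real \<Rightarrow> 'a::{real_normed_vector, second_countable_topology}"
  assumes "f \<in> borel_measurable lebesgue"
  shows "strongly_measurable_on UNIV f"
proof -
  obtain F where F: "\<And>i. simple_function lebesgue (F i)" "\<And>x. (\<lambda>i. F i x) \<longlonglongrightarrow> f x"
    using borel_measurable_implies_sequence_metric[OF assms, of 0] by auto
  then show ?thesis unfolding strongly_measurable_on_def by (intro exI[of _ F]) auto
qed

lemma strongly_measurable_continuous:
  fixes f :: "real \<Rightarrow> 'a::real_normed_vector"
  assumes "continuous_on UNIV f"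
  shows "strongly_measurable_on UNIV f"
proof -
  \<comment> \<open>Simple approximations of the identity of the line are composed with
    \<open>f\<close>, so the target space may be nonseparable.\<close>
  have "strongly_measurable_on UNIV (\<lambda>t::real. t)"
    by (rule strongly_measurable_borel) (simp add: measurable_completion)
  from strongly_measurable_compose2[OF this this, where p = "\<lambda>a b. f a"] show ?thesis
    using assms by (auto simp: continuous_on_eq_continuous_at intro: isCont_tendsto_compose)
qed

lemma strongly_measurable_scaleC:
  fixes f :: "real \<Rightarrow> 'a::complex_banach"
  assumes "g \<in> borel_measurable lebesgue" "strongly_measurable_on UNIV f"
  shows "strongly_measurable_on UNIV (\<lambda>t. g t *\<^sub>C f t)"
  by (rule strongly_measurable_compose2[OF strongly_measurable_borel[OF assms(1)] assms(2)])
    (rule scaleC.tendsto)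

lemma strongly_measurable_scaleR:
  fixes f :: "real \<Rightarrow> 'a::real_normed_vector"
  assumes "g \<in> borel_measurable lebesgue" "strongly_measurable_on UNIV f"
  shows "strongly_measurable_on UNIV (\<lambda>t. g t *\<^sub>R f t)"
  by (rule strongly_measurable_compose2[OF strongly_measurable_borel[OF assms(1)] assms(2)])
    (rule tendsto_scaleR)

lemma strongly_measurable_bounded_linear:
  fixes f :: "real \<Rightarrow> 'a::real_normed_vector"
  assumes "bounded_linear R" "strongly_measurable_on UNIV f"
  shows "strongly_measurable_on UNIV (\<lambda>t. R (f t))"
  by (rule strongly_measurable_compose2[OF assms(2) assms(2), where p = "\<lambda>a b. R a"])
    (rule bounded_linear.tendsto[OF assms(1)])

lemma strongly_measurable_add:
  fixes f g :: "real \<Rightarrow> 'a::real_normed_vector"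
  assumes "strongly_measurable_on UNIV f" "strongly_measurable_on UNIV g"
  shows "strongly_measurable_on UNIV (\<lambda>t. f t + g t)"
  by (rule strongly_measurable_compose2[OF assms]) (rule tendsto_add)

text \<open>An affine bijection scales Lebesgue measure by a constant, so the exceptional null set
  has a null preimage. The case \<open>c = -1\<close> is the reflection in a convolution,
  \<open>c = 1\<close> a translation.\<close>

lemma strongly_measurable_affine:
  fixes f :: "real \<Rightarrow> 'a::real_normed_vector"
  assumes f: "strongly_measurable_on UNIV f" and c: "c \<noteq> 0"
  shows "strongly_measurable_on UNIV (\<lambda>s. f (t + c * s))"
proof -
  let ?T = "\<lambda>s. t + c * s"
  obtain s :: "nat \<Rightarrow> real \<Rightarrow> 'a" where s: "\<And>n. simple_function lebesgue (s n)"
    "AE t in lebesgue. (\<lambda>n. s n t) \<longlonglongrightarrow> f t"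
    using f by (auto simp: strongly_measurable_on_def)
  have T: "?T \<in> lebesgue \<rightarrow>\<^sub>M lebesgue"
    using lebesgue_affine_measurable[where c = "\<lambda>x::real. c"] c by simp
  have "simple_function lebesgue (\<lambda>x. s n (?T x))" for n
    unfolding simple_function_def
  proof safe
    show "finite ((\<lambda>x. s n (?T x)) ` space lebesgue)"
      by (rule finite_subset[OF _ simple_functionD(1)[OF s(1)[of n]]]) auto
    show "(\<lambda>x. s n (?T x)) -` {s n (?T x)} \<inter> space lebesgue \<in> sets lebesgue" for x
      using measurable_sets[OF T simple_functionD(2)[OF s(1)[of n], of "{s n (?T x)}"]]
      by (simp add: vimage_def)
  qed
  moreover have "AE x in lebesgue. (\<lambda>n. s n (?T x)) \<longlonglongrightarrow> f (?T x)"
  proof -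
    have "AE x in density (distr lebesgue lebesgue ?T) (\<lambda>_. ennreal (abs c)). (\<lambda>n. s n x) \<longlonglongrightarrow> f x"
      by (rule arg_cong[where f = "\<lambda>M. AE x in M. (\<lambda>n. s n x) \<longlonglongrightarrow> f x", THEN iffD1,
            OF lebesgue_real_affine[OF c, of t] s(2)])
    then have "AE x in distr lebesgue lebesgue ?T. (\<lambda>n. s n x) \<longlonglongrightarrow> f x"
      using c by (subst (asm) AE_density) auto
    then obtain N where N: "{x. \<not> (\<lambda>n. s n x) \<longlonglongrightarrow> f x} \<subseteq> N" "N \<in> null_sets (distr lebesgue lebesgue ?T)"
      by (auto simp: eventually_ae_filter)
    then have "?T -` N \<in> null_sets lebesgue"
      using T by (auto simp: null_sets_distr_iff)
    from AE_not_in[OF this] show ?thesis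
      by eventually_elim (use N(1) in auto)
  qed
  ultimately show ?thesis
    unfolding strongly_measurable_on_def by (intro exI[of _ "\<lambda>n x. s n (?T x)"]) auto
qed

lemma strongly_measurable_restrict:
  fixes f :: "real \<Rightarrow> 'a::real_normed_vector"
  assumes f: "strongly_measurable_on J f" and S: "S \<subseteq> J" "S \<in> sets lebesgue"
  shows "strongly_measurable_on UNIV (\<lambda>t. if t \<in> S then f t else 0)"
proof -
  obtain s :: "nat \<Rightarrow> real \<Rightarrow> 'a" where s: "\<And>n. simple_function lebesgue (s n)"
    "AE t in lebesgue. t \<in> J \<longrightarrow> (\<lambda>n. s n t) \<longlonglongrightarrow> f t"
    using f by (auto simp: strongly_measurable_on_def)
  have "simple_function lebesgue (\<lambda>t. if t \<in> S then s n t else 0)" for n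
    using S by (intro simple_function_If_set s) auto
  moreover have "AE t in lebesgue. (\<lambda>n. if t \<in> S then s n t else 0) \<longlonglongrightarrow> (if t \<in> S then f t else 0)"
    using s(2) by eventually_elim (use S in auto)
  ultimately show ?thesis
    unfolding strongly_measurable_on_def
    by (intro exI[of _ "\<lambda>n t. if t \<in> S then s n t else 0"]) auto
qed

section \<open>Convolution with a bounded strongly measurable function\<close>

text \<open>The bound is a parameter because the estimates for convolutions and for the Neumann
  series are quantitative. The domain is the whole line: functions on \<open>J'\<close> enter
  through their extension by 0.\<close>

definition bounded_sm :: "real \<Rightarrow> (real \<Rightarrow> 'a::real_normed_vector) \<Rightarrow> bool" where
  "bounded_sm M \<Phi> \<longleftrightarrow> strongly_measurable_on UNIV \<Phi> \<and> (\<forall>t. norm (\<Phi> t) \<le> M)"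

lemma bounded_smD:
  assumes "bounded_sm M \<Phi>"
  shows "strongly_measurable_on UNIV \<Phi>" "norm (\<Phi> t) \<le> M" "0 \<le> M"
  using assms order_trans[OF norm_ge_zero, of "\<Phi> 0" M] by (auto simp: bounded_sm_def)

lemma has_integral_translate_UNIV:
  fixes f :: "real \<Rightarrow> 'a::banach"
  assumes "(f has_integral i) UNIV"
  shows "((\<lambda>s. f (s + c)) has_integral i) UNIV"
  unfolding has_integral_alt'
proof (intro conjI allI impI)
  have f: "f integrable_on cbox a b" for a b
    using assms unfolding has_integral_alt' by simp
  then show "(\<lambda>x. if x \<in> UNIV then f (x + c) else 0) integrable_on cbox a b" for a b
    using integrable_on_shift_cbox[of f c a b] by (simp add: o_def add.commute)
  fix e :: real assume "e > 0"
  then obtain B where B: "B > 0" "\<And>a b. ball 0 B \<subseteq> cbox a b \<Longrightarrow> norm (integral (cbox a b) f - i) < e"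
    using assms[unfolded has_integral_alt'] by auto
  show "\<exists>B>0. \<forall>a b. ball 0 B \<subseteq> cbox a b \<longrightarrow>
      norm (integral (cbox a b) (\<lambda>x. if x \<in> UNIV then f (x + c) else 0) - i) < e"
  proof (intro exI[of _ "B + \<bar>c\<bar>"] conjI allI impI)
    show "0 < B + \<bar>c\<bar>" using B(1) by simp
    fix a b :: real assume *: "ball 0 (B + \<bar>c\<bar>) \<subseteq> cbox a b"
    have "ball 0 B \<subseteq> cbox (a + c) (b + c)"
    proof
      fix x :: real assume "x \<in> ball 0 B"
      then have "x - c \<in> ball 0 (B + \<bar>c\<bar>)" by auto
      with * have "x - c \<in> cbox a b" by blast
      then show "x \<in> cbox (a + c) (b + c)" by auto
    qed
    from B(2)[OF this] show "norm (integral (cbox a b) (\<lambda>x. if x \<in> UNIV then f (x + c) else 0) - i) < e"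
      using integral_shift_cbox_plus[of a b f c] by (simp add: o_def add.commute)
  qed
qed

lemma bochner_integrable_scaleC:
  fixes \<Phi> :: "real \<Rightarrow> 'a::complex_banach"
  assumes f: "integrable lebesgue f" and P: "bounded_sm M \<Phi>" and c: "c \<noteq> 0"
  shows "bochner_integrable lebesgue (\<lambda>s. f s *\<^sub>C \<Phi> (t + c * s))"
proof (rule bochner_integrableI)
  show "strongly_measurable_on UNIV (\<lambda>s. f s *\<^sub>C \<Phi> (t + c * s))"
    using f by (intro strongly_measurable_scaleC strongly_measurable_affine bounded_smD[OF P] c)
      (auto dest: borel_measurable_integrable)
  show "integrable lebesgue (\<lambda>s. M * norm (f s))"
    using f by simp
  show "norm (f s *\<^sub>C \<Phi> (t + c * s)) \<le> M * norm (f s)" for s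
    using bounded_smD(2)[OF P] by (simp add: norm_scaleC mult.commute[of M] mult_left_mono)
qed

lemma
  fixes \<Phi> :: "real \<Rightarrow> 'a::complex_banach"
  assumes f: "integrable lebesgue f" and P: "bounded_sm M \<Phi>"
  shows convolution_integrable: "(\<lambda>s. f s *\<^sub>C \<Phi> (t - s)) integrable_on UNIV"
    and convolution_eq_integral: "convolution \<Phi> f t = integral UNIV (\<lambda>s. f s *\<^sub>C \<Phi> (t - s))"
  using bochner_integral_eq_integral[OF bochner_integrable_scaleC[OF f P, of "-1" t]]
  by (simp_all add: convolution_def)

lemma norm_convolution_le:
  fixes \<Phi> :: "real \<Rightarrow> 'a::complex_banach"
  assumes f: "integrable lebesgue f" and P: "bounded_sm M \<Phi>"
  shows "norm (convolution \<Phi> f t) \<le> M * (\<integral>s. norm (f s) \<partial>lebesgue)"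
proof -
  have int: "integrable lebesgue (\<lambda>s. M * norm (f s))" using f by simp
  have "norm (convolution \<Phi> f t) \<le> integral UNIV (\<lambda>s. M * norm (f s))"
    unfolding convolution_eq_integral[OF f P]
  proof (rule integral_norm_bound_integral[OF convolution_integrable[OF f P]])
    show "(\<lambda>s. M * norm (f s)) integrable_on UNIV" using integrable_on_lebesgue[OF int] .
    show "norm (f s *\<^sub>C \<Phi> (t - s)) \<le> M * norm (f s)" for s
      using bounded_smD(2)[OF P] by (simp add: norm_scaleC mult.commute[of M] mult_left_mono)
  qed
  then show ?thesis unfolding integral_lebesgue[OF int] by simp
qed

lemma convolution_add:
  fixes \<Phi> :: "real \<Rightarrow> 'a::complex_banach"
  assumes f: "integrable lebesgue f" and g: "integrable lebesgue g" and P: "bounded_sm M \<Phi>"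
  shows "convolution \<Phi> (\<lambda>s. f s + g s) t = convolution \<Phi> f t + convolution \<Phi> g t"
  using convolution_integrable[OF f P] convolution_integrable[OF g P]
  by (simp add: convolution_eq_integral[OF _ P] f g scaleC_add_left Henstock_Kurzweil_Integration.integral_add)

lemma convolution_diff:
  fixes \<Phi> :: "real \<Rightarrow> 'a::complex_banach"
  assumes f: "integrable lebesgue f" and g: "integrable lebesgue g" and P: "bounded_sm M \<Phi>"
  shows "convolution \<Phi> (\<lambda>s. f s - g s) t = convolution \<Phi> f t - convolution \<Phi> g t"
  using convolution_integrable[OF f P] convolution_integrable[OF g P]
  by (simp add: convolution_eq_integral[OF _ P] f g scaleC.diff_left Henstock_Kurzweil_Integration.integral_diff)

lemma convolution_cmult:
  fixes \<Phi> :: "real \<Rightarrow> 'a::complex_banach"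
  assumes f: "integrable lebesgue f" and P: "bounded_sm M \<Phi>"
  shows "convolution \<Phi> (\<lambda>s. c * f s) t = c *\<^sub>C convolution \<Phi> f t"
  using integral_linear[OF convolution_integrable[OF f P] scaleC.bounded_linear_right, of c t]
  by (simp add: convolution_eq_integral[OF _ P] f scaleC_scaleC[symmetric] o_def)

lemma convolution_translate:
  fixes \<Phi> :: "real \<Rightarrow> 'a::complex_banach"
  assumes f: "integrable lebesgue f" and P: "bounded_sm M \<Phi>"
  shows "convolution \<Phi> f (t + a) = convolution \<Phi> (\<lambda>s. f (s + a)) t"
proof -
  have fa: "integrable lebesgue (\<lambda>s. f (s + a))"
    using f lebesgue_integrable_real_affine_iff[of 1 f a] by (simp add: add.commute)
  have "((\<lambda>s. f (s + a) *\<^sub>C \<Phi> (t + a - (s + a))) has_integral convolution \<Phi> f (t + a)) UNIV"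
    unfolding convolution_eq_integral[OF f P]
    by (rule has_integral_translate_UNIV[OF integrable_integral[OF convolution_integrable[OF f P]]])
  then show ?thesis
    unfolding convolution_eq_integral[OF fa P] by (simp add: integral_unique)
qed

lemma bounded_sm_bounded_linear:
  assumes R: "bounded_linear R" and P: "bounded_sm M \<Phi>"
  shows "bounded_sm (onorm R * M) (\<lambda>t. R (\<Phi> t))"
  unfolding bounded_sm_def
proof (intro conjI allI)
  show "strongly_measurable_on UNIV (\<lambda>t. R (\<Phi> t))"
    by (rule strongly_measurable_bounded_linear[OF R bounded_smD(1)[OF P]])
  fix t
  have "norm (R (\<Phi> t)) \<le> onorm R * norm (\<Phi> t)" by (rule onorm[OF R])
  also have "\<dots> \<le> onorm R * M"
    using bounded_smD(2)[OF P] onorm_pos_le[OF R] by (rule mult_left_mono)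
  finally show "norm (R (\<Phi> t)) \<le> onorm R * M" .
qed

lemma convolution_bounded_clinear:
  fixes \<Phi> :: "real \<Rightarrow> 'a::complex_banach"
  assumes R: "bounded_clinear R" and f: "integrable lebesgue f" and P: "bounded_sm M \<Phi>"
  shows "convolution (\<lambda>t. R (\<Phi> t)) f t = R (convolution \<Phi> f t)"
proof -
  have R1: "bounded_linear R" and R2: "\<And>c x. R (c *\<^sub>C x) = c *\<^sub>C R x"
    using R by (auto simp: bounded_clinear_def)
  show ?thesis
    using integral_linear[OF convolution_integrable[OF f P] R1, of t]
    by (simp add: convolution_eq_integral[OF f P] R2 o_def
        convolution_eq_integral[OF f bounded_sm_bounded_linear[OF R1 P]])
qed

section \<open>Closed subspaces of the integrable functions on the line\<close>

abbreviation L1_norm :: "(real \<Rightarrow> complex) \<Rightarrow> real" where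
  "L1_norm f \<equiv> (\<integral>t. norm (f t) \<partial>lborel)"

text \<open>The elements are functions, not classes; the closure condition, applied to functions at
  distance 0, makes the set stable under changes on null sets.\<close>

definition L1_closed_subspace :: "(real \<Rightarrow> complex) set \<Rightarrow> bool" where
  "L1_closed_subspace V \<longleftrightarrow>
     V \<subseteq> Collect (integrable lborel) \<and> (\<lambda>_. 0) \<in> V \<and>
     (\<forall>f\<in>V. \<forall>g\<in>V. (\<lambda>t. f t + g t) \<in> V) \<and> (\<forall>c. \<forall>f\<in>V. (\<lambda>t. c * f t) \<in> V) \<and>
     (\<forall>f. integrable lborel f \<and> (\<forall>e>0. \<exists>g\<in>V. L1_norm (\<lambda>t. f t - g t) < e) \<longrightarrow> f \<in> V)"

lemma L1_closed_subspaceD: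
  assumes "L1_closed_subspace V"
  shows "f \<in> V \<Longrightarrow> integrable lborel f" "(\<lambda>_. 0) \<in> V"
    "f \<in> V \<Longrightarrow> g \<in> V \<Longrightarrow> (\<lambda>t. f t + g t) \<in> V" "f \<in> V \<Longrightarrow> (\<lambda>t. c * f t) \<in> V"
    "integrable lborel f \<Longrightarrow> (\<And>e. e > 0 \<Longrightarrow> \<exists>g\<in>V. L1_norm (\<lambda>t. f t - g t) < e) \<Longrightarrow> f \<in> V"
  using assms unfolding L1_closed_subspace_def by auto

lemma L1_closed_subspace_lim:
  assumes V: "L1_closed_subspace V" and f: "integrable lborel f" and s: "\<And>n. s n \<in> V"
    and lim: "(\<lambda>n. L1_norm (\<lambda>t. f t - s n t)) \<longlonglongrightarrow> 0"
  shows "f \<in> V"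
proof (rule L1_closed_subspaceD(5)[OF V f])
  fix e :: real assume "e > 0"
  then have "\<forall>\<^sub>F n in sequentially. L1_norm (\<lambda>t. f t - s n t) < e"
    by (rule order_tendstoD(2)[OF lim])
  then show "\<exists>g\<in>V. L1_norm (\<lambda>t. f t - g t) < e"
    using s by (auto simp: eventually_sequentially)
qed

lemma L1_closed_subspace_dominated_lim:
  assumes V: "L1_closed_subspace V" and f: "integrable lborel f" and s: "\<And>n. s n \<in> V"
    and w: "integrable lborel w" "\<And>n t. norm (f t - s n t) \<le> w t"
    and lim: "\<And>t. (\<lambda>n. s n t) \<longlonglongrightarrow> f t"
  shows "f \<in> V"
proof (rule L1_closed_subspace_lim[where s = s, OF V f s])
  have "(\<lambda>n. L1_norm (\<lambda>t. f t - s n t)) \<longlonglongrightarrow> (\<integral>t. 0 \<partial>(lborel :: real measure))"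
  proof (rule Bochner_Integration.integral_dominated_convergence[where w = w])
    show "(\<lambda>t. norm (f t - s n t)) \<in> borel_measurable lborel" for n
      using f L1_closed_subspaceD(1)[OF V s[of n]] by (simp add: borel_measurable_integrable)
    show "AE t in lborel. (\<lambda>n. norm (f t - s n t)) \<longlonglongrightarrow> 0"
    proof (intro AE_I2)
      fix t from tendsto_norm[OF tendsto_diff[OF tendsto_const[of "f t"] lim[of t]]]
      show "(\<lambda>n. norm (f t - s n t)) \<longlonglongrightarrow> 0" by simp
    qed
    show "AE t in lborel. norm (norm (f t - s n t)) \<le> w t" for n
      using w(2) by simp
  qed (use w(1) in simp_all)
  then show "(\<lambda>n. L1_norm (\<lambda>t. f t - s n t)) \<longlonglongrightarrow> 0" by simp
qed

text \<open>Dynkin's induction passes to complements, which may have infinite measure. Intersecting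
  with a fixed bounded interval keeps every indicator integrable.\<close>

lemma L1_closed_subspace_indicator_bounded:
  assumes V: "L1_closed_subspace V"
    and ivl: "\<And>a b. a \<le> b \<Longrightarrow> (indicator {a..<b} :: real \<Rightarrow> complex) \<in> V"
    and A: "A \<in> sets borel"
  shows "(indicator (A \<inter> {-r..<r}) :: real \<Rightarrow> complex) \<in> V"
proof -
  have ivl': "(indicator {a..<b} :: real \<Rightarrow> complex) \<in> V" for a b
  proof (cases "a \<le> b")
    case False
    then have "(indicator {a..<b} :: real \<Rightarrow> complex) = (\<lambda>_. 0)" by auto
    then show ?thesis using L1_closed_subspaceD(2)[OF V] by simp
  qed (rule ivl)
  let ?I = "{-r..<r}" and ?G = "range (\<lambda>(a, b). {a..<b::real})"
  have intI: "integrable lborel (indicator (B \<inter> ?I) :: real \<Rightarrow> complex)" if "B \<in> sets borel" for B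
  proof -
    have "emeasure lborel (B \<inter> ?I) \<le> emeasure lborel ?I"
      by (intro emeasure_mono) auto
    also have "\<dots> < \<infinity>" by (cases "-r \<le> r") auto
    finally have "integrable lborel (indicat_real (B \<inter> ?I))"
      using that by (intro integrable_real_indicator) auto
    from integrable_of_real[OF this] show ?thesis
      by (simp add: of_real_indicator[abs_def])
  qed
  have sig: "sets borel = sigma_sets UNIV ?G"
    by (simp add: borel_eq_atLeastLessThan)
  have "Int_stable ?G"
  proof (rule Int_stableI, safe)
    fix a b c d :: real
    show "{a..<b} \<inter> {c..<d} \<in> ?G"
      by (intro image_eqI[of _ _ "(max a c, min b d)"]) auto
  qed
  then show ?thesis
  proof (induction A rule: sigma_sets_induct_disjoint[where \<Omega> = UNIV and G = ?G, consumes 1])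
    show "?G \<subseteq> Pow UNIV" by simp
    show "A \<in> sigma_sets UNIV ?G" using A by (simp add: sig)
  next
    fix A assume "A \<in> ?G"
    then obtain a b where "A = {a..<b}" by auto
    moreover have "{a..<b} \<inter> ?I = {max a (-r)..<min b r}" by auto
    ultimately show "(indicator (A \<inter> ?I) :: real \<Rightarrow> complex) \<in> V" using ivl' by simp
  next
    have "(indicator ({} \<inter> ?I) :: real \<Rightarrow> complex) = (\<lambda>_. 0)" by auto
    then show "(indicator ({} \<inter> ?I) :: real \<Rightarrow> complex) \<in> V"
      using L1_closed_subspaceD(2)[OF V] by simp
  next
    fix A assume *: "(indicator (A \<inter> ?I) :: real \<Rightarrow> complex) \<in> V"
    have "(indicator ((UNIV - A) \<inter> ?I) :: real \<Rightarrow> complex) = (\<lambda>t. indicator ?I t + (-1) * indicator (A \<inter> ?I) t)"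
      by (auto simp: indicator_def)
    then show "(indicator ((UNIV - A) \<inter> ?I) :: real \<Rightarrow> complex) \<in> V"
      using L1_closed_subspaceD(3)[OF V ivl' L1_closed_subspaceD(4)[OF V *], of "-r" r "-1"] by simp
  next
    fix A :: "nat \<Rightarrow> real set"
    assume dis: "disjoint_family A" and rA: "range A \<subseteq> sigma_sets UNIV ?G"
      and IH: "\<And>i. (indicator (A i \<inter> ?I) :: real \<Rightarrow> complex) \<in> V"
    have Ab: "A i \<in> sets borel" for i using rA by (auto simp: sig)
    have fin: "(indicator ((\<Union>i<n. A i) \<inter> ?I) :: real \<Rightarrow> complex) \<in> V" for n :: nat
    proof (induction n)
      case 0
      have "(indicator ({} \<inter> ?I) :: real \<Rightarrow> complex) = (\<lambda>_. 0)" by auto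
      then show ?case using L1_closed_subspaceD(2)[OF V] by simp
    next
      case (Suc n)
      have "A n \<inter> A i = {}" if "i < n" for i
        using disjoint_family_onD[OF dis, of n i] that by simp
      then have "A n \<inter> (\<Union>i<n. A i) = {}" by blast
      then have "(indicator ((\<Union>i<Suc n. A i) \<inter> ?I) :: real \<Rightarrow> complex) =
        (\<lambda>t. indicator ((\<Union>i<n. A i) \<inter> ?I) t + indicator (A n \<inter> ?I) t)"
        by (auto simp: indicator_def less_Suc_eq fun_eq_iff)
      then show ?case using L1_closed_subspaceD(3)[OF V Suc IH] by simp
    qed
    show "(indicator ((\<Union>i. A i) \<inter> ?I) :: real \<Rightarrow> complex) \<in> V"
    proof (rule L1_closed_subspace_dominated_lim[where s = "\<lambda>n. indicator ((\<Union>i<n. A i) \<inter> ?I)", OF V _ fin])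
      show "integrable lborel (indicator ((\<Union>i. A i) \<inter> ?I) :: real \<Rightarrow> complex)"
        using Ab by (intro intI) auto
      show "integrable lborel (\<lambda>t. norm (indicator (UNIV \<inter> ?I) t :: complex))"
        by (intro integrable_norm intI) auto
      show "norm (indicator ((\<Union>i. A i) \<inter> ?I) t - indicator ((\<Union>i<n. A i) \<inter> ?I) t :: complex)
          \<le> norm (indicator (UNIV \<inter> ?I) t :: complex)" for n t
        by (auto simp: indicator_def)
      fix t
      show "(\<lambda>n. indicator ((\<Union>i<n. A i) \<inter> ?I) t :: complex) \<longlonglongrightarrow> indicator ((\<Union>i. A i) \<inter> ?I) t"
      proof (cases "t \<in> (\<Union>i. A i) \<inter> ?I")
        case True
        then obtain k where k: "t \<in> A k \<inter> ?I" by auto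
        have "\<forall>\<^sub>F n in sequentially. indicator ((\<Union>i. A i) \<inter> ?I) t = (indicator ((\<Union>i<n. A i) \<inter> ?I) t :: complex)"
          using eventually_gt_at_top[of k] by eventually_elim (use k True in \<open>auto simp: indicator_def\<close>)
        then show ?thesis by (rule Lim_transform_eventually[OF tendsto_const])
      next
        case False
        then have "indicator ((\<Union>i<n. A i) \<inter> ?I) t = (0::complex)" for n by (auto simp: indicator_def)
        with False show ?thesis by simp
      qed
    qed
  qed
qed

text \<open>Half-open intervals generate the Borel sets, and indicators of Borel sets span a dense
  subspace.\<close>

lemma L1_closed_subspace_UNIV:
  assumes V: "L1_closed_subspace V"
    and ivl: "\<And>a b. a \<le> b \<Longrightarrow> (indicator {a..<b} :: real \<Rightarrow> complex) \<in> V"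
    and f: "integrable lborel f"
  shows "f \<in> V"
  using f
proof (induction rule: integrable_induct)
  case (base A c)
  have A: "integrable lborel (indicator A :: real \<Rightarrow> complex)"
    using integrable_of_real[OF integrable_real_indicator[OF base]] by (simp add: of_real_indicator[abs_def])
  have "(indicator A :: real \<Rightarrow> complex) \<in> V"
  proof (rule L1_closed_subspace_dominated_lim[where s = "\<lambda>n. indicator (A \<inter> {-real n..<real n})", OF V A])
    show "(indicator (A \<inter> {-real n..<real n}) :: real \<Rightarrow> complex) \<in> V" for n
      using base by (intro L1_closed_subspace_indicator_bounded V ivl) auto
    show "integrable lborel (\<lambda>t. norm (indicator A t :: complex))" using A by (rule integrable_norm)
    show "norm (indicator A t - indicator (A \<inter> {-real n..<real n}) t :: complex) \<le> norm (indicator A t :: complex)" for n t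
      by (auto simp: indicator_def)
    fix t :: real
    have "\<forall>\<^sub>F n in sequentially. real n > \<bar>t\<bar>"
      using eventually_gt_at_top[of "nat \<lceil>\<bar>t\<bar>\<rceil>"] by eventually_elim linarith
    then have "\<forall>\<^sub>F n in sequentially. indicator A t = (indicator (A \<inter> {-real n..<real n}) t :: complex)"
      by eventually_elim (auto simp: indicator_def)
    then show "(\<lambda>n. indicator (A \<inter> {-real n..<real n}) t :: complex) \<longlonglongrightarrow> indicator A t"
      by (rule Lim_transform_eventually[OF tendsto_const])
  qed
  from L1_closed_subspaceD(4)[OF V this, of c] show ?case
    by (simp add: scaleR_conv_of_real of_real_indicator mult.commute)
next
  case (add f g)
  then show ?case using L1_closed_subspaceD(3)[OF V] by blast
next
  case (lim f s)
  show ?case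
  proof (rule L1_closed_subspace_dominated_lim[where s = s, OF V lim(4,5)])
    show "integrable lborel (\<lambda>t. 3 * norm (f t))" using lim(4) by simp
    show "norm (f t - s n t) \<le> 3 * norm (f t)" for n t
      using norm_triangle_ineq4[of "f t" "s n t"] lim(3)[of t n] by simp
    show "(\<lambda>n. s n t) \<longlonglongrightarrow> f t" for t using lim(2) by simp
  qed
qed

section \<open>Continuity of translation in L1\<close>

lemma integrable_translate:
  fixes f :: "real \<Rightarrow> complex"
  assumes "integrable lborel f"
  shows "integrable lborel (\<lambda>t. f (t + h))" "integrable lborel (\<lambda>t. f (t - h))" "integrable lborel (\<lambda>t. f (h - t))"
  using lborel_integrable_real_affine[OF assms, of 1 h] lborel_integrable_real_affine[OF assms, of 1 "-h"]
    lborel_integrable_real_affine[OF assms, of "-1" h] by (simp_all add: add.commute)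

lemma L1_norm_translate: "L1_norm (\<lambda>t. f (t + h)) = L1_norm f"
  using lborel_integral_real_affine[of 1 "\<lambda>t. norm (f t)" h] by (simp add: add.commute)

lemma L1_norm_translate_diff: "L1_norm (\<lambda>t. f (t - h)) = L1_norm f"
  using L1_norm_translate[of f "-h"] by simp

lemma L1_norm_triangle:
  assumes "integrable lborel f" "integrable lborel g" "integrable lborel h"
    "\<And>t. norm (h t) \<le> norm (f t) + norm (g t)"
  shows "L1_norm h \<le> L1_norm f + L1_norm g"
proof -
  have "L1_norm h \<le> (\<integral>t. norm (f t) + norm (g t) \<partial>lborel)"
    using assms by (intro integral_mono) auto
  then show ?thesis using assms by simp
qed

lemma integrable_indicator_ivl: "integrable lborel (indicator {a..<b::real} :: real \<Rightarrow> complex)"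
proof (cases "a \<le> b")
  case True
  then show ?thesis
    using integrable_of_real[OF integrable_real_indicator[of "{a..<b}" lborel]]
    by (simp add: of_real_indicator[abs_def])
next
  case False
  then have "(indicator {a..<b} :: real \<Rightarrow> complex) = (\<lambda>_. 0)" by auto
  then show ?thesis by simp
qed

text \<open>The two indicators differ only within distance \<open>\<bar>h\<bar>\<close> of an
  endpoint, that is on two intervals of length \<open>2 * \<bar>h\<bar>\<close>.\<close>

lemma L1_norm_indicator_translate:
  assumes "a \<le> b"
  shows "L1_norm (\<lambda>t. indicator {a..<b} (t + h) - indicator {a..<b} t) \<le> 4 * \<bar>h\<bar>"
proof -
  have "L1_norm (\<lambda>t. indicator {a..<b} (t + h) - indicator {a..<b} t) \<le>
      (\<integral>t. indicat_real {a - \<bar>h\<bar>..a + \<bar>h\<bar>} t + indicat_real {b - \<bar>h\<bar>..b + \<bar>h\<bar>} t \<partial>lborel)"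
  proof (rule integral_mono)
    from integrable_translate(1)[OF integrable_indicator_ivl[of a b], of h] integrable_indicator_ivl[of a b]
    show "integrable lborel (\<lambda>t. norm (indicator {a..<b} (t + h) - indicator {a..<b} t :: complex))"
      by simp
    show "norm (indicator {a..<b} (t + h) - indicator {a..<b} t :: complex) \<le>
        indicator {a - \<bar>h\<bar>..a + \<bar>h\<bar>} t + indicator {b - \<bar>h\<bar>..b + \<bar>h\<bar>} t" for t
      by (auto simp: indicator_def)
  qed auto
  also have "\<dots> = 4 * \<bar>h\<bar>" by (subst Bochner_Integration.integral_add) auto
  finally show ?thesis .
qed

text \<open>The functions whose translates depend continuously on the shift at 0 form a closed
  subspace, by a three-epsilon argument that uses translation invariance of the norm. It contains
  the interval indicators, hence everything.\<close>

lemma L1_translation_continuous: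
  assumes f: "integrable lborel f" and e: "e > 0"
  shows "\<exists>d>0. \<forall>h. \<bar>h\<bar> < d \<longrightarrow> L1_norm (\<lambda>t. f (t + h) - f t) < e"
proof -
  let ?P = "\<lambda>f. \<forall>e>0. \<exists>d>0. \<forall>h. \<bar>h\<bar> < d \<longrightarrow> L1_norm (\<lambda>t. f (t + h) - f t) < e"
  let ?V = "{f. integrable lborel f \<and> ?P f}"
  have "L1_closed_subspace ?V"
    unfolding L1_closed_subspace_def
  proof (intro conjI ballI allI impI)
    show "?V \<subseteq> Collect (integrable lborel)" by auto
    show "(\<lambda>_. 0) \<in> ?V" by (auto intro: exI[of _ 1])
  next
    fix f g assume fg: "f \<in> ?V" "g \<in> ?V"
    then have int: "integrable lborel f" "integrable lborel g" by auto
    have "\<exists>d>0. \<forall>h. \<bar>h\<bar> < d \<longrightarrow> L1_norm (\<lambda>t. f (t + h) + g (t + h) - (f t + g t)) < e" if e: "e > 0" for e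
    proof -
      have Pf: "?P f" and Pg: "?P g" using fg by auto
      obtain d1 where d1: "d1 > 0" "\<And>h. \<bar>h\<bar> < d1 \<Longrightarrow> L1_norm (\<lambda>t. f (t + h) - f t) < e / 2"
        using Pf[rule_format, OF half_gt_zero[OF e]] by auto
      obtain d2 where d2: "d2 > 0" "\<And>h. \<bar>h\<bar> < d2 \<Longrightarrow> L1_norm (\<lambda>t. g (t + h) - g t) < e / 2"
        using Pg[rule_format, OF half_gt_zero[OF e]] by auto
      show ?thesis
      proof (intro exI[of _ "min d1 d2"] conjI allI impI)
        fix h :: real assume h: "\<bar>h\<bar> < min d1 d2"
        have "L1_norm (\<lambda>t. f (t + h) + g (t + h) - (f t + g t)) \<le>
          L1_norm (\<lambda>t. f (t + h) - f t) + L1_norm (\<lambda>t. g (t + h) - g t)"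
        proof (rule L1_norm_triangle)
          show "norm (f (t + h) + g (t + h) - (f t + g t)) \<le> norm (f (t + h) - f t) + norm (g (t + h) - g t)" for t
            by (simp add: norm_diff_triangle_ineq)
        qed (use int integrable_translate(1)[OF int(1), of h] integrable_translate(1)[OF int(2), of h] in simp_all)
        with d1(2)[of h] d2(2)[of h] h
        show "L1_norm (\<lambda>t. f (t + h) + g (t + h) - (f t + g t)) < e" by linarith
      qed (use d1 d2 in auto)
    qed
    then show "(\<lambda>t. f t + g t) \<in> ?V" using int by auto
  next
    fix c f assume f: "f \<in> ?V"
    have "\<exists>d>0. \<forall>h. \<bar>h\<bar> < d \<longrightarrow> L1_norm (\<lambda>t. c * f (t + h) - c * f t) < e" if "e > 0" for e
    proof -
      \<comment> \<open>Adding 1 avoids a division by zero when \<open>c = 0\<close>; the same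
        device recurs with other bounds below.\<close>
      have "e / (norm c + 1) > 0" using that by (simp add: add_nonneg_pos)
      with f obtain d where d: "d > 0" "\<And>h. \<bar>h\<bar> < d \<Longrightarrow> L1_norm (\<lambda>t. f (t + h) - f t) < e / (norm c + 1)"
        by blast
      show ?thesis
      proof (intro exI[of _ d] conjI allI impI d(1))
        fix h :: real assume h: "\<bar>h\<bar> < d"
        have "L1_norm (\<lambda>t. c * f (t + h) - c * f t) = norm c * L1_norm (\<lambda>t. f (t + h) - f t)"
          by (simp add: right_diff_distrib[symmetric] norm_mult)
        also have "\<dots> \<le> (norm c + 1) * L1_norm (\<lambda>t. f (t + h) - f t)"
          by (intro mult_right_mono) auto
        also have "\<dots> < e" using d(2)[OF h] pos_less_divide_eq[of "norm c + 1" _ e]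
          by (simp add: mult.commute add_nonneg_pos)
        finally show "L1_norm (\<lambda>t. c * f (t + h) - c * f t) < e" .
      qed
    qed
    then show "(\<lambda>t. c * f t) \<in> ?V" using f by auto
  next
    fix f assume f: "integrable lborel f \<and> (\<forall>e>0. \<exists>g\<in>?V. L1_norm (\<lambda>t. f t - g t) < e)"
    have "\<exists>d>0. \<forall>h. \<bar>h\<bar> < d \<longrightarrow> L1_norm (\<lambda>t. f (t + h) - f t) < e" if "e > 0" for e
    proof -
      have e3: "e / 3 > 0" using that by simp
      with f obtain g where g: "integrable lborel g" "?P g" "L1_norm (\<lambda>t. f t - g t) < e / 3"
        by blast
      with e3 obtain d where d: "d > 0" "\<And>h. \<bar>h\<bar> < d \<Longrightarrow> L1_norm (\<lambda>t. g (t + h) - g t) < e / 3"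
        by blast
      note int = conjunct1[OF f] g(1)
      show ?thesis
      proof (intro exI[of _ d] conjI allI impI d(1))
        fix h :: real assume h: "\<bar>h\<bar> < d"
        have 1: "L1_norm (\<lambda>t. f (t + h) - g t) \<le> L1_norm (\<lambda>t. f (t + h) - g (t + h)) + L1_norm (\<lambda>t. g (t + h) - g t)"
        proof (rule L1_norm_triangle)
          show "norm (f (t + h) - g t) \<le> norm (f (t + h) - g (t + h)) + norm (g (t + h) - g t)" for t
            by (rule norm_diff_triangle_le) auto
        qed (use int integrable_translate(1)[OF int(1), of h] integrable_translate(1)[OF int(2), of h] in simp_all)
        have 2: "L1_norm (\<lambda>t. f (t + h) - f t) \<le> L1_norm (\<lambda>t. f (t + h) - g t) + L1_norm (\<lambda>t. f t - g t)"
        proof (rule L1_norm_triangle)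
          show "norm (f (t + h) - f t) \<le> norm (f (t + h) - g t) + norm (f t - g t)" for t
            by (rule norm_diff_triangle_le) (auto simp: norm_minus_commute)
        qed (use int integrable_translate(1)[OF int(1), of h] integrable_translate(1)[OF int(2), of h] in simp_all)
        have 3: "L1_norm (\<lambda>t. f (t + h) - g (t + h)) = L1_norm (\<lambda>t. f t - g t)"
          by (rule L1_norm_translate[of "\<lambda>t. f t - g t"])
        from 1 2 3 g(3) d(2)[OF h] show "L1_norm (\<lambda>t. f (t + h) - f t) < e" by linarith
      qed
    qed
    then show "f \<in> ?V" using f by auto
  qed
  moreover have "indicator {a..<b} \<in> ?V" if ab: "a \<le> b" for a b
  proof -
    have "?P (indicator {a..<b} :: real \<Rightarrow> complex)"
    proof (intro allI impI)
      fix e :: real assume "e > 0"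
      show "\<exists>d>0. \<forall>h. \<bar>h\<bar> < d \<longrightarrow> L1_norm (\<lambda>t. indicator {a..<b} (t + h) - indicator {a..<b} t) < e"
      proof (intro exI[of _ "e / 4"] conjI allI impI)
        fix h :: real assume "\<bar>h\<bar> < e / 4"
        with L1_norm_indicator_translate[OF ab, of h]
        show "L1_norm (\<lambda>t. indicator {a..<b} (t + h) - indicator {a..<b} t) < e" by linarith
      qed (use \<open>e > 0\<close> in simp)
    qed
    then show ?thesis using integrable_indicator_ivl by blast
  qed
  ultimately have "f \<in> ?V" using f by (rule L1_closed_subspace_UNIV)
  then show ?thesis using e by blast
qed

section \<open>Convolution of integrable functions\<close>

text \<open>For integrable factors the integrand is integrable only for almost every
  \<open>t\<close>, and elsewhere the integral has the default value 0. This is why linearity in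
  \<open>k\<close> is stated almost everywhere.\<close>

definition sconv :: "(real \<Rightarrow> complex) \<Rightarrow> (real \<Rightarrow> complex) \<Rightarrow> real \<Rightarrow> complex" where
  "sconv f k t = (\<integral>s. f (t - s) * k s \<partial>lborel)"

lemma borel_integrable_measurable:
  fixes f :: "real \<Rightarrow> complex"
  shows "integrable lborel f \<Longrightarrow> f \<in> borel_measurable borel"
  using borel_measurable_integrable[of lborel f] by simp

lemma sconv_pair_integrable:
  fixes f k :: "real \<Rightarrow> complex"
  assumes f: "integrable lborel f" and k: "integrable lborel k"
  shows "integrable (lborel \<Otimes>\<^sub>M lborel) (\<lambda>(s, t). f (t - s) * k s)"
proof (rule lborel_pair.Fubini_integrable)
  have [measurable]: "f \<in> borel_measurable borel" "k \<in> borel_measurable borel"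
    using f k by (auto intro: borel_integrable_measurable)
  show "(\<lambda>(s, t). f (t - s) * k s) \<in> borel_measurable (lborel \<Otimes>\<^sub>M lborel)" by measurable
  show "integrable lborel (\<lambda>s. \<integral>t. norm (case (s, t) of (s, t) \<Rightarrow> f (t - s) * k s) \<partial>lborel)"
    using k by (simp add: norm_mult L1_norm_translate_diff)
  show "AE s in lborel. integrable lborel (\<lambda>t. case (s, t) of (s, t) \<Rightarrow> f (t - s) * k s)"
    using integrable_translate(2)[OF f] by simp
qed

text \<open>Minkowski's integral inequality, obtained from Fubini for
  \<open>norm (H s t)\<close>.\<close>

lemma L1_norm_integral_le:
  assumes H: "integrable (lborel \<Otimes>\<^sub>M lborel) (case_prod H)"
  shows "L1_norm (\<lambda>t. \<integral>s. H s t \<partial>lborel) \<le> (\<integral>s. L1_norm (H s) \<partial>lborel)"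
proof -
  have nH: "integrable (lborel \<Otimes>\<^sub>M lborel) (\<lambda>(s, t). norm (H s t))"
    using integrable_norm[OF H] by (simp add: case_prod_beta')
  have "L1_norm (\<lambda>t. \<integral>s. H s t \<partial>lborel) \<le> (\<integral>t. \<integral>s. norm (H s t) \<partial>lborel \<partial>lborel)"
    using lborel_pair.integrable_snd[OF H] lborel_pair.integrable_snd[OF nH]
    by (intro integral_mono integrable_norm integral_norm_bound) auto
  also have "\<dots> = (\<integral>s. L1_norm (H s) \<partial>lborel)"
    by (rule lborel_pair.Fubini_integral[OF nH])
  finally show ?thesis .
qed

lemma sconv_integrable:
  assumes "integrable lborel f" "integrable lborel k"
  shows "integrable lborel (sconv f k)"
  using lborel_pair.integrable_snd[OF sconv_pair_integrable[OF assms]] by (simp add: sconv_def[abs_def])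

lemma L1_norm_sconv_le:
  assumes "integrable lborel f" "integrable lborel k"
  shows "L1_norm (sconv f k) \<le> L1_norm f * L1_norm k"
  using L1_norm_integral_le[OF sconv_pair_integrable[OF assms]]
  by (simp add: sconv_def[abs_def] norm_mult L1_norm_translate_diff)

lemma integral_sconv:
  assumes "integrable lborel f" "integrable lborel k"
  shows "(\<integral>t. sconv f k t \<partial>lborel) = (\<integral>t. f t \<partial>lborel) * (\<integral>t. k t \<partial>lborel)"
proof -
  have "(\<integral>t. sconv f k t \<partial>lborel) = (\<integral>s. \<integral>t. f (t - s) * k s \<partial>lborel \<partial>lborel)"
    unfolding sconv_def by (rule lborel_pair.Fubini_integral[OF sconv_pair_integrable[OF assms]])
  moreover have "(\<integral>t. f (t - s) * k s \<partial>lborel) = (\<integral>t. f t \<partial>lborel) * k s" for s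
    using lborel_integral_real_affine[of 1 f "-s"] by simp
  ultimately show ?thesis by (simp only: integral_mult_right_zero)
qed

lemma
  assumes f: "integrable lborel f" and g: "integrable lborel g" and h: "integrable lborel h"
  shows sconv_add_AE: "AE t in lborel. sconv f (\<lambda>s. g s + h s) t = sconv f g t + sconv f h t"
    and sconv_diff_AE: "AE t in lborel. sconv f (\<lambda>s. g s - h s) t = sconv f g t - sconv f h t"
proof -
  have *: "AE t in lborel. integrable lborel (\<lambda>s. f (t - s) * g s)"
    "AE t in lborel. integrable lborel (\<lambda>s. f (t - s) * h s)"
    by (rule lborel_pair.AE_integrable_snd[OF sconv_pair_integrable] f g h)+
  show "AE t in lborel. sconv f (\<lambda>s. g s + h s) t = sconv f g t + sconv f h t"
    using * by eventually_elim (simp add: sconv_def distrib_left)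
  show "AE t in lborel. sconv f (\<lambda>s. g s - h s) t = sconv f g t - sconv f h t"
    using * by eventually_elim (simp add: sconv_def right_diff_distrib)
qed

lemma L1_norm_cong_AE:
  assumes "integrable lborel f" "integrable lborel g" "AE t in lborel. f t = g t"
  shows "L1_norm f = L1_norm g"
proof (rule integral_cong_AE)
  show "AE t in lborel. norm (f t) = norm (g t)" using assms(3) by eventually_elim simp
qed (use assms in \<open>auto dest: borel_integrable_measurable\<close>)

lemma L1_closed_subspace_AE:
  assumes V: "L1_closed_subspace V" and f: "f \<in> V" and g: "integrable lborel g"
    and ae: "AE t in lborel. g t = f t"
  shows "g \<in> V"
proof (rule L1_closed_subspaceD(5)[OF V g])
  fix e :: real assume "e > 0"
  have "L1_norm (\<lambda>t. g t - f t) = L1_norm (\<lambda>_. 0)"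
    using ae L1_closed_subspaceD(1)[OF V f] g by (intro L1_norm_cong_AE) auto
  then show "\<exists>f\<in>V. L1_norm (\<lambda>t. g t - f t) < e" using f \<open>e > 0\<close> by (intro bexI[of _ f]) simp_all
qed

section \<open>Riemann sums for the convolution with an interval indicator\<close>

lemma sconv_short_interval:
  assumes f: "integrable lborel f" and h: "h \<ge> 0"
    and w: "\<And>r. 0 \<le> r \<Longrightarrow> r < h \<Longrightarrow> L1_norm (\<lambda>t. f (t - r) - f t) \<le> w" and w0: "w \<ge> 0"
  shows "L1_norm (\<lambda>t. sconv f (indicator {c..<c + h}) t - of_real h * f (t - c)) \<le> h * w"
proof -
  let ?i = "indicator {c..<c + h} :: real \<Rightarrow> complex"
  have [measurable]: "f \<in> borel_measurable borel" using f by (rule borel_integrable_measurable)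
  have fs: "integrable lborel (\<lambda>t. f (t - s))" for s using integrable_translate(2)[OF f] .
  have 1: "integrable (lborel \<Otimes>\<^sub>M lborel) (\<lambda>(s, t). f (t - s) * ?i s)"
    by (rule sconv_pair_integrable[OF f integrable_indicator_ivl])
  have 2: "integrable (lborel \<Otimes>\<^sub>M lborel) (\<lambda>(s, t). f (t - c) * ?i s)"
  proof (rule lborel_pair.Fubini_integrable)
    show "(\<lambda>(s, t). f (t - c) * ?i s) \<in> borel_measurable (lborel \<Otimes>\<^sub>M lborel)" by measurable
    show "integrable lborel (\<lambda>s. \<integral>t. norm (case (s, t) of (s, t) \<Rightarrow> f (t - c) * ?i s) \<partial>lborel)"
      using integrable_norm[OF integrable_indicator_ivl] by (simp add: norm_mult)
    show "AE s in lborel. integrable lborel (\<lambda>t. case (s, t) of (s, t) \<Rightarrow> f (t - c) * ?i s)"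
      using fs by simp
  qed
  \<comment> \<open>The convolution integrates the translates \<open>f (t - s)\<close> over
    \<open>s\<close> in a short interval. Replacing each by \<open>f (t - c)\<close> costs at most
    \<open>w\<close> in norm for every \<open>s\<close>, and Minkowski's inequality integrates this
    error.\<close>
  let ?H = "\<lambda>s t. f (t - s) * ?i s - f (t - c) * ?i s"
  have H: "integrable (lborel \<Otimes>\<^sub>M lborel) (case_prod ?H)"
    using Bochner_Integration.integrable_diff[OF 1 2] by (simp add: case_prod_beta')
  have ii: "(\<integral>s. ?i s \<partial>lborel) = of_real h"
  proof -
    have "integrable lborel (indicat_real {c..<c + h})"
      using h by (intro integrable_real_indicator) auto
    then have "(\<integral>s. complex_of_real (indicat_real {c..<c + h} s) \<partial>lborel) = of_real (\<integral>s. indicat_real {c..<c + h} s \<partial>lborel)"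
      by (rule integral_of_real)
    then show ?thesis using h by (simp add: of_real_indicator)
  qed
  have "AE t in lborel. integrable lborel (\<lambda>s. f (t - s) * ?i s)"
    by (rule lborel_pair.AE_integrable_snd[OF 1])
  then have ae: "AE t in lborel. sconv f ?i t - of_real h * f (t - c) = (\<integral>s. ?H s t \<partial>lborel)"
    by eventually_elim (simp add: sconv_def ii integrable_indicator_ivl)
  have "L1_norm (\<lambda>t. sconv f ?i t - of_real h * f (t - c)) = L1_norm (\<lambda>t. \<integral>s. ?H s t \<partial>lborel)"
    using sconv_integrable[OF f integrable_indicator_ivl] fs lborel_pair.integrable_snd[OF H]
    by (intro L1_norm_cong_AE ae) auto
  also have "\<dots> \<le> (\<integral>s. L1_norm (?H s) \<partial>lborel)" by (rule L1_norm_integral_le[OF H])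
  also have "\<dots> \<le> (\<integral>s. w * indicat_real {c..<c + h} s \<partial>lborel)"
  proof (rule integral_mono)
    show "integrable lborel (\<lambda>s. L1_norm (?H s))"
      using lborel_pair.integrable_fst[of "\<lambda>s t. norm (?H s t)"] integrable_norm[OF H]
      by (simp add: case_prod_beta')
    show "integrable lborel (\<lambda>s. w * indicat_real {c..<c + h} s)" using h by simp
    fix s
    show "L1_norm (?H s) \<le> w * indicat_real {c..<c + h} s"
    proof (cases "s \<in> {c..<c + h}")
      case True
      have "L1_norm (?H s) = L1_norm (\<lambda>t. f (t - s) - f (t - c))" using True by simp
      also have "\<dots> = L1_norm (\<lambda>t. f (t - (s - c)) - f t)"
        using L1_norm_translate_diff[of "\<lambda>t. f (t - (s - c)) - f t" c] by simp
      also have "\<dots> \<le> w" using True by (intro w) auto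
      finally show ?thesis using True by simp
    qed simp
  qed
  also have "\<dots> = h * w" using h by simp
  finally show ?thesis .
qed

text \<open>The errors of \<open>m\<close> adjacent intervals add up to \<open>m * h * w\<close>.
  Since \<open>m * h\<close> is the total length, refining the mesh makes the error small through
  the modulus of continuity \<open>w\<close>.\<close>

lemma sconv_interval_riemann:
  assumes f: "integrable lborel f" and h: "h \<ge> 0"
    and w: "\<And>r. 0 \<le> r \<Longrightarrow> r < h \<Longrightarrow> L1_norm (\<lambda>t. f (t - r) - f t) \<le> w" and w0: "w \<ge> 0"
  shows "L1_norm (\<lambda>t. sconv f (indicator {a..<a + real m * h}) t -
      (\<Sum>j<m. of_real h * f (t - (a + real j * h)))) \<le> real m * h * w"
proof (induction m)
  case 0
  have "(indicator {a..<a} :: real \<Rightarrow> complex) = (\<lambda>_. 0)" by auto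
  then show ?case by (simp add: sconv_def)
next
  case (Suc m)
  let ?i = "\<lambda>c d. indicator {c..<d} :: real \<Rightarrow> complex"
  let ?b = "a + real m * h" and ?b' = "a + real (Suc m) * h"
  let ?S = "\<lambda>t. (\<Sum>j<m. of_real h * f (t - (a + real j * h)))"
  have fs: "integrable lborel (\<lambda>t. f (t - s))" for s using integrable_translate(2)[OF f] .
  note int = sconv_integrable[OF f integrable_indicator_ivl]
  have b': "?b' = ?b + h" by (simp add: algebra_simps)
  have "(\<lambda>s. ?i a b s + ?i b (b + h) s) = ?i a (b + h)" if "a \<le> b" for b
    using that h by (auto simp: indicator_def fun_eq_iff)
  from this[of ?b] have "(\<lambda>s. ?i a ?b s + ?i ?b ?b' s) = ?i a ?b'"
    using h unfolding b' by simp
  then have ae: "AE t in lborel. sconv f (?i a ?b') t = sconv f (?i a ?b) t + sconv f (?i ?b ?b') t"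
    using sconv_add_AE[OF f integrable_indicator_ivl integrable_indicator_ivl, of a ?b ?b ?b'] by simp
  have iS: "integrable lborel ?S" using fs by simp
  have "L1_norm (\<lambda>t. sconv f (?i a ?b') t - (\<Sum>j<Suc m. of_real h * f (t - (a + real j * h)))) =
    L1_norm (\<lambda>t. (sconv f (?i a ?b) t - ?S t) + (sconv f (?i ?b ?b') t - of_real h * f (t - ?b)))"
  proof (rule L1_norm_cong_AE)
    show "integrable lborel (\<lambda>t. sconv f (?i a ?b') t - (\<Sum>j<Suc m. of_real h * f (t - (a + real j * h))))"
      using int[of a ?b'] fs by (intro Bochner_Integration.integrable_diff) auto
    show "integrable lborel (\<lambda>t. (sconv f (?i a ?b) t - ?S t) + (sconv f (?i ?b ?b') t - of_real h * f (t - ?b)))"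
      using int iS fs by (intro Bochner_Integration.integrable_add Bochner_Integration.integrable_diff) auto
    show "AE t in lborel. sconv f (?i a ?b') t - (\<Sum>j<Suc m. of_real h * f (t - (a + real j * h))) =
        (sconv f (?i a ?b) t - ?S t) + (sconv f (?i ?b ?b') t - of_real h * f (t - ?b))"
      using ae by eventually_elim simp
  qed
  also have "\<dots> \<le> L1_norm (\<lambda>t. sconv f (?i a ?b) t - ?S t) + L1_norm (\<lambda>t. sconv f (?i ?b ?b') t - of_real h * f (t - ?b))"
    using int iS fs
    by (intro L1_norm_triangle Bochner_Integration.integrable_add Bochner_Integration.integrable_diff norm_triangle_ineq) auto
  also have "\<dots> \<le> real m * h * w + h * w"
    unfolding b' by (intro add_mono Suc sconv_short_interval f h w w0)
  finally show ?case by (simp add: algebra_simps)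
qed

text \<open>Riemann sums of \<open>sconv f (indicator {a..<b})\<close> are combinations of translates of \<open>f\<close>.\<close>

lemma L1_closed_translation_invariant_ideal:
  assumes V: "L1_closed_subspace V" and trans: "\<And>f a. f \<in> V \<Longrightarrow> (\<lambda>t. f (t - a)) \<in> V"
    and fV: "f \<in> V" and k: "integrable lborel k"
  shows "sconv f k \<in> V"
proof -
  have f: "integrable lborel f" using L1_closed_subspaceD(1)[OF V fV] .
  let ?W = "{k. integrable lborel k \<and> sconv f k \<in> V}"
  \<comment> \<open>The admissible kernels \<open>k\<close> form a closed subspace, closed because
    \<open>sconv f\<close> is bounded in norm. It therefore suffices to treat interval
    indicators.\<close>
  have "L1_closed_subspace ?W"
    unfolding L1_closed_subspace_def
  proof (intro conjI ballI allI impI)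
    show "?W \<subseteq> Collect (integrable lborel)" by auto
    have "sconv f (\<lambda>_. 0) = (\<lambda>_. 0)" by (simp add: sconv_def[abs_def])
    then show "(\<lambda>_. 0) \<in> ?W" using L1_closed_subspaceD(2)[OF V] by simp
  next
    fix g h assume gh: "g \<in> ?W" "h \<in> ?W"
    then have "(\<lambda>t. sconv f g t + sconv f h t) \<in> V"
      using L1_closed_subspaceD(3)[OF V] by simp
    then have "sconv f (\<lambda>s. g s + h s) \<in> V"
      using gh by (intro L1_closed_subspace_AE[OF V _ _ sconv_add_AE] sconv_integrable f) auto
    then show "(\<lambda>t. g t + h t) \<in> ?W" using gh by simp
  next
    fix c g assume g: "g \<in> ?W"
    have "sconv f (\<lambda>t. c * g t) = (\<lambda>t. c * sconv f g t)"
      by (simp add: sconv_def[abs_def] mult.left_commute)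
    then show "(\<lambda>t. c * g t) \<in> ?W" using g L1_closed_subspaceD(4)[OF V] by simp
  next
    fix g assume "integrable lborel g \<and> (\<forall>e>0. \<exists>h\<in>?W. L1_norm (\<lambda>t. g t - h t) < e)"
    then have g: "integrable lborel g" and *: "\<And>e. e > 0 \<Longrightarrow> \<exists>h\<in>?W. L1_norm (\<lambda>t. g t - h t) < e"
      by auto
    have "sconv f g \<in> V"
    proof (rule L1_closed_subspaceD(5)[OF V sconv_integrable[OF f g]])
      fix e :: real assume "e > 0"
      have pos: "L1_norm f + 1 > 0" by (rule add_nonneg_pos) auto
      then have "e / (L1_norm f + 1) > 0" using \<open>e > 0\<close> by simp
      then obtain h where h: "integrable lborel h" "sconv f h \<in> V"
        "L1_norm (\<lambda>t. g t - h t) < e / (L1_norm f + 1)" using * by blast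
      have "L1_norm (\<lambda>t. sconv f g t - sconv f h t) = L1_norm (sconv f (\<lambda>t. g t - h t))"
        using sconv_diff_AE[OF f g h(1)] sconv_integrable[OF f g] sconv_integrable[OF f h(1)]
          sconv_integrable[OF f Bochner_Integration.integrable_diff[OF g h(1)]]
        by (intro L1_norm_cong_AE) (auto simp: eq_commute)
      also have "\<dots> \<le> L1_norm f * L1_norm (\<lambda>t. g t - h t)"
        by (intro L1_norm_sconv_le f Bochner_Integration.integrable_diff g h)
      also have "\<dots> \<le> (L1_norm f + 1) * L1_norm (\<lambda>t. g t - h t)"
        by (intro mult_right_mono) auto
      also have "\<dots> < e"
        using h(3) pos_less_divide_eq[OF pos, of "L1_norm (\<lambda>t. g t - h t)" e] by (simp add: mult.commute)
      finally show "\<exists>h\<in>V. L1_norm (\<lambda>t. sconv f g t - h t) < e" using h(2) by blast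
    qed
    then show "g \<in> ?W" using g by simp
  qed
  moreover have "indicator {a..<b} \<in> ?W" if ab: "a \<le> b" for a b
  proof -
    have "sconv f (indicator {a..<b}) \<in> V"
    proof (rule L1_closed_subspaceD(5)[OF V sconv_integrable[OF f integrable_indicator_ivl]])
      fix e :: real assume "e > 0"
      \<comment> \<open>The Riemann error will be \<open>(b - a) * w\<close>, less than
        \<open>e\<close>; the added 1 covers \<open>a = b\<close>.\<close>
      define w where "w = e / (2 * (b - a + 1))"
      have w: "w > 0" using \<open>e > 0\<close> ab by (simp add: w_def)
      then obtain d where d: "d > 0" "\<And>h. \<bar>h\<bar> < d \<Longrightarrow> L1_norm (\<lambda>t. f (t + h) - f t) < w"
        using L1_translation_continuous[OF f w] by blast
      obtain m where m: "(b - a) / d < real m" using reals_Archimedean2 by blast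
      define h where "h = (b - a) / real m"
      have m0: "m > 0"
      proof (rule ccontr)
        assume "\<not> m > 0"
        then show False using m d(1) ab by (simp add: divide_less_0_iff)
      qed
      have h: "h \<ge> 0" "h < d" "a + real m * h = b"
        using m ab d(1) m0 by (auto simp: h_def field_simps)
      have wr: "L1_norm (\<lambda>t. f (t - r) - f t) \<le> w" if "0 \<le> r" "r < h" for r
        using d(2)[of "-r"] that h by simp
      let ?S = "\<lambda>t. (\<Sum>j<m. of_real h * f (t - (a + real j * h)))"
      have "(\<lambda>t. \<Sum>j<n. of_real h * f (t - (a + real j * h))) \<in> V" for n
      proof (induction n)
        case 0 then show ?case using L1_closed_subspaceD(2)[OF V] by simp
      next
        case (Suc n)
        then show ?case
          using L1_closed_subspaceD(3)[OF V Suc L1_closed_subspaceD(4)[OF V trans[OF fV]]] by simp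
      qed
      then have "?S \<in> V" .
      moreover have "L1_norm (\<lambda>t. sconv f (indicator {a..<b}) t - ?S t) < e"
      proof -
        have "L1_norm (\<lambda>t. sconv f (indicator {a..<b}) t - ?S t) \<le> (b - a) * w"
          using sconv_interval_riemann[OF f h(1) wr, of a m] w h(3) m0 by (simp add: h_def)
        also have "\<dots> < e"
        proof -
          have "e = 2 * (b - a + 1) * w" using ab by (simp add: w_def)
          moreover have "0 < (b - a + 2) * w" using w ab by (intro mult_pos_pos) auto
          ultimately show ?thesis by (simp add: algebra_simps)
        qed
        finally show ?thesis .
      qed
      ultimately show "\<exists>g\<in>V. L1_norm (\<lambda>t. sconv f (indicator {a..<b}) t - g t) < e" by (intro bexI[of _ ?S])
    qed
    then show ?thesis using integrable_indicator_ivl by simp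
  qed
  ultimately have "k \<in> ?W" using k by (rule L1_closed_subspace_UNIV)
  then show ?thesis by simp
qed

section \<open>Convolution with a smooth kernel\<close>

lemma sconv_commute: "sconv f k t = (\<integral>s. f s * k (t - s) \<partial>lborel)"
  unfolding sconv_def
  using lborel_integral_real_affine[of "-1" "\<lambda>s. f s * k (t - s)" t] by (simp add: algebra_simps)

lemma sconv_bounded_integrable:
  fixes f k :: "real \<Rightarrow> complex"
  assumes f: "integrable lborel f" and k: "k \<in> borel_measurable borel" "\<And>t. norm (k t) \<le> B"
  shows "integrable lborel (\<lambda>s. f s * k (t - s))"
proof (rule Bochner_Integration.integrable_bound)
  show "integrable lborel (\<lambda>s. of_real B * f s)" using f by simp
  have [measurable]: "f \<in> borel_measurable borel" using f by (rule borel_integrable_measurable)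
  note k(1)[measurable]
  show "(\<lambda>s. f s * k (t - s)) \<in> borel_measurable lborel" by measurable
  show "AE s in lborel. norm (f s * k (t - s)) \<le> norm (of_real B * f s)"
    using k(2) order_trans[OF norm_ge_zero k(2)]
    by (auto simp: norm_mult mult.commute[of B] intro!: AE_I2 mult_left_mono)
qed

lemma norm_sconv_le:
  assumes f: "integrable lborel f" and k: "k \<in> borel_measurable borel" "\<And>t. norm (k t) \<le> B"
  shows "norm (sconv f k t) \<le> L1_norm f * B"
proof -
  have "norm (sconv f k t) \<le> (\<integral>s. norm (f s) * B \<partial>lborel)"
    unfolding sconv_commute
  proof (rule Bochner_Integration.integral_norm_bound_integral[OF sconv_bounded_integrable[OF f k]])
    show "integrable lborel (\<lambda>s. norm (f s) * B)" using f by simp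
    show "norm (f s * k (t - s)) \<le> norm (f s) * B" for s
      using k(2) by (simp add: norm_mult mult_left_mono)
  qed
  then show ?thesis by simp
qed

lemma sconv_tendsto_0:
  assumes f: "integrable lborel f" and k: "k \<in> borel_measurable borel" "\<And>t. norm (k t) \<le> B"
    and lim: "(k \<longlongrightarrow> 0) at_top"
  shows "(sconv f k \<longlongrightarrow> 0) at_top"
proof -
  have "((\<lambda>t. \<integral>s. f s * k (t - s) \<partial>lborel) \<longlongrightarrow> (\<integral>s. 0 \<partial>(lborel :: real measure))) at_top"
  proof (rule integral_dominated_convergence_at_top[where w = "\<lambda>s. norm (f s) * B"])
    show "(\<lambda>s. f s * k (t - s)) \<in> borel_measurable lborel" for t
      using sconv_bounded_integrable[OF f k] by (rule borel_measurable_integrable)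
    show "integrable lborel (\<lambda>s. norm (f s) * B)" using f by simp
    show "\<forall>\<^sub>F t in at_top. AE s in lborel. norm (f s * k (t - s)) \<le> norm (f s) * B"
      using k(2) by (intro always_eventually allI AE_I2) (simp add: norm_mult mult_left_mono)
    show "AE s in lborel. ((\<lambda>t. f s * k (t - s)) \<longlongrightarrow> 0) at_top"
    proof (rule AE_I2)
      fix s :: real
      have "filterlim (\<lambda>t. t - s) at_top at_top"
        using filterlim_tendsto_add_at_top[OF tendsto_const[of "-s"] filterlim_ident] by simp
      from filterlim_compose[OF lim this]
      show "((\<lambda>t. f s * k (t - s)) \<longlongrightarrow> 0) at_top" by (rule tendsto_mult_right_zero)
    qed
  qed simp
  then show ?thesis by (simp add: sconv_commute[abs_def])
qed

section \<open>Differentiating a convolution in its smooth factor\<close>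

lemma vector_derivative_bounded_lipschitz:
  fixes k :: "real \<Rightarrow> 'b::real_normed_vector"
  assumes k: "\<And>t. (k has_vector_derivative k' t) (at t)" and B: "\<And>t. norm (k' t) \<le> B"
  shows "norm (k x - k y) \<le> B * \<bar>x - y\<bar>"
proof -
  have "norm (k x - k y) \<le> B * norm (x - y)"
  proof (rule differentiable_bound[where S = UNIV and f' = "\<lambda>x h. h *\<^sub>R k' x"])
    show "(k has_derivative (\<lambda>h. h *\<^sub>R k' x)) (at x within UNIV)" for x
      using k by (simp add: has_vector_derivative_def)
    show "onorm (\<lambda>h. h *\<^sub>R k' x) \<le> B" for x
      using B[of x] by (intro onorm_le) (simp add: mult.commute[of B] mult_left_mono)
  qed auto
  then show ?thesis by simp
qed

text \<open>Between \<open>t\<close> and \<open>t + h\<close> the derivative moves by at most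
  \<open>B * \<bar>h\<bar>\<close>, so the mean value inequality bounds the remainder uniformly in
  \<open>t\<close>.\<close>

lemma vector_derivative_taylor:
  fixes k :: "real \<Rightarrow> 'b::real_normed_vector"
  assumes k: "\<And>t. (k has_vector_derivative k' t) (at t)"
    and k': "\<And>x y. norm (k' x - k' y) \<le> B * \<bar>x - y\<bar>" and B: "B \<ge> 0"
  shows "norm (k (t + h) - k t - h *\<^sub>R k' t) \<le> B * h\<^sup>2"
proof -
  have "norm (k (t + h) - k t - (t + h - t) *\<^sub>R k' t) \<le> norm (t + h - t) * (B * \<bar>h\<bar>)"
  proof (rule vector_differentiable_bound_linearization[where S = "closed_segment t (t + h)"])
    show "(k has_vector_derivative k' x) (at x within closed_segment t (t + h))" for x
      using k by (rule has_vector_derivative_at_within)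
    fix x assume x: "x \<in> closed_segment t (t + h)"
    have "norm (k' x - k' t) \<le> B * \<bar>x - t\<bar>" by (rule k')
    also have "\<dots> \<le> B * \<bar>h\<bar>"
      using x B by (intro mult_left_mono) (auto simp: closed_segment_eq_real_ivl split: if_splits)
    finally show "norm (k' x - k' t) \<le> B * \<bar>h\<bar>" .
  qed auto
  then show ?thesis by (simp add: power2_eq_square abs_mult_self_eq mult.assoc mult.left_commute)
qed

text \<open>The Taylor remainder of \<open>k\<close> is bounded uniformly in its base point, so it
  may be integrated against \<open>f\<close>: the difference quotient of the convolution has error
  at most \<open>L1_norm f * C * \<bar>h\<bar>\<close>.\<close>

lemma sconv_has_vector_derivative:
  fixes k :: "real \<Rightarrow> complex"
  assumes f: "integrable lborel f"
    and k: "k \<in> borel_measurable borel" "\<And>t. norm (k t) \<le> B"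
    and k': "k' \<in> borel_measurable borel" "\<And>t. norm (k' t) \<le> B'"
    and taylor: "\<And>t h. norm (k (t + h) - k t - h *\<^sub>R k' t) \<le> C * h\<^sup>2"
  shows "(sconv f k has_vector_derivative sconv f k' t) (at t)"
proof -
  note int = sconv_bounded_integrable[OF f k] sconv_bounded_integrable[OF f k']
  have *: "norm (sconv f k (t + h) - sconv f k t - h *\<^sub>R sconv f k' t) \<le> L1_norm f * C * h\<^sup>2" for h
  proof -
    have "sconv f k (t + h) - sconv f k t - h *\<^sub>R sconv f k' t =
      (\<integral>s. f s * (k (t + h - s) - k (t - s) - h *\<^sub>R k' (t - s)) \<partial>lborel)"
      using int[of t] int(1)[of "t + h"]
      by (simp add: sconv_commute right_diff_distrib scaleR_conv_of_real mult.left_commute[of _ "of_real h"])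
    also have "norm \<dots> \<le> (\<integral>s. norm (f s) * (C * h\<^sup>2) \<partial>lborel)"
    proof (rule Bochner_Integration.integral_norm_bound_integral)
      show "integrable lborel (\<lambda>s. f s * (k (t + h - s) - k (t - s) - h *\<^sub>R k' (t - s)))"
        using int[of t] int(1)[of "t + h"]
        by (simp add: right_diff_distrib scaleR_conv_of_real mult.left_commute[of _ "of_real h"])
      show "integrable lborel (\<lambda>s. norm (f s) * (C * h\<^sup>2))" using f by simp
      show "norm (f s * (k (t + h - s) - k (t - s) - h *\<^sub>R k' (t - s))) \<le> norm (f s) * (C * h\<^sup>2)" for s
        unfolding norm_mult using taylor[of "t - s" h]
        by (intro mult_left_mono) (simp_all add: algebra_simps)
    qed
    finally show ?thesis by (simp add: mult.assoc)
  qed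
  have "((\<lambda>h. norm (sconv f k (t + h) - sconv f k t - h *\<^sub>R sconv f k' t) / norm h) \<longlongrightarrow> 0) (at 0)"
  proof (rule tendsto_sandwich[OF _ _ tendsto_const])
    show "\<forall>\<^sub>F h in at 0. 0 \<le> norm (sconv f k (t + h) - sconv f k t - h *\<^sub>R sconv f k' t) / norm h"
      by simp
    show "\<forall>\<^sub>F h in at 0. norm (sconv f k (t + h) - sconv f k t - h *\<^sub>R sconv f k' t) / norm h \<le> L1_norm f * C * \<bar>h\<bar>"
    proof (rule eventually_at_filter[THEN iffD2], rule always_eventually, intro allI impI)
      fix h :: real assume "h \<noteq> 0"
      then show "norm (sconv f k (t + h) - sconv f k t - h *\<^sub>R sconv f k' t) / norm h \<le> L1_norm f * C * \<bar>h\<bar>"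
        using *[of h] by (simp add: pos_divide_le_eq power2_eq_square mult.assoc)
    qed
    have "((\<lambda>h. L1_norm f * C * \<bar>h\<bar>) \<longlongrightarrow> L1_norm f * C * \<bar>0\<bar>) (at 0)" by (intro tendsto_intros)
    then show "((\<lambda>h. L1_norm f * C * \<bar>h\<bar>) \<longlongrightarrow> 0) (at (0::real))" by simp
  qed
  then show ?thesis
    by (simp add: has_vector_derivative_def has_derivative_at bounded_linear_scaleR_left)
qed

lemma sconv_reflect: "sconv f k (- t) = sconv (\<lambda>s. f (- s)) (\<lambda>s. k (- s)) t"
  unfolding sconv_def
  using lborel_integral_real_affine[of "-1" "\<lambda>s. f (- t - s) * k s" 0] by simp

lemma sconv_tendsto_0_at_bot:
  assumes f: "integrable lborel f" and k: "k \<in> borel_measurable borel" "\<And>t. norm (k t) \<le> B"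
    and lim: "(k \<longlongrightarrow> 0) at_bot"
  shows "(sconv f k \<longlongrightarrow> 0) at_bot"
proof -
  have "(sconv (\<lambda>s. f (- s)) (\<lambda>s. k (- s)) \<longlongrightarrow> 0) at_top"
  proof (rule sconv_tendsto_0)
    show "integrable lborel (\<lambda>s. f (- s))" using integrable_translate(3)[OF f, of 0] by simp
    show "(\<lambda>s. k (- s)) \<in> borel_measurable borel" using k(1) by measurable
    show "((\<lambda>s. k (- s)) \<longlongrightarrow> 0) at_top"
      using lim by (simp add: filterlim_at_bot_mirror)
  qed (rule k(2))
  then show ?thesis by (simp add: filterlim_at_bot_mirror sconv_reflect)
qed

section \<open>Band-limited kernels\<close>

text \<open>For \<open>j = 0\<close> and nonzero \<open>a * t\<close> this is
  \<open>(exp (i a t) - 1) / (i a t)\<close>, a modulated sinc with frequencies between 0 and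
  \<open>a\<close>; the index \<open>j\<close> counts derivatives in \<open>t\<close>. The integral
  form needs no case distinction at \<open>t = 0\<close>.\<close>

definition sinc_moment :: "real \<Rightarrow> nat \<Rightarrow> real \<Rightarrow> complex" where
  "sinc_moment a j t = integral {0..1} (\<lambda>x. (\<i> * of_real (a * x)) ^ j * exp (\<i> * of_real (a * x * t)))"

lemma sinc_moment_integrable:
  "(\<lambda>x. (\<i> * of_real (a * x)) ^ j * exp (\<i> * of_real (a * x * t))) integrable_on {0..1}"
  by (intro integrable_continuous_real continuous_intros)

lemma sinc_moment_has_vector_derivative:
  "(sinc_moment a j has_vector_derivative sinc_moment a (Suc j) t) (at t)"
proof -
  let ?f = "\<lambda>j t x. (\<i> * of_real (a * x)) ^ j * exp (\<i> * of_real (a * x * t))"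
  have "((\<lambda>t. integral (cbox 0 1) (?f j t)) has_vector_derivative integral (cbox 0 1) (?f (Suc j) t)) (at t within UNIV)"
  proof (rule leibniz_rule_vector_derivative)
    fix t x :: real
    have "((\<lambda>t. \<i> * of_real (a * x * t)) has_vector_derivative \<i> * of_real (a * x)) (at t)"
      by (auto intro!: derivative_eq_intros simp: has_vector_derivative_def scaleR_conv_of_real)
    then have "((\<lambda>t. exp (\<i> * of_real (a * x * t))) has_vector_derivative
        (\<i> * of_real (a * x)) * exp (\<i> * of_real (a * x * t))) (at t)"
      using field_vector_diff_chain_at[of "\<lambda>t. \<i> * of_real (a * x * t)" _ t exp "exp (\<i> * of_real (a * x * t))"]
      by (simp add: o_def)
    from has_vector_derivative_mult_right[OF this, of "(\<i> * of_real (a * x)) ^ j"]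
    show "(( \<lambda>t. ?f j t x) has_vector_derivative ?f (Suc j) t x) (at t within UNIV)"
      by (simp add: mult.assoc mult.left_commute)
  next
    show "?f j t integrable_on cbox 0 1" for t using sinc_moment_integrable by simp
    show "continuous_on (UNIV \<times> cbox 0 1) (\<lambda>(t, x). ?f (Suc j) t x)"
      unfolding case_prod_beta by (intro continuous_intros)
  qed auto
  then show ?thesis by (simp add: sinc_moment_def[abs_def])
qed

lemma norm_sinc_moment_le:
  assumes a: "a > 0"
  shows "norm (sinc_moment a j t) \<le> a ^ j"
proof -
  have "norm (sinc_moment a j t) \<le> integral {0..1} (\<lambda>x::real. a ^ j)"
    unfolding sinc_moment_def
  proof (rule integral_norm_bound_integral[OF sinc_moment_integrable])
    show "(\<lambda>x::real. a ^ j) integrable_on {0..1}" by (intro integrable_continuous_real continuous_intros)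
    fix x :: real assume x: "x \<in> {0..1}"
    have "norm ((\<i> * of_real (a * x)) ^ j * exp (\<i> * of_real (a * x * t))) = (a * x) ^ j"
      using x a by (simp add: norm_mult norm_power)
    also have "\<dots> \<le> a ^ j"
      using x a by (intro power_mono) (auto simp: mult_left_le)
    finally show "norm ((\<i> * of_real (a * x)) ^ j * exp (\<i> * of_real (a * x * t))) \<le> a ^ j" .
  qed
  then show ?thesis by simp
qed

text \<open>Integration by parts over the frequency interval.\<close>

lemma sinc_moment_decay:
  assumes a: "a > 0"
  shows "a * \<bar>t\<bar> * norm (sinc_moment a j t) \<le> 2 * a ^ j"
proof -
  let ?e = "\<lambda>x. exp (\<i> * of_real (a * x * t)) :: complex"
  let ?c = "(\<i> * of_real a) ^ j"
  let ?m = "\<lambda>x. (\<i> * of_real (a * x)) ^ j :: complex"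
  have vd: "((\<lambda>x. of_real (x ^ j) * ?e x) has_vector_derivative
      of_real (x ^ j) * (\<i> * of_real (a * t) * ?e x) + of_real (real j * x ^ (j - 1)) * ?e x) (at x within {0..1})" for x
  proof -
    have "((\<lambda>x. \<i> * of_real (a * x * t)) has_vector_derivative \<i> * of_real (a * t)) (at x)"
      by (auto intro!: derivative_eq_intros simp: has_vector_derivative_def scaleR_conv_of_real)
    then have 1: "(?e has_vector_derivative (\<i> * of_real (a * t)) * ?e x) (at x)"
      using field_vector_diff_chain_at[of "\<lambda>x. \<i> * of_real (a * x * t)" _ x exp "?e x"]
      by (simp add: o_def)
    have "((\<lambda>x::real. x ^ j) has_real_derivative real j * x ^ (j - 1)) (at x)"
      by (auto intro!: derivative_eq_intros)
    then have 2: "((\<lambda>x. complex_of_real (x ^ j)) has_vector_derivative of_real (real j * x ^ (j - 1))) (at x)"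
      by (rule has_vector_derivative_of_real)
    show ?thesis
      by (rule has_vector_derivative_at_within[OF has_vector_derivative_mult[OF 2 1]])
  qed
  have "((\<lambda>x. of_real (x ^ j) * (\<i> * of_real (a * t) * ?e x) + of_real (real j * x ^ (j - 1)) * ?e x) has_integral
      (of_real (1 ^ j) * ?e 1 - of_real (0 ^ j) * ?e 0)) {0..1}"
    by (rule fundamental_theorem_of_calculus[OF _ vd]) simp
  moreover have i1: "(\<lambda>x. of_real (real j * x ^ (j - 1)) * ?e x) integrable_on {0..1}"
    by (intro integrable_continuous_real continuous_intros)
  moreover have i2: "(\<lambda>x. of_real (x ^ j) * (\<i> * of_real (a * t) * ?e x)) integrable_on {0..1}"
    by (intro integrable_continuous_real continuous_intros)
  ultimately have eq: "integral {0..1} (\<lambda>x. of_real (x ^ j) * (\<i> * of_real (a * t) * ?e x)) =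
      (?e 1 - of_real (0 ^ j) * ?e 0) - integral {0..1} (\<lambda>x. of_real (real j * x ^ (j - 1)) * ?e x)"
    using Henstock_Kurzweil_Integration.integral_add[OF i2 i1] by (simp add: integral_unique eq_diff_eq)
  have c: "(\<i> * of_real (a * t)) * sinc_moment a j t = ?c * integral {0..1} (\<lambda>x. of_real (x ^ j) * (\<i> * of_real (a * t) * ?e x))"
    unfolding sinc_moment_def integral_mult_right[symmetric]
    by (intro integral_cong) (simp add: power_mult_distrib)
  have "a * \<bar>t\<bar> * norm (sinc_moment a j t) =
      a ^ j * norm (integral {0..1} (\<lambda>x. of_real (x ^ j) * (\<i> * of_real (a * t) * ?e x)))"
  proof -
    have n: "norm (\<i> * complex_of_real (a * t)) = a * \<bar>t\<bar>" "norm ?c = a ^ j"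
      using a by (simp_all add: norm_mult norm_power abs_mult)
    show ?thesis
      using arg_cong[where f = norm, OF c]
      unfolding norm_mult[of "\<i> * of_real (a * t)"] norm_mult[of ?c] n .
  qed
  \<comment> \<open>Since \<open>0 ^ 0 = 1\<close>, both endpoints contribute exactly when
    \<open>j = 0\<close>, and then the integral term vanishes. For \<open>j > 0\<close> one endpoint
    remains, and the integral of \<open>j * x ^ (j - 1)\<close> is 1. Either way the bound is
    2.\<close>
  also have "norm (integral {0..1} (\<lambda>x. of_real (x ^ j) * (\<i> * of_real (a * t) * ?e x))) \<le> 2"
  proof (cases "j = 0")
    case True
    then show ?thesis unfolding eq using norm_triangle_ineq4[of "?e 1" "?e 0"] by simp
  next
    case False
    have "norm (integral {0..1} (\<lambda>x. of_real (real j * x ^ (j - 1)) * ?e x)) \<le> integral {0..1} (\<lambda>x. real j * x ^ (j - 1))"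
    proof (rule integral_norm_bound_integral[OF i1])
      show "(\<lambda>x. real j * x ^ (j - 1)) integrable_on {0..1}"
        by (intro integrable_continuous_real continuous_intros)
    qed (simp add: norm_mult norm_power)
    also have "((\<lambda>x::real. real j * x ^ (j - 1)) has_integral (1 ^ j - 0 ^ j)) {0..1}"
      by (rule fundamental_theorem_of_calculus)
        (auto intro!: derivative_eq_intros simp: has_real_derivative_iff_has_vector_derivative[symmetric])
    then have "integral {0..1} (\<lambda>x::real. real j * x ^ (j - 1)) = 1"
      unfolding integral_unique[OF \<open>((\<lambda>x::real. real j * x ^ (j - 1)) has_integral (1 ^ j - 0 ^ j)) {0..1}\<close>]
      using False by simp
    finally show ?thesis
      unfolding eq using False norm_triangle_ineq4[of "?e 1" "integral {0..1} (\<lambda>x. of_real (real j * x ^ (j - 1)) * ?e x)"]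
      by (simp add: power_0_left)
  qed
  finally show ?thesis using a by simp
qed

text \<open>Each factor decays only like \<open>1 / t\<close>; the product of two such bounds gives
  \<open>4 / (a * t)\<^sup>2\<close>. Adding the uniform bound covers small \<open>t\<close> and
  yields an integrable majorant.\<close>

lemma sinc_moment_mult_decay:
  assumes a: "a > 0"
  shows "norm (sinc_moment a i t * cnj (sinc_moment a j t)) \<le> a ^ (i + j) * (1 + 4 / a\<^sup>2) / (1 + t\<^sup>2)"
proof -
  let ?x = "norm (sinc_moment a i t)" and ?y = "norm (sinc_moment a j t)"
  have "?x * ?y \<le> a ^ i * a ^ j"
    by (intro mult_mono norm_sinc_moment_le a) (use a in auto)
  moreover have "(a * \<bar>t\<bar> * ?x) * (a * \<bar>t\<bar> * ?y) \<le> (2 * a ^ i) * (2 * a ^ j)"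
    by (intro mult_mono sinc_moment_decay a) (use a in auto)
  then have "t\<^sup>2 * (?x * ?y) \<le> 4 / a\<^sup>2 * (a ^ i * a ^ j)"
    using a by (simp add: field_simps power2_eq_square)
  ultimately have "(1 + t\<^sup>2) * (?x * ?y) \<le> a ^ i * a ^ j * (1 + 4 / a\<^sup>2)"
    by (simp add: algebra_simps)
  then show ?thesis
    by (simp add: norm_mult pos_le_divide_eq power_add mult.commute add_pos_nonneg)
qed

text \<open>The \<open>n\<close>-th derivative of \<open>sinc_moment a i * cnj (sinc_moment a j)\<close>.\<close>

fun sinc_product :: "real \<Rightarrow> nat \<Rightarrow> nat \<Rightarrow> nat \<Rightarrow> real \<Rightarrow> complex" where
  "sinc_product a 0 i j t = sinc_moment a i t * cnj (sinc_moment a j t)"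
| "sinc_product a (Suc n) i j t = sinc_product a n (Suc i) j t + sinc_product a n i (Suc j) t"

lemma sinc_product_has_vector_derivative:
  "((\<lambda>t. sinc_product a n i j t) has_vector_derivative sinc_product a (Suc n) i j t) (at t)"
proof (induction n arbitrary: i j)
  case 0
  show ?case
    using has_vector_derivative_mult[OF sinc_moment_has_vector_derivative
        has_vector_derivative_cnj[OF sinc_moment_has_vector_derivative], of a i a j t]
    by (simp add: add.commute)
next
  case (Suc n)
  from has_vector_derivative_add[OF Suc[of "Suc i" j] Suc[of i "Suc j"]] show ?case by simp
qed

text \<open>The product rule produces \<open>2 ^ n\<close> terms, and in each of them the total
  order of the moments has grown by \<open>n\<close>, which contributes
  \<open>a ^ n\<close>.\<close>

lemma norm_sinc_product_le:
  assumes a: "a > 0"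
  shows "norm (sinc_product a n i j t) \<le> 2 ^ n * (a ^ (n + i + j) * (1 + 4 / a\<^sup>2) / (1 + t\<^sup>2))"
proof (induction n arbitrary: i j)
  case 0
  then show ?case using sinc_moment_mult_decay[OF a] by simp
next
  case (Suc n)
  have "norm (sinc_product a (Suc n) i j t) \<le> norm (sinc_product a n (Suc i) j t) + norm (sinc_product a n i (Suc j) t)"
    by (simp add: norm_triangle_ineq)
  also have "\<dots> \<le> 2 ^ n * (a ^ (n + Suc i + j) * (1 + 4 / a\<^sup>2) / (1 + t\<^sup>2)) + 2 ^ n * (a ^ (n + i + Suc j) * (1 + 4 / a\<^sup>2) / (1 + t\<^sup>2))"
    by (intro add_mono Suc)
  finally show ?case
    unfolding add_Suc add_Suc_right power_Suc[of 2] mult_2 distrib_right .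
qed

text \<open>For \<open>n = 0\<close> this is a squared sinc modulated to have frequencies between
  \<open>l - a\<close> and \<open>l + a\<close>. Increasing \<open>n\<close> by one applies the
  operator that sends \<open>k\<close> to \<open>k' - i l k\<close>, because the modulation absorbs
  the term with \<open>l\<close>.\<close>

definition band_kernel :: "real \<Rightarrow> real \<Rightarrow> nat \<Rightarrow> real \<Rightarrow> complex" where
  "band_kernel l a n t = exp (\<i> * of_real (l * t)) * sinc_product a n 0 0 t"

lemma band_kernel_has_vector_derivative:
  "(band_kernel l a n has_vector_derivative
     band_kernel l a (Suc n) t + \<i> * of_real l * band_kernel l a n t) (at t)"
proof -
  have "((\<lambda>t. \<i> * of_real (l * t)) has_vector_derivative \<i> * of_real l) (at t)"
    by (auto intro!: derivative_eq_intros simp: has_vector_derivative_def scaleR_conv_of_real)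
  then have 1: "((\<lambda>t. exp (\<i> * of_real (l * t))) has_vector_derivative
      (\<i> * of_real l) * exp (\<i> * of_real (l * t))) (at t)"
    using field_vector_diff_chain_at[of "\<lambda>t. \<i> * of_real (l * t)" _ t exp "exp (\<i> * of_real (l * t))"]
    by (simp add: o_def)
  from has_vector_derivative_mult[OF 1 sinc_product_has_vector_derivative[of a n 0 0 t]] show ?thesis
    by (simp add: band_kernel_def[abs_def] distrib_left mult.assoc)
qed

text \<open>The decay factor in \<open>t\<close> is the same for all \<open>n\<close>; only
  \<open>(2 * a) ^ n\<close> depends on the order. This geometric rate is later matched against the
  powers of \<open>onorm R\<close>.\<close>

lemma norm_band_kernel_le:
  assumes a: "a > 0"
  shows "norm (band_kernel l a n t) \<le> (2 * a) ^ n * (1 + 4 / a\<^sup>2) * (1 / (1 + t\<^sup>2))"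
  using norm_sinc_product_le[OF a, of n 0 0 t]
  by (simp add: band_kernel_def norm_mult power_mult_distrib mult.assoc)

lemma norm_band_kernel_le':
  assumes a: "a > 0"
  shows "norm (band_kernel l a n t) \<le> (2 * a) ^ n * (1 + 4 / a\<^sup>2)"
proof -
  have "(2 * a) ^ n * (1 + 4 / a\<^sup>2) * (1 / (1 + t\<^sup>2)) \<le> (2 * a) ^ n * (1 + 4 / a\<^sup>2) * 1"
    using a by (intro mult_left_mono) (auto simp: divide_le_eq add_pos_nonneg)
  then show ?thesis using norm_band_kernel_le[OF a, of l n t] by simp
qed

lemma continuous_band_kernel: "continuous_on UNIV (band_kernel l a n)"
  using band_kernel_has_vector_derivative has_vector_derivative_continuous
  by (intro continuous_at_imp_continuous_on ballI) blast

lemma borel_band_kernel: "band_kernel l a n \<in> borel_measurable borel"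
  by (rule borel_measurable_continuous_onI[OF continuous_band_kernel])

lemma integrable_inverse_1_plus_sq: "integrable lborel (\<lambda>t::real. 1 / (1 + t\<^sup>2))"
proof -
  let ?f = "\<lambda>t::real. 1 / (1 + t\<^sup>2)"
  have m: "?f \<in> borel_measurable borel" by measurable
  have "(\<integral>\<^sup>+x. ennreal (?f x) * indicator {0..} x \<partial>lborel) = pi / 2 - arctan 0"
  proof (rule nn_integral_FTC_atLeast[OF m])
    show "DERIV arctan x :> ?f x" for x
      using DERIV_arctan[of x] by (simp add: inverse_eq_divide)
    show "(arctan \<longlongrightarrow> pi / 2) at_top" by (rule tendsto_arctan_at_top)
  qed simp
  also have "(\<integral>\<^sup>+x. ennreal (?f x) * indicator {0..} x \<partial>lborel) = (\<integral>\<^sup>+x. ennreal (?f x * indicator {0..} x) \<partial>lborel)"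
    by (intro nn_integral_cong) (simp add: indicator_def)
  finally have 1: "integrable lborel (\<lambda>x. ?f x * indicator {0..} x)"
    using m by (intro integrableI_nonneg) auto
  \<comment> \<open>The half-line and its reflection cover the line. At 0 both contribute, so the
    sum dominates \<open>?f\<close> without being equal to it there.\<close>
  have "integrable lborel (\<lambda>x. ?f x * indicator {0..} x + ?f (0 + (-1) * x) * indicator {0..} (0 + (-1) * x))"
    by (intro Bochner_Integration.integrable_add 1 lborel_integrable_real_affine[OF 1, of "-1" 0]) simp
  then show ?thesis
  proof (rule Bochner_Integration.integrable_bound)
    show "?f \<in> borel_measurable lborel" using m by simp
    show "AE x in lborel. norm (?f x) \<le> norm (?f x * indicator {0..} x + ?f (0 + (-1) * x) * indicator {0..} (0 + (-1) * x))"
      by (intro AE_I2) (auto simp: indicator_def)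
  qed
qed

lemma integrable_band_kernel:
  assumes a: "a > 0"
  shows "integrable lborel (band_kernel l a n)"
    and "L1_norm (band_kernel l a n) \<le> (2 * a) ^ n * (1 + 4 / a\<^sup>2) * (\<integral>t. 1 / (1 + t\<^sup>2) \<partial>lborel)"
proof -
  have i: "integrable lborel (\<lambda>t::real. (2 * a) ^ n * (1 + 4 / a\<^sup>2) * (1 / (1 + t\<^sup>2)))"
    by (intro integrable_mult_right integrable_inverse_1_plus_sq)
  show int: "integrable lborel (band_kernel l a n)"
  proof (rule Bochner_Integration.integrable_bound[OF i])
    show "band_kernel l a n \<in> borel_measurable lborel" using borel_band_kernel by simp
    show "AE t in lborel. norm (band_kernel l a n t) \<le> norm ((2 * a) ^ n * (1 + 4 / a\<^sup>2) * (1 / (1 + t\<^sup>2)))"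
      using norm_band_kernel_le[OF a] by (intro AE_I2) (metis abs_ge_self order_trans real_norm_def)
  qed
  have "L1_norm (band_kernel l a n) \<le> (\<integral>t. (2 * a) ^ n * (1 + 4 / a\<^sup>2) * (1 / (1 + t\<^sup>2)) \<partial>lborel)"
    by (intro integral_mono integrable_norm int i norm_band_kernel_le a)
  also have "\<dots> = (2 * a) ^ n * (1 + 4 / a\<^sup>2) * (\<integral>t. 1 / (1 + t\<^sup>2) \<partial>lborel)"
    by (rule integral_mult_right_zero)
  finally show "L1_norm (band_kernel l a n) \<le> (2 * a) ^ n * (1 + 4 / a\<^sup>2) * (\<integral>t. 1 / (1 + t\<^sup>2) \<partial>lborel)" .
qed

text \<open>Demodulation turns the kernel into \<open>(norm (sinc_moment a 0 t))\<^sup>2\<close>,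
  which is nonnegative, continuous and equal to 1 at 0.\<close>

lemma band_kernel_integral_nonzero:
  assumes a: "a > 0"
  shows "(\<integral>t. exp (- \<i> * of_real (l * t)) * band_kernel l a 0 t \<partial>lborel) \<noteq> 0"
proof -
  let ?h = "\<lambda>t. (norm (sinc_moment a 0 t))\<^sup>2"
  have eq: "exp (- \<i> * of_real (l * t)) * band_kernel l a 0 t = of_real (?h t)" for t
  proof -
    have "exp (- \<i> * of_real (l * t)) * exp (\<i> * of_real (l * t)) = (1::complex)"
      by (simp flip: exp_add)
    then show ?thesis
      unfolding complex_norm_square band_kernel_def mult.assoc[symmetric] by simp
  qed
  have "continuous_on UNIV (sinc_moment a 0)"
    using sinc_moment_has_vector_derivative has_vector_derivative_continuous
    by (intro continuous_at_imp_continuous_on ballI) blast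
  then have cont: "continuous_on UNIV ?h" by (intro continuous_intros)
  have hint: "integrable lborel ?h"
  proof (rule Bochner_Integration.integrable_bound[OF integrable_norm[OF integrable_band_kernel(1)[OF a, of l 0]]])
    show "?h \<in> borel_measurable lborel" using borel_measurable_continuous_onI[OF cont] by simp
    show "AE t in lborel. norm (?h t) \<le> norm (norm (band_kernel l a 0 t))"
      by (intro AE_I2) (simp add: band_kernel_def norm_mult power2_eq_square)
  qed
  have "(\<integral>t. ?h t \<partial>lborel) \<noteq> 0"
  proof
    assume "(\<integral>t. ?h t \<partial>lborel) = 0"
    then have "AE t in lborel. ?h t = 0"
      using integral_nonneg_eq_0_iff_AE[OF hint] by simp
    then have "AE t in lborel. t \<in> {t. ?h t = 0}" by simp
    \<comment> \<open>A closed set of full measure is the whole line, so a vanishing integral would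
      force \<open>?h 0 = 0\<close>.\<close>
    moreover have "closed {t. ?h t = 0}"
      by (rule closed_Collect_eq[OF cont continuous_on_const])
    ultimately have "0 \<in> {t. ?h t = 0}"
      using mem_closed_if_AE_lebesgue by (metis AE_completion)
    moreover have "sinc_moment a 0 0 = 1" by (simp add: sinc_moment_def)
    ultimately show False by simp
  qed
  then show ?thesis unfolding eq integral_of_real[OF hint] by (simp only: of_real_eq_0_iff not_False_eq_True)
qed

section \<open>Integration by parts for bounded strongly measurable functions\<close>

text \<open>Quadratic increments force the derivative to vanish everywhere. This is the means of
  proving an identity whose terms need not be differentiable one by one.\<close>

lemma eq_if_quadratic_increments:
  fixes H :: "real \<Rightarrow> 'a::real_normed_vector"
  assumes ab: "a \<le> b"
    and H: "\<And>c d. a \<le> c \<Longrightarrow> c \<le> d \<Longrightarrow> d \<le> b \<Longrightarrow> norm (H d - H c) \<le> K * (d - c)\<^sup>2"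
  shows "H a = H b"
proof -
  have K: "norm (H y - H x) \<le> \<bar>K\<bar> * (y - x)\<^sup>2" if "x \<in> {a..b}" "y \<in> {a..b}" for x y
  proof (cases "x \<le> y")
    case True
    then have "norm (H y - H x) \<le> K * (y - x)\<^sup>2" using that by (intro H) auto
    also have "\<dots> \<le> \<bar>K\<bar> * (y - x)\<^sup>2" by (intro mult_right_mono) auto
    finally show ?thesis .
  next
    case False
    then have "norm (H x - H y) \<le> K * (x - y)\<^sup>2" using that by (intro H) auto
    also have "\<dots> \<le> \<bar>K\<bar> * (x - y)\<^sup>2" by (intro mult_right_mono) auto
    finally show ?thesis by (simp add: norm_minus_commute power2_commute)
  qed
  have "\<exists>c. \<forall>x\<in>{a..b}. H x = c"
  proof (rule has_derivative_zero_constant)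
    fix x assume x: "x \<in> {a..b}"
    show "(H has_derivative (\<lambda>h. 0)) (at x within {a..b})"
      unfolding has_derivative_within_alt
    proof (intro conjI allI impI)
      show "bounded_linear (\<lambda>h::real. 0 :: 'a)" by (rule bounded_linear_zero)
      fix e :: real assume e: "e > 0"
      show "\<exists>d>0. \<forall>y\<in>{a..b}. norm (y - x) < d \<longrightarrow> norm (H y - H x - 0) \<le> e * norm (y - x)"
      proof (intro exI[of _ "e / (\<bar>K\<bar> + 1)"] conjI ballI impI)
        show "e / (\<bar>K\<bar> + 1) > 0" using e by (simp add: add_nonneg_pos)
        fix y assume y: "y \<in> {a..b}" "norm (y - x) < e / (\<bar>K\<bar> + 1)"
        have "(\<bar>K\<bar> + 1) * \<bar>y - x\<bar> < e"
          using y(2) pos_less_divide_eq[of "\<bar>K\<bar> + 1" "\<bar>y - x\<bar>" e] by (simp add: mult.commute add_nonneg_pos)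
        then have "\<bar>K\<bar> * \<bar>y - x\<bar> \<le> e" by (simp add: distrib_right)
        then have "\<bar>K\<bar> * \<bar>y - x\<bar> * \<bar>y - x\<bar> \<le> e * \<bar>y - x\<bar>" by (intro mult_right_mono) auto
        then show "norm (H y - H x - 0) \<le> e * norm (y - x)"
          using K[OF x y(1)] by (simp add: power2_eq_square mult.assoc abs_mult_self_eq)
      qed
    qed
  qed simp
  then show ?thesis using ab by auto
qed

lemma integral_by_parts_interval:
  fixes y r :: "real \<Rightarrow> 'a::complex_banach" and g g' :: "real \<Rightarrow> complex"
  assumes ab: "a \<le> b"
    and y: "\<And>c d. a \<le> c \<Longrightarrow> c \<le> d \<Longrightarrow> d \<le> b \<Longrightarrow> (r has_integral (y d - y c)) {c..d}"
    and r: "\<And>t. norm (r t) \<le> M"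
    and g: "\<And>t. (g has_vector_derivative g' t) (at t)"
    and g': "continuous_on UNIV g'" "\<And>t. norm (g' t) \<le> B"
    and gr: "(\<lambda>s. g s *\<^sub>C r s) integrable_on {a..b}"
  shows "integral {a..b} (\<lambda>s. g' s *\<^sub>C y s) =
    g b *\<^sub>C y b - g a *\<^sub>C y a - integral {a..b} (\<lambda>s. g s *\<^sub>C r s)"
proof -
  have M0: "M \<ge> 0" using r[of 0] norm_ge_zero order_trans by blast
  have B0: "B \<ge> 0" using g'(2)[of 0] norm_ge_zero order_trans by blast
  have ylip: "norm (y d - y c) \<le> M * (d - c)" if "a \<le> c" "c \<le> d" "d \<le> b" for c d
    using has_integral_bound_real[OF M0 finite.emptyI y[OF that]] r that by simp
  have glip: "norm (g s - g c) \<le> B * \<bar>s - c\<bar>" for s c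
    by (rule vector_derivative_bounded_lipschitz[OF g g'(2)])
  have ycont: "continuous_on {a..b} y"
    unfolding continuous_on_iff
  proof (intro ballI allI impI)
    fix x e :: real assume x: "x \<in> {a..b}" and e: "e > 0"
    show "\<exists>d>0. \<forall>x'\<in>{a..b}. dist x' x < d \<longrightarrow> dist (y x') (y x) < e"
    proof (intro exI[of _ "e / (M + 1)"] conjI ballI impI)
      show "e / (M + 1) > 0" using e M0 by simp
      fix x' assume x': "x' \<in> {a..b}" "dist x' x < e / (M + 1)"
      have "dist (y x') (y x) \<le> M * dist x' x"
        using ylip[of x x'] ylip[of x' x] x x' by (auto simp: dist_norm norm_minus_commute abs_if)
      also have "\<dots> \<le> (M + 1) * dist x' x" by (intro mult_right_mono) auto
      also have "\<dots> < e" using x'(2) M0 by (simp add: pos_less_divide_eq mult.commute)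
      finally show "dist (y x') (y x) < e" .
    qed
  qed
  have g'y: "(\<lambda>s. g' s *\<^sub>C y s) integrable_on {c..d}" if "a \<le> c" "d \<le> b" for c d
  proof (rule integrable_continuous_real)
    have "continuous_on {c..d} y" by (rule continuous_on_subset[OF ycont]) (use that in auto)
    then show "continuous_on {c..d} (\<lambda>s. g' s *\<^sub>C y s)"
      using g'(1) by (intro scaleC.continuous_on) (auto intro: continuous_on_subset)
  qed
  have gr': "(\<lambda>s. g s *\<^sub>C r s) integrable_on {c..d}" if "a \<le> c" "d \<le> b" for c d
    using gr that by (intro integrable_on_subinterval[OF gr]) auto
  let ?H = "\<lambda>t. g t *\<^sub>C y t - integral {a..t} (\<lambda>s. g' s *\<^sub>C y s) - integral {a..t} (\<lambda>s. g s *\<^sub>C r s)"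
  have "?H a = ?H b"
  proof (rule eq_if_quadratic_increments[where H = ?H, OF ab])
    fix c d assume cd: "a \<le> c" "c \<le> d" "d \<le> b"
    \<comment> \<open>Write \<open>g d y d - g c y c\<close> as
      \<open>(g d - g c) y d + g c (y d - y c)\<close>. Compared with the two integrals, this
      freezes \<open>y\<close> at \<open>d\<close> and \<open>g\<close> at \<open>c\<close>; each
      frozen factor is off by order \<open>d - c\<close>, over a length
      \<open>d - c\<close>.\<close>
    have 1: "(g' has_integral (g d - g c)) {c..d}"
      by (rule fundamental_theorem_of_calculus[OF cd(2) has_vector_derivative_at_within[OF g]])
    have 2: "((\<lambda>s. g' s *\<^sub>C y d) has_integral ((g d - g c) *\<^sub>C y d)) {c..d}"
      using has_integral_linear[OF 1 scaleC.bounded_linear_left[of "y d"]] by (simp add: o_def)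
    have 3: "((\<lambda>s. g c *\<^sub>C r s) has_integral (g c *\<^sub>C (y d - y c))) {c..d}"
      using has_integral_linear[OF y[OF cd] scaleC.bounded_linear_right[of "g c"]] by (simp add: o_def)
    have 4: "((\<lambda>s. g' s *\<^sub>C y d - g' s *\<^sub>C y s + (g c *\<^sub>C r s - g s *\<^sub>C r s)) has_integral
      ((g d - g c) *\<^sub>C y d - integral {c..d} (\<lambda>s. g' s *\<^sub>C y s) +
       (g c *\<^sub>C (y d - y c) - integral {c..d} (\<lambda>s. g s *\<^sub>C r s)))) {c..d}"
      by (rule has_integral_add[OF has_integral_diff[OF 2 integrable_integral[OF g'y]]
            has_integral_diff[OF 3 integrable_integral[OF gr']]]) (use cd in auto)
    have "integral {a..d} (\<lambda>s. g' s *\<^sub>C y s) = integral {a..c} (\<lambda>s. g' s *\<^sub>C y s) + integral {c..d} (\<lambda>s. g' s *\<^sub>C y s)"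
      using g'y[of a d] cd by (simp add: Henstock_Kurzweil_Integration.integral_combine)
    moreover have "integral {a..d} (\<lambda>s. g s *\<^sub>C r s) = integral {a..c} (\<lambda>s. g s *\<^sub>C r s) + integral {c..d} (\<lambda>s. g s *\<^sub>C r s)"
      using gr'[of a d] cd by (simp add: Henstock_Kurzweil_Integration.integral_combine)
    ultimately have eq: "?H d - ?H c = (g d - g c) *\<^sub>C y d - integral {c..d} (\<lambda>s. g' s *\<^sub>C y s) +
       (g c *\<^sub>C (y d - y c) - integral {c..d} (\<lambda>s. g s *\<^sub>C r s))"
      by (simp add: scaleC.diff_left scaleC.diff_right)
    have "norm (?H d - ?H c) \<le> (2 * B * M * (d - c)) * (d - c)"
      unfolding eq
    proof (rule order_trans[OF has_integral_bound_real[OF _ finite.emptyI 4]])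
      show "0 \<le> 2 * B * M * (d - c)" using B0 M0 cd by simp
      fix s assume "s \<in> {c..d} - {}"
      then have s: "s \<in> {c..d}" by simp
      have "norm (g' s *\<^sub>C y d - g' s *\<^sub>C y s) = norm (g' s) * norm (y d - y s)"
        by (simp add: norm_scaleC flip: scaleC.diff_right)
      also have "\<dots> \<le> B * (M * (d - c))"
      proof (rule mult_mono[OF g'(2)])
        have "norm (y d - y s) \<le> M * (d - s)" using s cd by (intro ylip) auto
        also have "\<dots> \<le> M * (d - c)" using s M0 by (intro mult_left_mono) auto
        finally show "norm (y d - y s) \<le> M * (d - c)" .
      qed (use B0 in auto)
      finally have i: "norm (g' s *\<^sub>C y d - g' s *\<^sub>C y s) \<le> B * (M * (d - c))" .
      have "norm (g c *\<^sub>C r s - g s *\<^sub>C r s) = norm (g c - g s) * norm (r s)"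
        by (simp add: norm_scaleC flip: scaleC.diff_left)
      also have "\<dots> \<le> (B * (d - c)) * M"
      proof (rule mult_mono[OF _ r])
        have "norm (g c - g s) \<le> B * \<bar>c - s\<bar>" by (rule glip)
        also have "\<dots> \<le> B * (d - c)" using s B0 by (intro mult_left_mono) auto
        finally show "norm (g c - g s) \<le> B * (d - c)" .
      qed (use B0 cd in auto)
      finally have ii: "norm (g c *\<^sub>C r s - g s *\<^sub>C r s) \<le> (B * (d - c)) * M" .
      show "norm (g' s *\<^sub>C y d - g' s *\<^sub>C y s + (g c *\<^sub>C r s - g s *\<^sub>C r s)) \<le> 2 * B * M * (d - c)"
        using norm_triangle_le[OF add_mono[OF i ii]] by (simp add: algebra_simps)
    qed (use cd in auto)
    then show "norm (?H d - ?H c) \<le> 2 * B * M * (d - c)\<^sup>2" by (simp add: power2_eq_square mult.assoc)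
  qed
  then show ?thesis by (simp add: algebra_simps)
qed

lemma has_integral_UNIV_tendsto:
  fixes f :: "real \<Rightarrow> 'a::banach"
  assumes "f integrable_on UNIV"
  shows "(\<lambda>n. integral {- real n..real n} f) \<longlonglongrightarrow> integral UNIV f"
proof (rule tendstoI)
  fix e :: real assume "e > 0"
  then obtain B where B: "B > 0" "\<And>a b. ball 0 B \<subseteq> cbox a b \<Longrightarrow> norm (integral (cbox a b) f - integral UNIV f) < e"
    using integrable_integral[OF assms, unfolded has_integral_alt'] by auto
  have "\<forall>\<^sub>F n in sequentially. real n \<ge> B"
    using eventually_ge_at_top[of "nat \<lceil>B\<rceil>"] by eventually_elim linarith
  then show "\<forall>\<^sub>F n in sequentially. dist (integral {- real n..real n} f) (integral UNIV f) < e"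
  proof eventually_elim
    fix n assume "real n \<ge> B"
    then have "ball 0 B \<subseteq> cbox (- real n) (real n)" by (auto simp: dist_real_def)
    from B(2)[OF this] show "dist (integral {- real n..real n} f) (integral UNIV f) < e"
      by (simp add: dist_norm)
  qed
qed

text \<open>The jump of \<open>W\<close> at \<open>0\<close> produces the boundary term when \<open>J'\<close> is the half-line.\<close>

lemma convolution_by_parts:
  fixes W P :: "real \<Rightarrow> 'a::complex_banach" and g g' :: "real \<Rightarrow> complex"
  assumes J': "J' \<in> {{0..}, UNIV}"
    and W: "bounded_sm Mw W" and P: "bounded_sm M P"
    and W0: "\<And>t. t \<notin> J' \<Longrightarrow> W t = 0" and P0: "\<And>t. t \<notin> J' \<Longrightarrow> P t = 0"
    and WP: "\<And>c d. c \<le> d \<Longrightarrow> c \<in> J' \<Longrightarrow> (P has_integral (W d - W c)) {c..d}"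
    and g: "\<And>t. (g has_vector_derivative g' t) (at t)"
    and g': "continuous_on UNIV g'" "\<And>t. norm (g' t) \<le> B"
    and int: "integrable lebesgue g" "integrable lebesgue g'"
    and lim: "(g \<longlongrightarrow> 0) at_top" "(g \<longlongrightarrow> 0) at_bot"
    and t: "t \<in> J'"
  shows "convolution W g' t = convolution P g t + (if J' = UNIV then 0 else g t *\<^sub>C W 0)"
proof -
  \<comment> \<open>On the half-line \<open>W (t - s)\<close> vanishes for \<open>s > t\<close> and
    may jump at \<open>s = t\<close>, where its integral representation breaks off. Integration by
    parts therefore stops at \<open>t\<close>, and the jump appears as an endpoint term.\<close>
  define b where "b n = (if J' = UNIV then real n else t)" for n :: nat
  let ?F = "\<lambda>s. g' s *\<^sub>C W (t - s)" and ?G = "\<lambda>s. g s *\<^sub>C P (t - s)"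
  note Fi = convolution_integrable[OF int(2) W, of t] and Gi = convolution_integrable[OF int(1) P, of t]
  have Fi': "?F integrable_on {c..d}" and Gi': "?G integrable_on {c..d}" for c d
    by (rule integrable_on_subinterval[OF Fi] integrable_on_subinterval[OF Gi], simp)+
  have J'cases: "J' = UNIV \<or> J' = {0..}" using J' by auto
  have restrict: "integral {- real n..real n} h = integral {- real n..b n} h"
    if n: "real n \<ge> \<bar>t\<bar>" and h: "\<And>c d. h integrable_on {c..d}" and z: "\<And>s. t - s \<notin> J' \<Longrightarrow> h s = 0"
    for n and h :: "real \<Rightarrow> 'a"
  proof (cases "J' = UNIV")
    case False
    then have J0: "J' = {0..}" using J'cases by simp
    have "integral {- real n..real n} h = integral {- real n..t} h + integral {t..real n} h"
      using n h by (intro Henstock_Kurzweil_Integration.integral_combine[symmetric]) auto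
    also have "integral {t..real n} h = integral {t..real n} (\<lambda>_. 0)"
    \<comment> \<open>At \<open>s = t\<close> the argument \<open>t - s = 0\<close> still lies in
      \<open>J'\<close>, so \<open>h\<close> need not vanish there; a single point is
      negligible.\<close>
    proof (rule integral_spike[of "{t}"])
      show "0 = h s" if "s \<in> {t..real n} - {t}" for s
        using that z[of s] J0 by auto
    qed simp
    finally show ?thesis using False by (simp add: b_def)
  qed (simp add: b_def)
  have parts: "integral {- real n..b n} ?F =
      g (b n) *\<^sub>C W (t - b n) - g (- real n) *\<^sub>C W (t + real n) + integral {- real n..b n} ?G"
    if n: "real n \<ge> \<bar>t\<bar>" for n
  proof -
    \<comment> \<open>The minus sign in front of \<open>P\<close> comes from the reflection: as a
      function of \<open>s\<close>, \<open>W (t - s)\<close> is an indefinite integral of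
      \<open>- P (t - s)\<close>.\<close>
    have "integral {- real n..b n} ?F = g (b n) *\<^sub>C W (t - b n) - g (- real n) *\<^sub>C W (t - (- real n))
        - integral {- real n..b n} (\<lambda>s. g s *\<^sub>C - P (t - s))"
    proof (rule integral_by_parts_interval[where M = M and B = B])
      show "- real n \<le> b n" using n by (auto simp: b_def)
      show "((\<lambda>s. - P (t - s)) has_integral (W (t - d) - W (t - c))) {c..d}"
        if cd: "- real n \<le> c" "c \<le> d" "d \<le> b n" for c d
      proof -
        have "t - d \<in> J'" using cd J'cases by (auto simp: b_def)
        then have "(P has_integral (W (t - c) - W (t - d))) (cbox (t - d) (t - c))"
          using WP[of "t - d" "t - c"] cd by simp
        from has_integral_affinity[OF this, of "-1" t]
        have "((\<lambda>s. P (t - s)) has_integral (W (t - c) - W (t - d))) ((\<lambda>x. t - x) ` {t - d..t - c})"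
          by simp
        moreover have "(\<lambda>x. t - x) ` {t - d..t - c} = {c..d}"
          by (simp add: image_diff_atLeastAtMost)
        ultimately have "((\<lambda>s. P (t - s)) has_integral (W (t - c) - W (t - d))) {c..d}" by simp
        from has_integral_neg[OF this] show ?thesis by simp
      qed
      show "norm (- P (t - s)) \<le> M" for s using bounded_smD(2)[OF P] by simp
      show "(\<lambda>s. g s *\<^sub>C - P (t - s)) integrable_on {- real n..b n}"
        using integrable_neg[OF Gi'] by (simp add: scaleC.minus_right)
    qed (use g g' in auto)
    then show ?thesis by (simp add: scaleC.minus_right)
  qed
  have ev: "\<forall>\<^sub>F n in sequentially. real n \<ge> \<bar>t\<bar>"
    using filterlim_real_sequentially unfolding filterlim_at_top by blast
  have bnd: "((\<lambda>n. h n *\<^sub>C W (k n)) \<longlonglongrightarrow> 0)" if "h \<longlonglongrightarrow> 0" for h :: "nat \<Rightarrow> complex" and k :: "nat \<Rightarrow> real"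
  proof (rule tendsto_norm_zero_cancel, rule tendsto_sandwich[OF _ _ tendsto_const])
    show "\<forall>\<^sub>F n in sequentially. 0 \<le> norm (h n *\<^sub>C W (k n))" by simp
    show "\<forall>\<^sub>F n in sequentially. norm (h n *\<^sub>C W (k n)) \<le> norm (h n) * Mw"
      using mult_left_mono[OF bounded_smD(2)[OF W] norm_ge_zero]
      by (intro always_eventually allI) (simp only: norm_scaleC)
    show "(\<lambda>n. norm (h n) * Mw) \<longlonglongrightarrow> 0"
      by (rule tendsto_mult_left_zero[OF tendsto_norm_zero[OF that]])
  qed
  \<comment> \<open>On the whole line the endpoint term is bounded times \<open>g (real n)\<close>
    and disappears. On the half-line \<open>t - b n = 0\<close> for every \<open>n\<close>, so it is
    constant.\<close>
  have l1: "(\<lambda>n. g (b n) *\<^sub>C W (t - b n)) \<longlonglongrightarrow> (if J' = UNIV then 0 else g t *\<^sub>C W 0)"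
  proof (cases "J' = UNIV")
    case True
    have "(\<lambda>n. g (real n)) \<longlonglongrightarrow> 0" by (rule filterlim_compose[OF lim(1) filterlim_real_sequentially])
    then show ?thesis using True bnd[of "\<lambda>n. g (real n)"] by (simp add: b_def)
  qed (simp add: b_def)
  have "(\<lambda>n. g (- real n)) \<longlonglongrightarrow> 0"
    by (rule filterlim_compose[OF lim(2)]) (simp add: filterlim_real_sequentially filterlim_uminus_at_bot)
  then have l2: "(\<lambda>n. g (- real n) *\<^sub>C W (t + real n)) \<longlonglongrightarrow> 0" by (rule bnd)
  have "(\<lambda>n. g (b n) *\<^sub>C W (t - b n) - g (- real n) *\<^sub>C W (t + real n) + integral {- real n..real n} ?G)
    \<longlonglongrightarrow> (if J' = UNIV then 0 else g t *\<^sub>C W 0) - 0 + integral UNIV ?G"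
    by (rule tendsto_add[OF tendsto_diff[OF l1 l2] has_integral_UNIV_tendsto[OF Gi]])
  then have "(\<lambda>n. integral {- real n..real n} ?F)
    \<longlonglongrightarrow> (if J' = UNIV then 0 else g t *\<^sub>C W 0) - 0 + integral UNIV ?G"
  proof (rule Lim_transform_eventually)
    show "\<forall>\<^sub>F n in sequentially. g (b n) *\<^sub>C W (t - b n) - g (- real n) *\<^sub>C W (t + real n) +
        integral {- real n..real n} ?G = integral {- real n..real n} ?F"
      using ev
    proof eventually_elim
      fix n assume n: "real n \<ge> \<bar>t\<bar>"
      have rF: "integral {- real n..real n} ?F = integral {- real n..b n} ?F"
        by (rule restrict[OF n Fi']) (simp add: W0 scaleC.zero_right)
      have rG: "integral {- real n..real n} ?G = integral {- real n..b n} ?G"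
        by (rule restrict[OF n Gi']) (simp add: P0 scaleC.zero_right)
      show "g (b n) *\<^sub>C W (t - b n) - g (- real n) *\<^sub>C W (t + real n) +
        integral {- real n..real n} ?G = integral {- real n..real n} ?F"
        unfolding rF rG parts[OF n] ..
    qed
  qed
  from LIMSEQ_unique[OF has_integral_UNIV_tendsto[OF Fi] this] show ?thesis
    by (simp add: convolution_eq_integral[OF int(2) W] convolution_eq_integral[OF int(1) P] add.commute)
qed

section \<open>Mild solutions\<close>

lemma bounded_sm_add:
  assumes "bounded_sm M \<Phi>" "bounded_sm N \<Psi>"
  shows "bounded_sm (M + N) (\<lambda>t. \<Phi> t + \<Psi> t)"
  using assms unfolding bounded_sm_def
  by (auto intro: strongly_measurable_add norm_triangle_le add_mono)

lemma bounded_sm_cmult: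
  fixes \<Phi> :: "real \<Rightarrow> 'a::complex_banach"
  assumes "bounded_sm M \<Phi>"
  shows "bounded_sm (norm c * M) (\<lambda>t. c *\<^sub>C \<Phi> t)"
  using assms unfolding bounded_sm_def
  by (auto intro: strongly_measurable_scaleC mult_left_mono simp: norm_scaleC)

lemma convolution_fun_add:
  fixes \<Phi> \<Psi> :: "real \<Rightarrow> 'a::complex_banach"
  assumes f: "integrable lebesgue f" and P: "bounded_sm M \<Phi>" and Q: "bounded_sm N \<Psi>"
  shows "convolution (\<lambda>t. \<Phi> t + \<Psi> t) f t = convolution \<Phi> f t + convolution \<Psi> f t"
  using convolution_integrable[OF f P] convolution_integrable[OF f Q]
  by (simp add: convolution_eq_integral[OF f P] convolution_eq_integral[OF f Q]
      convolution_eq_integral[OF f bounded_sm_add[OF P Q]] scaleC_add_right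
      Henstock_Kurzweil_Integration.integral_add)

lemma convolution_fun_cmult:
  fixes \<Phi> :: "real \<Rightarrow> 'a::complex_banach"
  assumes f: "integrable lebesgue f" and P: "bounded_sm M \<Phi>"
  shows "convolution (\<lambda>t. c *\<^sub>C \<Phi> t) f t = c *\<^sub>C convolution \<Phi> f t"
  using integral_linear[OF convolution_integrable[OF f P] scaleC.bounded_linear_right, of c t]
  by (simp add: convolution_eq_integral[OF f P] convolution_eq_integral[OF f bounded_sm_cmult[OF P]]
      scaleC_scaleC o_def mult.commute)

lemma bounded_sm_L_infinity:
  assumes phi: "\<phi> \<in> L_infinity J" and J': "J' \<in> {{0..}, UNIV}" "J' \<subseteq> J"
  obtains M where "bounded_sm M (\<lambda>t. if t \<in> J' then \<phi> t else 0)"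
proof -
  from phi have sm: "strongly_measurable_on J \<phi>" and b: "bounded (\<phi> ` J)"
    by (auto simp: L_infinity_def)
  obtain M where M: "\<And>t. t \<in> J \<Longrightarrow> norm (\<phi> t) \<le> M"
    using b by (auto simp: bounded_iff)
  have "strongly_measurable_on UNIV (\<lambda>t. if t \<in> J' then \<phi> t else 0)"
    using J' by (intro strongly_measurable_restrict[OF sm]) auto
  then have "bounded_sm (max M 0) (\<lambda>t. if t \<in> J' then \<phi> t else 0)"
    using M J'(2) by (auto simp: bounded_sm_def le_max_iff_disj)
  then show ?thesis by (rule that)
qed

lemma BC_subset_L_infinity:
  assumes J: "J \<in> {{0..}, UNIV}"
  shows "BC J \<subseteq> (L_infinity J :: (real \<Rightarrow> 'a::complex_banach) set)"
proof
  fix u :: "real \<Rightarrow> 'a" assume u: "u \<in> BC J"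
  then have c: "continuous_on J u" by (simp add: BC_def)
  \<comment> \<open>\<open>p\<close> is a continuous retraction of the line onto \<open>J\<close>,
    so \<open>u\<close> composed with \<open>p\<close> extends \<open>u\<close> continuously and is
    strongly measurable.\<close>
  define p where "p t = (if J = UNIV then t else max 0 t)" for t :: real
  have p: "continuous_on UNIV p" "\<And>t. p t \<in> J" "\<And>t. t \<in> J \<Longrightarrow> p t = t"
    using J by (auto simp: p_def[abs_def] intro!: continuous_intros)
  have "continuous_on UNIV (\<lambda>t. u (p t))"
    by (rule continuous_on_compose2[OF c p(1)]) (use p(2) in auto)
  then have "strongly_measurable_on UNIV (\<lambda>t. u (p t))"
    by (rule strongly_measurable_continuous)
  then obtain s where s: "\<And>n. simple_function lebesgue (s n)"
    "AE t in lebesgue. (\<lambda>n. s n t) \<longlonglongrightarrow> u (p t)"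
    by (auto simp: strongly_measurable_on_def)
  have "AE t in lebesgue. t \<in> J \<longrightarrow> (\<lambda>n. s n t) \<longlonglongrightarrow> u t"
    using s(2) by eventually_elim (use p(3) in auto)
  then have "strongly_measurable_on J u"
    using s(1) by (auto simp: strongly_measurable_on_def)
  with u show "u \<in> L_infinity J" by (simp add: BC_def L_infinity_def)
qed

section \<open>Oriented integrals of the extended functions\<close>

lemma
  fixes \<Phi> \<phi> :: "real \<Rightarrow> 'a::complex_banach"
  assumes P: "bounded_sm M \<Phi>" and eq: "\<And>s. s \<in> {a..b} \<Longrightarrow> \<phi> s = \<Phi> s"
  shows bounded_sm_integrable_on: "\<Phi> integrable_on {a..b}"
    and bochner_set_integral_eq: "bochner_set_integral {a..b} \<phi> = integral {a..b} \<Phi>"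
proof -
  have ind: "(\<lambda>s. indicator {a..b} s *\<^sub>R \<phi> s) = (\<lambda>s. indicator {a..b} s *\<^sub>R \<Phi> s)"
  proof
    show "indicator {a..b} s *\<^sub>R \<phi> s = indicator {a..b} s *\<^sub>R \<Phi> s" for s
      by (cases "s \<in> {a..b}") (simp_all add: eq)
  qed
  have "bochner_integrable lebesgue (\<lambda>s. indicator {a..b} s *\<^sub>R \<Phi> s)"
  proof (rule bochner_integrableI)
    show "strongly_measurable_on UNIV (\<lambda>s. indicator {a..b} s *\<^sub>R \<Phi> s)"
      by (intro strongly_measurable_scaleR borel_measurable_indicator bounded_smD(1)[OF P]) auto
    show "integrable lebesgue (\<lambda>s. M * indicat_real {a..b} s)"
      by (intro integrable_mult_right integrable_real_indicator; cases "a \<le> b") auto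
    show "norm (indicator {a..b} s *\<^sub>R \<Phi> s) \<le> M * indicat_real {a..b} s" for s
      using bounded_smD(2)[OF P] by (simp add: indicator_def)
  qed
  note * = bochner_integral_eq_integral[OF this]
  have r: "(\<lambda>s. indicator {a..b} s *\<^sub>R \<Phi> s) = (\<lambda>s. if s \<in> {a..b} then \<Phi> s else 0)"
    by (auto simp: indicator_def)
  show "\<Phi> integrable_on {a..b}" using *(1) unfolding r integrable_restrict_UNIV .
  show "bochner_set_integral {a..b} \<phi> = integral {a..b} \<Phi>"
    unfolding bochner_set_integral_def ind *(2) unfolding r integral_restrict_UNIV ..
qed

lemma integral_from_0_diff:
  fixes \<Phi> \<phi> :: "real \<Rightarrow> 'a::complex_banach"
  assumes J': "J' \<in> {{0..}, UNIV}" and P: "bounded_sm M \<Phi>" and eq: "\<And>s. s \<in> J' \<Longrightarrow> \<phi> s = \<Phi> s"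
    and c: "c \<in> J'" and cd: "c \<le> d"
  shows "integral_from_0 d \<phi> - integral_from_0 c \<phi> = integral {c..d} \<Phi>"
proof -
  have e: "bochner_set_integral {a..b} \<phi> = integral {a..b} \<Phi>" if "a \<in> J'" for a b
    using that J' by (intro bochner_set_integral_eq[OF P] eq) auto
  note i = bounded_sm_integrable_on[OF P refl]
  have 0: "0 \<in> J'" "d \<in> J'" using J' c cd by auto
  consider "0 \<le> c" | "c < 0" "0 \<le> d" | "d < 0" by linarith
  then show ?thesis
  proof cases
    case 1
    then show ?thesis
      using cd Henstock_Kurzweil_Integration.integral_combine[OF 1 cd i]
      by (simp add: integral_from_0_def e 0 algebra_simps)
  next
    case 2
    then show ?thesis
      using Henstock_Kurzweil_Integration.integral_combine[of c 0 d, OF _ _ i]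
      by (simp add: integral_from_0_def e 0 c add.commute)
  next
    case 3
    then show ?thesis
      using cd Henstock_Kurzweil_Integration.integral_combine[of c d 0, OF _ _ i]
      by (simp add: integral_from_0_def e 0 c algebra_simps)
  qed
qed

text \<open>For \<open>v = integral_from_0 t u\<close> the mild equation gives \<open>A v\<close>,
  and \<open>R (z v - A v) = v\<close> then expresses \<open>R (u t)\<close> through integrals and
  the constant \<open>R x\<close>. The constant cancels in the difference between \<open>d\<close>
  and \<open>c\<close>.\<close>

lemma mild_solution_resolvent:
  fixes u \<phi> :: "real \<Rightarrow> 'a::complex_banach"
  assumes J': "J' \<in> {{0..}, UNIV}" and mild: "mild_solution J D A \<phi> x u" and sub: "J' \<subseteq> J"
    and R: "bounded_clinear R" "\<And>x. x \<in> D \<Longrightarrow> R (z *\<^sub>C x - A x) = x"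
    and U: "bounded_sm Mu U" "\<And>s. s \<in> J' \<Longrightarrow> u s = U s"
    and P: "bounded_sm M \<Phi>" "\<And>s. s \<in> J' \<Longrightarrow> \<phi> s = \<Phi> s"
    and cd: "c \<le> d" "c \<in> J'"
  shows "((\<lambda>t. z *\<^sub>C R (U t) + ((-1) *\<^sub>C U t + R (\<Phi> t))) has_integral (R (U d) - R (U c))) {c..d}"
proof -
  have R1: "bounded_linear R" and R2: "\<And>c x. R (c *\<^sub>C x) = c *\<^sub>C R x"
    using R(1) by (auto simp: bounded_clinear_def)
  interpret R: bounded_linear R by (rule R1)
  have d: "d \<in> J'" using cd J' by auto
  have Rt: "R (U t) = z *\<^sub>C R (integral_from_0 t u) - integral_from_0 t u + R x + R (integral_from_0 t \<phi>)"
    if t: "t \<in> J'" for t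
  proof -
    have "integral_from_0 t u \<in> D" and "u t - x = A (integral_from_0 t u) + integral_from_0 t \<phi>"
      using mild t sub by (auto simp: mild_solution_def)
    then have "A (integral_from_0 t u) = U t - x - integral_from_0 t \<phi>"
      using U(2)[OF t] by (simp add: algebra_simps)
    with R(2)[OF \<open>integral_from_0 t u \<in> D\<close>]
    have "R (z *\<^sub>C integral_from_0 t u - (U t - x - integral_from_0 t \<phi>)) = integral_from_0 t u"
      by simp
    then have "z *\<^sub>C R (integral_from_0 t u) - (R (U t) - R x - R (integral_from_0 t \<phi>)) = integral_from_0 t u"
      by (simp add: R.diff R2)
    then show ?thesis by (simp add: algebra_simps)
  qed
  have iU: "(U has_integral (integral_from_0 d u - integral_from_0 c u)) {c..d}"
    unfolding integral_from_0_diff[where \<phi> = u, OF J' U(1) U(2) cd(2) cd(1), simplified]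
    by (rule integrable_integral[OF bounded_sm_integrable_on[OF U(1) refl]])
  have iP: "(\<Phi> has_integral (integral_from_0 d \<phi> - integral_from_0 c \<phi>)) {c..d}"
    unfolding integral_from_0_diff[where \<phi> = \<phi>, OF J' P(1) P(2) cd(2) cd(1), simplified]
    by (rule integrable_integral[OF bounded_sm_integrable_on[OF P(1) refl]])
  let ?dU = "integral_from_0 d u - integral_from_0 c u" and ?dP = "integral_from_0 d \<phi> - integral_from_0 c \<phi>"
  have 1: "((\<lambda>t. z *\<^sub>C R (U t)) has_integral (z *\<^sub>C R ?dU)) {c..d}"
    using has_integral_linear[OF has_integral_linear[OF iU R1] scaleC.bounded_linear_right[of z]]
    by (simp add: o_def)
  have 2: "((\<lambda>t. (-1) *\<^sub>C U t) has_integral ((-1) *\<^sub>C ?dU)) {c..d}"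
    using has_integral_linear[OF iU scaleC.bounded_linear_right[of "-1"]] by (simp add: o_def)
  have 3: "((\<lambda>t. R (\<Phi> t)) has_integral (R ?dP)) {c..d}"
    using has_integral_linear[OF iP R1] by (simp add: o_def)
  have "z *\<^sub>C R ?dU + ((-1) *\<^sub>C ?dU + R ?dP) = R (U d) - R (U c)"
    unfolding Rt[OF d] Rt[OF cd(2)] by (simp add: R.diff scaleC.diff_right scaleC.minus_left)
  then show ?thesis using has_integral_add[OF 1 has_integral_add[OF 2 3]] by simp
qed

section \<open>Ideals defined by a translation invariant class\<close>

lemma
  fixes f :: "real \<Rightarrow> complex"
  assumes "integrable lborel f"
  shows integrable_lebesgueI: "integrable lebesgue f"
    and integral_lebesgue_lborel: "(\<integral>t. f t \<partial>lebesgue) = (\<integral>t. f t \<partial>lborel)"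
    and L1_norm_lebesgue: "(\<integral>t. norm (f t) \<partial>lebesgue) = L1_norm f"
  using assms integrable_completion[of f lborel] integral_completion[of f lborel]
    integral_completion[of "\<lambda>t. norm (f t)" lborel]
  by (auto dest: borel_measurable_integrable)

lemma norm_convolution_le':
  fixes \<Phi> :: "real \<Rightarrow> 'a::complex_banach"
  assumes f: "integrable lborel f" and P: "bounded_sm M \<Phi>"
  shows "norm (convolution \<Phi> f t) \<le> M * L1_norm f"
  using norm_convolution_le[OF integrable_lebesgueI[OF f] P] L1_norm_lebesgue[OF f] by simp

text \<open>Continuity of translation in L1 gives uniform continuity. This makes the invariance
  hypothesis on \<open>F\<close> applicable to convolutions of functions that are themselves only
  bounded and measurable.\<close>

lemma convolution_BUC:
  fixes \<Phi> :: "real \<Rightarrow> 'a::complex_banach"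
  assumes f: "integrable lborel f" and P: "bounded_sm M \<Phi>"
  shows "convolution \<Phi> f \<in> BUC UNIV"
  unfolding BUC_def
proof (intro CollectI conjI)
  show "bounded (range (convolution \<Phi> f))"
    using norm_convolution_le'[OF f P] by (auto simp: bounded_iff)
  show "uniformly_continuous_on UNIV (convolution \<Phi> f)"
    unfolding uniformly_continuous_on_def
  proof (intro allI impI)
    fix e :: real assume e: "e > 0"
    have M: "M \<ge> 0" by (rule bounded_smD(3)[OF P])
    obtain d where d: "d > 0" "\<And>h. \<bar>h\<bar> < d \<Longrightarrow> L1_norm (\<lambda>t. f (t + h) - f t) < e / (M + 1)"
      using L1_translation_continuous[OF f, of "e / (M + 1)"] e M by auto
    show "\<exists>d>0. \<forall>x\<in>UNIV. \<forall>x'\<in>UNIV. dist x' x < d \<longrightarrow> dist (convolution \<Phi> f x') (convolution \<Phi> f x) < e"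
    proof (intro exI[of _ d] conjI ballI impI d(1))
      fix x x' :: real assume h: "dist x' x < d"
      let ?h = "x' - x"
      note int = integrable_translate(1)[OF f, of ?h]
      have "convolution \<Phi> f x' = convolution \<Phi> (\<lambda>s. f (s + ?h)) x"
        using convolution_translate[OF integrable_lebesgueI[OF f] P, of x ?h] by simp
      then have "dist (convolution \<Phi> f x') (convolution \<Phi> f x) = norm (convolution \<Phi> (\<lambda>s. f (s + ?h) - f s) x)"
        by (simp add: dist_norm convolution_diff[OF integrable_lebesgueI[OF int] integrable_lebesgueI[OF f] P])
      also have "\<dots> \<le> M * L1_norm (\<lambda>s. f (s + ?h) - f s)"
        by (rule norm_convolution_le'[OF Bochner_Integration.integrable_diff[OF int f] P])
      also have "\<dots> \<le> (M + 1) * L1_norm (\<lambda>s. f (s + ?h) - f s)" by (intro mult_right_mono) auto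
      also have "\<dots> < e"
        using d(2)[of ?h] h M by (simp add: dist_real_def pos_less_divide_eq mult.commute)
      finally show "dist (convolution \<Phi> f x') (convolution \<Phi> f x) < e" .
    qed
  qed
qed (simp add: extensional_def)

locale invariant_class =
  fixes J' :: "real set" and F :: "(real \<Rightarrow> 'a::complex_banach) set"
  assumes J': "J' \<in> {{0..}, UNIV}"
    and F_lin: "function_subspace J' F"
    and F_closed: "uniformly_closed J' F"
    and F_inv: "BUC_invariant J' F"
begin

lemma zero_mem: "restrict (\<lambda>t. 0) J' \<in> F"
  using F_lin by (simp add: function_subspace_def)

lemma add_mem:
  assumes "restrict f J' \<in> F" "restrict g J' \<in> F"
  shows "restrict (\<lambda>t. f t + g t) J' \<in> F"
proof -
  have "(\<lambda>t\<in>J'. restrict f J' t + restrict g J' t) \<in> F"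
    using assms F_lin unfolding function_subspace_def by blast
  moreover have "(\<lambda>t\<in>J'. restrict f J' t + restrict g J' t) = restrict (\<lambda>t. f t + g t) J'"
    by (auto simp: restrict_def)
  ultimately show ?thesis by simp
qed

lemma cmult_mem:
  assumes "restrict f J' \<in> F"
  shows "restrict (\<lambda>t. c *\<^sub>C f t) J' \<in> F"
proof -
  have "(\<lambda>t\<in>J'. c *\<^sub>C restrict f J' t) \<in> F"
    using assms F_lin unfolding function_subspace_def by blast
  moreover have "(\<lambda>t\<in>J'. c *\<^sub>C restrict f J' t) = restrict (\<lambda>t. c *\<^sub>C f t) J'"
    by (auto simp: restrict_def)
  ultimately show ?thesis by simp
qed

lemma approx_mem:
  assumes "\<And>e. e > 0 \<Longrightarrow> \<exists>g. restrict g J' \<in> F \<and> (\<forall>t\<in>J'. norm (h t - g t) < e)"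
  shows "restrict h J' \<in> F"
proof -
  have "\<forall>n. \<exists>g. restrict g J' \<in> F \<and> (\<forall>t\<in>J'. norm (h t - g t) < 1 / real (Suc n))"
    by (intro allI assms) simp
  then obtain g where g: "\<And>n. restrict (g n) J' \<in> F" "\<And>n t. t \<in> J' \<Longrightarrow> norm (h t - g n t) < 1 / real (Suc n)"
    by metis
  have "uniform_limit J' (\<lambda>n. restrict (g n) J') (restrict h J') sequentially"
  proof (rule uniform_limitI)
    fix e :: real assume "e > 0"
    then obtain N where N: "1 / real (Suc N) < e" using nat_approx_posE by blast
    show "\<forall>\<^sub>F n in sequentially. \<forall>t\<in>J'. dist (restrict (g n) J' t) (restrict h J' t) < e"
      using eventually_ge_at_top[of N]
    proof eventually_elim
      fix n assume "N \<le> n"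
      then have "1 / real (Suc n) \<le> 1 / real (Suc N)" by (simp add: field_simps)
      with N g(2)[of _ n] show "\<forall>t\<in>J'. dist (restrict (g n) J' t) (restrict h J' t) < e"
        by (force simp: dist_norm norm_minus_commute)
    qed
  qed
  with F_closed g(1) show ?thesis unfolding uniformly_closed_def
    by (auto dest!: spec[of _ "\<lambda>n. restrict (g n) J'"] spec[of _ "restrict h J'"])
qed

lemma translate_mem:
  assumes "\<psi> \<in> BUC UNIV" "restrict \<psi> J' \<in> F"
  shows "restrict (\<lambda>t. \<psi> (t + a)) J' \<in> F"
  using F_inv assms unfolding BUC_invariant_def by blast

text \<open>The kernels are integrable for \<open>lborel\<close>, so that Fubini for Borel product
  measures applies. The passage from the Lebesgue integrable kernels of
  \<open>reduced_spectrum\<close> is made in \<open>not_reduced_spectrum_iff\<close>.\<close>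

definition conv_ideal :: "(real \<Rightarrow> 'a) \<Rightarrow> (real \<Rightarrow> complex) set" where
  "conv_ideal \<Phi> = {f. integrable lborel f \<and> restrict (convolution \<Phi> f) J' \<in> F}"

text \<open>Closedness rests on \<open>norm_convolution_le'\<close>: approximation of kernels in L1
  becomes uniform approximation of convolutions, under which \<open>F\<close> is closed.\<close>

lemma conv_ideal_closed_subspace:
  assumes P: "bounded_sm M \<Phi>"
  shows "L1_closed_subspace (conv_ideal \<Phi>)"
  unfolding L1_closed_subspace_def
proof (intro conjI ballI allI impI)
  show "conv_ideal \<Phi> \<subseteq> Collect (integrable lborel)" by (auto simp: conv_ideal_def)
  have "convolution \<Phi> (\<lambda>_. 0) t = 0" for t
    using convolution_cmult[of "\<lambda>_. 0" M \<Phi> 0 t] P by (simp add: scaleC.zero_left)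
  then have "convolution \<Phi> (\<lambda>_. 0) = (\<lambda>_. 0)" by auto
  then show "(\<lambda>_. 0) \<in> conv_ideal \<Phi>" using zero_mem by (simp add: conv_ideal_def)
next
  fix f g assume fg: "f \<in> conv_ideal \<Phi>" "g \<in> conv_ideal \<Phi>"
  then have "convolution \<Phi> (\<lambda>t. f t + g t) = (\<lambda>t. convolution \<Phi> f t + convolution \<Phi> g t)"
    by (intro ext convolution_add[OF _ _ P] integrable_lebesgueI) (auto simp: conv_ideal_def)
  then show "(\<lambda>t. f t + g t) \<in> conv_ideal \<Phi>"
    using fg add_mem by (simp add: conv_ideal_def)
next
  fix c f assume f: "f \<in> conv_ideal \<Phi>"
  then have "convolution \<Phi> (\<lambda>t. c * f t) = (\<lambda>t. c *\<^sub>C convolution \<Phi> f t)"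
    by (intro ext convolution_cmult[OF _ P] integrable_lebesgueI) (auto simp: conv_ideal_def)
  then show "(\<lambda>t. c * f t) \<in> conv_ideal \<Phi>"
    using f cmult_mem by (simp add: conv_ideal_def)
next
  fix f assume "integrable lborel f \<and> (\<forall>e>0. \<exists>g\<in>conv_ideal \<Phi>. L1_norm (\<lambda>t. f t - g t) < e)"
  then have f: "integrable lborel f" and *: "\<And>e. e > 0 \<Longrightarrow> \<exists>g\<in>conv_ideal \<Phi>. L1_norm (\<lambda>t. f t - g t) < e"
    by auto
  have "restrict (convolution \<Phi> f) J' \<in> F"
  proof (rule approx_mem)
    fix e :: real assume e: "e > 0"
    have M: "M \<ge> 0" by (rule bounded_smD(3)[OF P])
    obtain g where g: "integrable lborel g" "restrict (convolution \<Phi> g) J' \<in> F"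
      "L1_norm (\<lambda>t. f t - g t) < e / (M + 1)"
      using *[of "e / (M + 1)"] e M by (auto simp: conv_ideal_def)
    have "norm (convolution \<Phi> f t - convolution \<Phi> g t) < e" for t
    proof -
      have "norm (convolution \<Phi> f t - convolution \<Phi> g t) = norm (convolution \<Phi> (\<lambda>s. f s - g s) t)"
        by (simp add: convolution_diff[OF integrable_lebesgueI[OF f] integrable_lebesgueI[OF g(1)] P])
      also have "\<dots> \<le> M * L1_norm (\<lambda>s. f s - g s)"
        by (rule norm_convolution_le'[OF Bochner_Integration.integrable_diff[OF f g(1)] P])
      also have "\<dots> \<le> (M + 1) * L1_norm (\<lambda>s. f s - g s)" by (intro mult_right_mono) auto
      also have "\<dots> < e" using g(3) M by (simp add: pos_less_divide_eq mult.commute)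
      finally show ?thesis .
    qed
    then show "\<exists>h. restrict h J' \<in> F \<and> (\<forall>t\<in>J'. norm (convolution \<Phi> f t - h t) < e)"
      using g(2) by blast
  qed
  then show "f \<in> conv_ideal \<Phi>" using f by (simp add: conv_ideal_def)
qed

text \<open>Translating the kernel translates the convolution, and the latter is in
  \<open>BUC UNIV\<close>; so the closed subspace is translation invariant and the ideal property
  follows.\<close>

lemma conv_ideal_sconv:
  assumes P: "bounded_sm M \<Phi>" and f: "f \<in> conv_ideal \<Phi>" and k: "integrable lborel k"
  shows "sconv f k \<in> conv_ideal \<Phi>"
proof (rule L1_closed_translation_invariant_ideal[OF conv_ideal_closed_subspace[OF P] _ f k])
  fix f a assume "f \<in> conv_ideal \<Phi>"
  then have f: "integrable lborel f" "restrict (convolution \<Phi> f) J' \<in> F" by (auto simp: conv_ideal_def)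
  have "convolution \<Phi> (\<lambda>t. f (t - a)) = (\<lambda>t. convolution \<Phi> f (t + (- a)))"
    using convolution_translate[OF integrable_lebesgueI[OF f(1)] P, of _ "- a"] by auto
  then show "(\<lambda>t. f (t - a)) \<in> conv_ideal \<Phi>"
    using translate_mem[OF convolution_BUC[OF f(1) P] f(2), of "- a"] integrable_translate(2)[OF f(1)]
    by (simp add: conv_ideal_def)
qed

text \<open>A compactly supported function on the half-line is a translate of one that vanishes there.\<close>

lemma vanishing_at_infinity_mem:
  fixes g :: "real \<Rightarrow> complex"
  assumes J0: "J' = {0..}" and lip: "\<And>s t. norm (g s - g t) \<le> L * \<bar>s - t\<bar>"
    and bnd: "\<And>t. norm (g t) \<le> B" and lim: "(g \<longlongrightarrow> 0) at_top"
  shows "restrict (\<lambda>t. g t *\<^sub>C y) J' \<in> F"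
proof (rule approx_mem)
  fix e :: real assume e: "e > 0"
  have L: "L \<ge> 0" using order_trans[OF norm_ge_zero lip[of 1 0]] by simp
  have B: "B \<ge> 0" using bnd[of 0] norm_ge_zero order_trans by blast
  have "\<forall>\<^sub>F t in at_top. norm (g t) < e / (norm y + 1)"
    using tendstoD[OF lim, of "e / (norm y + 1)"] e by (simp add: add_nonneg_pos)
  then obtain N where N: "\<And>t. t \<ge> N \<Longrightarrow> norm (g t) < e / (norm y + 1)"
    by (auto simp: eventually_at_top_linorder)
  \<comment> \<open>\<open>cut \<bar>t\<bar>\<close> is 1 for \<open>\<bar>t\<bar> \<le> N\<close>,
    0 for \<open>\<bar>t\<bar> \<ge> N + 1\<close> and linear in between. Multiplying by it
    preserves the Lipschitz property and changes \<open>g\<close> on the half-line only where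
    \<open>g\<close> is already small.\<close>
  define cut where "cut t = max 0 (min 1 (N + 1 - t))" for t :: real
  have cut: "0 \<le> cut t" "cut t \<le> 1" for t by (auto simp: cut_def)
  have cutlip: "\<bar>cut s - cut t\<bar> \<le> \<bar>s - t\<bar>" for s t by (auto simp: cut_def)
  let ?k = "\<lambda>t. of_real (cut \<bar>t\<bar>) * g t"
  let ?\<psi> = "\<lambda>t. ?k t *\<^sub>C y"
  have klip: "norm (?k s - ?k t) \<le> (L + B) * \<bar>s - t\<bar>" for s t
  proof -
    have "?k s - ?k t = of_real (cut \<bar>s\<bar>) * (g s - g t) + of_real (cut \<bar>s\<bar> - cut \<bar>t\<bar>) * g t"
      by (simp add: algebra_simps)
    also have "norm \<dots> \<le> cut \<bar>s\<bar> * norm (g s - g t) + \<bar>cut \<bar>s\<bar> - cut \<bar>t\<bar>\<bar> * norm (g t)"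
      using norm_triangle_ineq[of "of_real (cut \<bar>s\<bar>) * (g s - g t)" "of_real (cut \<bar>s\<bar> - cut \<bar>t\<bar>) * g t"] cut
      by (simp only: norm_mult norm_of_real abs_of_nonneg)
    also have "\<dots> \<le> 1 * (L * \<bar>s - t\<bar>) + \<bar>s - t\<bar> * B"
    proof (intro add_mono mult_mono lip bnd cut)
      show "\<bar>cut \<bar>s\<bar> - cut \<bar>t\<bar>\<bar> \<le> \<bar>s - t\<bar>" using cutlip[of "\<bar>s\<bar>" "\<bar>t\<bar>"] by linarith
    qed (use B in auto)
    finally show ?thesis by (simp add: algebra_simps)
  qed
  have BUC: "?\<psi> \<in> BUC UNIV"
    unfolding BUC_def
  proof (intro CollectI conjI)
    have "norm (?\<psi> t) \<le> 1 * B * norm y" for t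
      unfolding norm_scaleC norm_mult
      by (intro mult_mono bnd) (use cut B in auto)
    then show "bounded (range ?\<psi>)" by (auto simp: bounded_iff)
    show "uniformly_continuous_on UNIV ?\<psi>"
      unfolding uniformly_continuous_on_def
    proof (intro allI impI)
      fix r :: real assume r: "r > 0"
      let ?K = "(L + B) * norm y + 1"
      have K: "?K > 0" using L B by (intro add_nonneg_pos) auto
      show "\<exists>d>0. \<forall>x\<in>UNIV. \<forall>x'\<in>UNIV. dist x' x < d \<longrightarrow> dist (?\<psi> x') (?\<psi> x) < r"
      proof (intro exI[of _ "r / ?K"] conjI ballI impI)
        show "r / ?K > 0" using r K by simp
        fix x x' :: real assume d: "dist x' x < r / ?K"
        have "dist (?\<psi> x') (?\<psi> x) = norm (?k x' - ?k x) * norm y"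
          by (simp only: dist_norm norm_scaleC flip: scaleC.diff_left)
        also have "\<dots> \<le> (L + B) * \<bar>x' - x\<bar> * norm y" by (intro mult_right_mono klip) auto
        also have "\<dots> \<le> ?K * \<bar>x' - x\<bar>" by (simp add: algebra_simps)
        also have "\<dots> < r" using d K by (simp add: dist_real_def pos_less_divide_eq mult.commute[of _ ?K])
        finally show "dist (?\<psi> x') (?\<psi> x) < r" .
      qed
    qed
  qed (simp add: extensional_def)
  \<comment> \<open>For \<open>t \<ge> 0\<close> one has \<open>t + a \<ge> N + 1\<close>, so the
    shifted function vanishes on the half-line and belongs to \<open>F\<close> as the zero
    function.\<close>
  define a where "a = \<bar>N\<bar> + 1"
  have "restrict (\<lambda>t. ?\<psi> (t + a)) J' = restrict (\<lambda>t. 0) J'"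
    by (auto simp: J0 cut_def a_def scaleC.zero_left restrict_def)
  then have "restrict (\<lambda>t. ?\<psi> (t + a)) J' \<in> F" using zero_mem by simp
  moreover have "(\<lambda>t. ?\<psi> (t + a)) \<in> BUC UNIV"
  proof -
    have uc: "uniformly_continuous_on UNIV ?\<psi>"
      using BUC by (simp only: BUC_def mem_Collect_eq)
    have "uniformly_continuous_on UNIV (\<lambda>t. ?\<psi> (t + a))"
      unfolding uniformly_continuous_on_def
    proof (intro allI impI)
      fix r :: real assume "r > 0"
      then obtain d where "d > 0" "\<And>x x'. dist x' x < d \<Longrightarrow> dist (?\<psi> x') (?\<psi> x) < r"
        using uc unfolding uniformly_continuous_on_def by (metis UNIV_I)
      then show "\<exists>d>0. \<forall>x\<in>UNIV. \<forall>x'\<in>UNIV. dist x' x < d \<longrightarrow> dist (?\<psi> (x' + a)) (?\<psi> (x + a)) < r"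
        by (intro exI[of _ d]) (simp add: dist_add_cancel2)
    qed
    moreover have "bounded (range (\<lambda>t. ?\<psi> (t + a)))"
      using BUC by (auto simp: BUC_def intro: bounded_subset)
    ultimately show ?thesis by (simp add: BUC_def extensional_def)
  qed
  \<comment> \<open>Invariance holds for shifts of either sign: shifting back by \<open>- a\<close>
    brings the values from the negative axis into the half-line without leaving
    \<open>F\<close>.\<close>
  ultimately have "restrict (\<lambda>t. ?\<psi> (t + - a + a)) J' \<in> F"
    by (intro translate_mem[of "\<lambda>t. ?\<psi> (t + a)" "- a"])
  then have "restrict ?\<psi> J' \<in> F" by simp
  moreover have "\<forall>t\<in>J'. norm (g t *\<^sub>C y - ?\<psi> t) < e"
  proof
    fix t assume t: "t \<in> J'"
    show "norm (g t *\<^sub>C y - ?\<psi> t) < e"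
    proof (cases "t \<ge> N")
      case True
      have "g t *\<^sub>C y - ?\<psi> t = (of_real (1 - cut \<bar>t\<bar>) * g t) *\<^sub>C y"
        by (simp add: algebra_simps scaleC.diff_left)
      also have "norm \<dots> = (1 - cut \<bar>t\<bar>) * norm (g t) * norm y"
        using cut[of "\<bar>t\<bar>"] by (simp only: norm_scaleC norm_mult norm_of_real)
      also have "\<dots> \<le> 1 * norm (g t) * (norm y + 1)"
        using cut[of "\<bar>t\<bar>"] by (intro mult_mono) auto
      also have "\<dots> < e"
        using N[OF True] by (simp add: pos_less_divide_eq add_nonneg_pos)
      finally show ?thesis .
    next
      case False
      then have "cut \<bar>t\<bar> = 1" using t J0 by (simp add: cut_def)
      then show ?thesis using e by simp
    qed
  qed
  ultimately show "\<exists>h. restrict h J' \<in> F \<and> (\<forall>t\<in>J'. norm (g t *\<^sub>C y - h t) < e)" by blast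
qed

end

section \<open>The Neumann series\<close>

lemma band_kernel_tendsto_0:
  assumes a: "a > 0"
  shows "(band_kernel l a n \<longlongrightarrow> 0) at_top" "(band_kernel l a n \<longlongrightarrow> 0) at_bot"
proof -
  define C where "C = (2 * a) ^ n * (1 + 4 / a\<^sup>2)"
  have C: "C \<ge> 0" using a by (simp add: C_def)
  have *: "(k \<longlongrightarrow> 0) at_top" if k: "\<And>t. norm (k t) \<le> C * (1 / (1 + t\<^sup>2))" for k :: "real \<Rightarrow> complex"
  proof (rule tendsto_norm_zero_cancel, rule tendsto_sandwich[OF _ _ tendsto_const])
    show "\<forall>\<^sub>F t in at_top. 0 \<le> norm (k t)" by simp
    show "\<forall>\<^sub>F t in at_top. norm (k t) \<le> C * inverse t"
      using eventually_gt_at_top[of 1]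
    proof eventually_elim
      fix t :: real assume t: "1 < t"
      then have "1 * t \<le> t * t" by (intro mult_right_mono) auto
      then have "t \<le> 1 + t\<^sup>2" by (simp add: power2_eq_square)
      then have "1 / (1 + t\<^sup>2) \<le> inverse t" using t by (simp add: inverse_eq_divide frac_le)
      then have "C * (1 / (1 + t\<^sup>2)) \<le> C * inverse t" using C by (rule mult_left_mono)
      with k[of t] show "norm (k t) \<le> C * inverse t" by (rule order_trans)
    qed
    show "((\<lambda>t. C * inverse t) \<longlongrightarrow> 0) at_top"
      by (rule tendsto_mult_right_zero[OF tendsto_inverse_0_at_top[OF filterlim_ident]])
  qed
  show "(band_kernel l a n \<longlongrightarrow> 0) at_top"
    using norm_band_kernel_le[OF a] by (intro *) (simp add: C_def)
  show "(band_kernel l a n \<longlongrightarrow> 0) at_bot"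
    unfolding filterlim_at_bot_mirror
    using norm_band_kernel_le[OF a, of l n "- t" for t] by (intro *) (simp add: C_def)
qed

lemma sconv_band_kernel_has_vector_derivative:
  assumes f: "integrable lborel f" and a: "a > 0"
  shows "(sconv f (band_kernel l a n) has_vector_derivative
    sconv f (band_kernel l a (Suc n)) t + \<i> * of_real l * sconv f (band_kernel l a n) t) (at t)"
proof -
  let ?k = "band_kernel l a" and ?z = "\<i> * complex_of_real l"
  let ?k' = "\<lambda>t. ?k (Suc n) t + ?z * ?k n t"
  \<comment> \<open>The second derivative of the kernel; its uniform bound is the constant of the
    Taylor estimate.\<close>
  let ?k'' = "\<lambda>t. (?k (Suc (Suc n)) t + ?z * ?k (Suc n) t) + ?z * (?k (Suc n) t + ?z * ?k n t)"
  define C where "C m = (2 * a) ^ m * (1 + 4 / a\<^sup>2)" for m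
  have k: "norm (?k m t) \<le> C m" for m t
    unfolding C_def by (rule norm_band_kernel_le'[OF a])
  have k1: "norm (?k (Suc m) t + ?z * ?k m t) \<le> C (Suc m) + \<bar>l\<bar> * C m" for m t
    by (intro norm_triangle_le add_mono k) (simp add: norm_mult k mult_left_mono)
  have k2: "norm (?k'' t) \<le> (C (Suc (Suc n)) + \<bar>l\<bar> * C (Suc n)) + \<bar>l\<bar> * (C (Suc n) + \<bar>l\<bar> * C n)" for t
    by (intro norm_triangle_le[of "_ + _"] add_mono k1)
      (simp only: norm_mult norm_ii norm_of_real mult_1 mult_left_mono[OF k1 abs_ge_zero])
  have d: "(?k' has_vector_derivative ?k'' t) (at t)" for t
    by (intro has_vector_derivative_add has_vector_derivative_mult_right band_kernel_has_vector_derivative)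
  have "(sconv f (?k n) has_vector_derivative sconv f ?k' t) (at t)"
  proof (rule sconv_has_vector_derivative[OF f borel_band_kernel k _ k1])
    show "?k' \<in> borel_measurable borel"
      using borel_band_kernel[of l a "Suc n"] borel_band_kernel[of l a n] by measurable
    show "norm (?k n (t + h) - ?k n t - h *\<^sub>R ?k' t) \<le>
      ((C (Suc (Suc n)) + \<bar>l\<bar> * C (Suc n)) + \<bar>l\<bar> * (C (Suc n) + \<bar>l\<bar> * C n)) * h\<^sup>2" for t h
    proof (rule vector_derivative_taylor[OF band_kernel_has_vector_derivative])
      show "norm (?k' x - ?k' y) \<le>
        ((C (Suc (Suc n)) + \<bar>l\<bar> * C (Suc n)) + \<bar>l\<bar> * (C (Suc n) + \<bar>l\<bar> * C n)) * \<bar>x - y\<bar>" for x y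
        by (rule vector_derivative_bounded_lipschitz[OF d k2])
      show "0 \<le> (C (Suc (Suc n)) + \<bar>l\<bar> * C (Suc n)) + \<bar>l\<bar> * (C (Suc n) + \<bar>l\<bar> * C n)"
        using a by (simp add: C_def)
    qed
  qed
  moreover have "sconv f ?k' t = sconv f (?k (Suc n)) t + ?z * sconv f (?k n) t"
    using sconv_bounded_integrable[OF f borel_band_kernel k, where ?t = t]
    by (simp add: sconv_commute distrib_left mult.left_commute[of _ ?z])
  ultimately show ?thesis by simp
qed

text \<open>Because \<open>?e (t - s) * ?e s = ?e t\<close>, modulating a convolution modulates both
  factors, and the integral of a convolution is the product of the integrals.\<close>

lemma fourier_sconv:
  assumes f: "integrable lborel f" and k: "integrable lborel k"
  shows "fourier (sconv f k) l =
    (\<integral>t. exp (- \<i> * of_real (l * t)) * f t \<partial>lborel) * (\<integral>t. exp (- \<i> * of_real (l * t)) * k t \<partial>lborel)"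
    and "fourier f l = (\<integral>t. exp (- \<i> * of_real (l * t)) * f t \<partial>lborel)"
proof -
  let ?e = "\<lambda>t. exp (- \<i> * complex_of_real (l * t))"
  have int: "integrable lborel (\<lambda>t. ?e t * g t)" if g: "integrable lborel g" for g
  proof (rule Bochner_Integration.integrable_bound[OF g])
    have [measurable]: "g \<in> borel_measurable borel" using g by (rule borel_integrable_measurable)
    show "(\<lambda>t. ?e t * g t) \<in> borel_measurable lborel" by measurable
    show "AE t in lborel. norm (?e t * g t) \<le> norm (g t)" by (intro AE_I2) (simp add: norm_mult)
  qed
  have four: "fourier g l = (\<integral>t. ?e t * g t \<partial>lborel)" if "integrable lborel g" for g
    unfolding fourier_def by (rule integral_lebesgue_lborel[OF int[OF that]])
  show "fourier f l = (\<integral>t. ?e t * f t \<partial>lborel)" by (rule four[OF f])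
  have e: "?e (t - s) * ?e s = ?e t" for s t
    by (simp add: exp_add[symmetric] algebra_simps)
  have "?e t * sconv f k t = sconv (\<lambda>t. ?e t * f t) (\<lambda>t. ?e t * k t) t" for t
  proof -
    have "?e t * (f (t - s) * k s) = ?e (t - s) * f (t - s) * (?e s * k s)" for s
      unfolding e[of t s, symmetric] by (simp only: ac_simps)
    then have "(\<integral>s. ?e t * (f (t - s) * k s) \<partial>lborel) = sconv (\<lambda>t. ?e t * f t) (\<lambda>t. ?e t * k t) t"
      unfolding sconv_def by (rule Bochner_Integration.integral_cong[OF refl])
    then show ?thesis by (simp only: sconv_def integral_mult_right_zero)
  qed
  then have "fourier (sconv f k) l = (\<integral>t. sconv (\<lambda>t. ?e t * f t) (\<lambda>t. ?e t * k t) t \<partial>lborel)"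
    using four[OF sconv_integrable[OF f k]] by simp
  also have "\<dots> = (\<integral>t. ?e t * f t \<partial>lborel) * (\<integral>t. ?e t * k t \<partial>lborel)"
    by (rule integral_sconv[OF int[OF f] int[OF k]])
  finally show "fourier (sconv f k) l = (\<integral>t. ?e t * f t \<partial>lborel) * (\<integral>t. ?e t * k t \<partial>lborel)" .
qed

context invariant_class
begin

text \<open>One step of the Neumann series. \<open>T\<close> collects \<open>R\<close> applied to
  the convolution of \<open>\<Phi>\<close> and the boundary term: the first is in \<open>F\<close>
  by the ideal property and \<open>F_op\<close>, the second because it decays on the half-line. The
  order of the kernel rises by one.\<close>

lemma resolvent_step:
  fixes U \<Phi> :: "real \<Rightarrow> 'a"
  assumes R: "bounded_clinear R"
    and F_op: "\<And>\<psi>. \<psi> \<in> F \<Longrightarrow> (\<lambda>t\<in>J'. R (\<psi> t)) \<in> F"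
    and U: "bounded_sm Mu U" "\<And>t. t \<notin> J' \<Longrightarrow> U t = 0"
    and P: "bounded_sm M \<Phi>" "\<And>t. t \<notin> J' \<Longrightarrow> \<Phi> t = 0"
    and ode: "\<And>c d. c \<le> d \<Longrightarrow> c \<in> J' \<Longrightarrow>
      ((\<lambda>t. (\<i> * of_real l) *\<^sub>C R (U t) + ((-1) *\<^sub>C U t + R (\<Phi> t))) has_integral (R (U d) - R (U c))) {c..d}"
    and f: "f \<in> conv_ideal \<Phi>" and a: "a > 0"
  shows "\<exists>T. restrict T J' \<in> F \<and> (\<forall>t\<in>J'. convolution U (sconv f (band_kernel l a n)) t =
    T t - R (convolution U (sconv f (band_kernel l a (Suc n))) t))"
proof -
  let ?z = "\<i> * complex_of_real l"
  let ?g = "\<lambda>n. sconv f (band_kernel l a n)"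
  let ?g' = "\<lambda>t. ?g (Suc n) t + ?z * ?g n t"
  define Ps where "Ps t = ?z *\<^sub>C R (U t) + ((-1) *\<^sub>C U t + R (\<Phi> t))" for t
  have R1: "bounded_linear R" and R2: "\<And>c x. R (c *\<^sub>C x) = c *\<^sub>C R x"
    using R by (auto simp: bounded_clinear_def)
  interpret R: bounded_linear R by (rule R1)
  have fint: "integrable lborel f" using f by (simp add: conv_ideal_def)
  note gint = sconv_integrable[OF fint integrable_band_kernel(1)[OF a]]
  note gint' = integrable_lebesgueI[OF gint]
  have RU: "bounded_sm (onorm R * Mu) (\<lambda>t. R (U t))" by (rule bounded_sm_bounded_linear[OF R1 U(1)])
  have RP: "bounded_sm (onorm R * M) (\<lambda>t. R (\<Phi> t))" by (rule bounded_sm_bounded_linear[OF R1 P(1)])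
  note zRU = bounded_sm_cmult[OF RU, of ?z] and mU = bounded_sm_cmult[OF U(1), of "-1"]
  have Ps: "bounded_sm (norm ?z * (onorm R * Mu) + (norm (-1 :: complex) * Mu + onorm R * M)) Ps"
    unfolding Ps_def[abs_def] by (intro bounded_sm_add zRU mU RP)
  note d = sconv_band_kernel_has_vector_derivative[OF fint a]
  have cont: "continuous_on UNIV (?g m)" for m
    using has_vector_derivative_continuous[OF d] by (intro continuous_at_imp_continuous_on) blast
  have gb: "norm (?g m t) \<le> L1_norm f * ((2 * a) ^ m * (1 + 4 / a\<^sup>2))" for m t
    by (rule norm_sconv_le[OF fint borel_band_kernel norm_band_kernel_le'[OF a]])
  have g'b: "norm (?g' t) \<le> L1_norm f * ((2 * a) ^ Suc n * (1 + 4 / a\<^sup>2)) +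
      \<bar>l\<bar> * (L1_norm f * ((2 * a) ^ n * (1 + 4 / a\<^sup>2)))" for t
    by (intro norm_triangle_le add_mono gb)
      (simp only: norm_mult norm_ii norm_of_real mult_1 mult_left_mono[OF gb abs_ge_zero])
  have lim: "(?g n \<longlongrightarrow> 0) at_top" "(?g n \<longlongrightarrow> 0) at_bot"
    by (rule sconv_tendsto_0[OF fint borel_band_kernel norm_band_kernel_le'[OF a] band_kernel_tendsto_0(1)[OF a]]
        sconv_tendsto_0_at_bot[OF fint borel_band_kernel norm_band_kernel_le'[OF a] band_kernel_tendsto_0(2)[OF a]])+
  let ?bd = "\<lambda>t. if J' = UNIV then 0 else ?g n t *\<^sub>C R (U 0)"
  let ?T = "\<lambda>t. R (convolution \<Phi> (?g n) t) + ?bd t"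
  have "convolution U (?g n) t = ?T t - R (convolution U (?g (Suc n)) t)" if t: "t \<in> J'" for t
  proof -
    have "convolution (\<lambda>t. R (U t)) ?g' t = convolution Ps (?g n) t + ?bd t"
    proof (rule convolution_by_parts[OF J' RU Ps])
      show "R (U t) = 0" if "t \<notin> J'" for t using U(2)[OF that] by (simp add: R.zero)
      show "Ps t = 0" if "t \<notin> J'" for t
        using U(2)[OF that] P(2)[OF that] by (simp add: Ps_def R.zero scaleC.zero_right)
      show "(Ps has_integral (R (U d) - R (U c))) {c..d}" if "c \<le> d" "c \<in> J'" for c d
        unfolding Ps_def[abs_def] by (rule ode[OF that])
      show "continuous_on UNIV ?g'" by (intro continuous_intros cont)
      show "integrable lebesgue ?g'"
        by (intro integrable_lebesgueI Bochner_Integration.integrable_add integrable_mult_right gint)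
    qed (use d g'b gint' lim t in auto)
    \<comment> \<open>The derivative of \<open>?g n\<close> is
      \<open>?g (Suc n) + ?z * ?g n\<close>. Its second term produces the same multiple of
      \<open>R (convolution U (?g n) t)\<close> as the first term of \<open>Ps\<close>, and the two
      cancel.\<close>
    moreover have "convolution (\<lambda>t. R (U t)) ?g' t =
        R (convolution U (?g (Suc n)) t) + ?z *\<^sub>C R (convolution U (?g n) t)"
      using convolution_add[OF gint' _ RU, of "\<lambda>t. ?z * ?g n t"] gint'
      by (simp add: convolution_cmult[OF gint' RU] convolution_bounded_clinear[OF R gint' U(1)])
    moreover have "convolution Ps (?g n) t = ?z *\<^sub>C R (convolution U (?g n) t) +
        ((-1) *\<^sub>C convolution U (?g n) t + R (convolution \<Phi> (?g n) t))"
      unfolding Ps_def[abs_def]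
      by (simp only: convolution_fun_add[OF gint' zRU bounded_sm_add[OF mU RP]]
          convolution_fun_add[OF gint' mU RP] convolution_fun_cmult[OF gint' RU]
          convolution_fun_cmult[OF gint' U(1)] convolution_bounded_clinear[OF R gint' U(1)]
          convolution_bounded_clinear[OF R gint' P(1)])
    ultimately show ?thesis by (simp add: scaleC.minus_left algebra_simps)
  qed
  moreover have "restrict ?T J' \<in> F"
  proof (rule add_mem)
    have "restrict (convolution \<Phi> (?g n)) J' \<in> F"
      using conv_ideal_sconv[OF P(1) f integrable_band_kernel(1)[OF a]] by (simp add: conv_ideal_def)
    from F_op[OF this] show "restrict (\<lambda>t. R (convolution \<Phi> (?g n) t)) J' \<in> F"
      by (simp add: restrict_def cong: if_cong)
    show "restrict ?bd J' \<in> F"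
    proof (cases "J' = UNIV")
      case True
      then show ?thesis using zero_mem by simp
    next
      case False
      then have "J' = {0..}" using J' by auto
      from vanishing_at_infinity_mem[OF this vector_derivative_bounded_lipschitz[OF d g'b] gb lim(1)] False
      show ?thesis by simp
    qed
  qed
  ultimately show ?thesis by blast
qed

text \<open>After \<open>N\<close> steps the remainder is, up to sign, \<open>R\<close> applied
  \<open>N\<close> times to the convolution with the kernel of order \<open>n + N\<close>. The
  induction varies \<open>n\<close> because each step raises the order.\<close>

lemma neumann_approx:
  fixes U \<Phi> :: "real \<Rightarrow> 'a"
  assumes R: "bounded_clinear R"
    and F_op: "\<And>\<psi>. \<psi> \<in> F \<Longrightarrow> (\<lambda>t\<in>J'. R (\<psi> t)) \<in> F"
    and U: "bounded_sm Mu U" "\<And>t. t \<notin> J' \<Longrightarrow> U t = 0"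
    and P: "bounded_sm M \<Phi>" "\<And>t. t \<notin> J' \<Longrightarrow> \<Phi> t = 0"
    and ode: "\<And>c d. c \<le> d \<Longrightarrow> c \<in> J' \<Longrightarrow>
      ((\<lambda>t. (\<i> * of_real l) *\<^sub>C R (U t) + ((-1) *\<^sub>C U t + R (\<Phi> t))) has_integral (R (U d) - R (U c))) {c..d}"
    and f: "f \<in> conv_ideal \<Phi>" and a: "a > 0"
  shows "\<exists>T. restrict T J' \<in> F \<and> (\<forall>t\<in>J'. norm (convolution U (sconv f (band_kernel l a n)) t - T t) \<le>
    onorm R ^ N * (Mu * L1_norm (sconv f (band_kernel l a (n + N)))))"
proof (induction N arbitrary: n)
  case 0
  have fint: "integrable lborel f" using f by (simp add: conv_ideal_def)
  show ?case
    using norm_convolution_le'[OF sconv_integrable[OF fint integrable_band_kernel(1)[OF a]] U(1)]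
    by (intro exI[of _ "\<lambda>t. 0"] conjI zero_mem) simp
next
  case (Suc N)
  have R1: "bounded_linear R" using R by (auto simp: bounded_clinear_def)
  interpret R: bounded_linear R by (rule R1)
  let ?c = "\<lambda>n. convolution U (sconv f (band_kernel l a n))"
  obtain T where T: "restrict T J' \<in> F" "\<And>t. t \<in> J' \<Longrightarrow> ?c n t = T t - R (?c (Suc n) t)"
    using resolvent_step[OF R F_op U P ode f a, of n] by blast
  obtain S where S: "restrict S J' \<in> F" "\<And>t. t \<in> J' \<Longrightarrow> norm (?c (Suc n) t - S t) \<le>
      onorm R ^ N * (Mu * L1_norm (sconv f (band_kernel l a (Suc n + N))))"
    using Suc[of "Suc n"] by blast
  have "restrict (\<lambda>t. R (S t)) J' \<in> F"
    using F_op[OF S(1)] by (simp add: restrict_def cong: if_cong)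
  from add_mem[OF T(1) cmult_mem[OF this, of "-1"]]
  have "restrict (\<lambda>t. T t - R (S t)) J' \<in> F" by (simp add: scaleC.minus_left)
  moreover have "norm (?c n t - (T t - R (S t))) \<le>
      onorm R ^ Suc N * (Mu * L1_norm (sconv f (band_kernel l a (n + Suc N))))" if t: "t \<in> J'" for t
  proof -
    have "norm (?c n t - (T t - R (S t))) = norm (R (?c (Suc n) t - S t))"
      by (simp add: T(2)[OF t] R.diff norm_minus_commute)
    also have "\<dots> \<le> onorm R * norm (?c (Suc n) t - S t)" by (rule onorm[OF R1])
    also have "\<dots> \<le> onorm R * (onorm R ^ N * (Mu * L1_norm (sconv f (band_kernel l a (Suc n + N)))))"
      by (rule mult_left_mono[OF S(2)[OF t] onorm_pos_le[OF R1]])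
    finally show ?thesis by simp
  qed
  ultimately show ?case by blast
qed

text \<open>The witness is \<open>f\<close> convolved with the kernel of order 0. Its Fourier
  transform at \<open>l\<close> is a product of two nonzero numbers, and the Neumann remainders tend
  to 0 uniformly on \<open>J'\<close>.\<close>

lemma conv_ideal_resolvent:
  fixes U \<Phi> :: "real \<Rightarrow> 'a"
  assumes R: "bounded_clinear R"
    and F_op: "\<And>\<psi>. \<psi> \<in> F \<Longrightarrow> (\<lambda>t\<in>J'. R (\<psi> t)) \<in> F"
    and U: "bounded_sm Mu U" "\<And>t. t \<notin> J' \<Longrightarrow> U t = 0"
    and P: "bounded_sm M \<Phi>" "\<And>t. t \<notin> J' \<Longrightarrow> \<Phi> t = 0"
    and ode: "\<And>c d. c \<le> d \<Longrightarrow> c \<in> J' \<Longrightarrow>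
      ((\<lambda>t. (\<i> * of_real l) *\<^sub>C R (U t) + ((-1) *\<^sub>C U t + R (\<Phi> t))) has_integral (R (U d) - R (U c))) {c..d}"
    and f: "f \<in> conv_ideal \<Phi>" "fourier f l \<noteq> 0"
  shows "\<exists>g \<in> conv_ideal U. fourier g l \<noteq> 0"
proof -
  have K: "onorm R \<ge> 0" using R by (auto simp: bounded_clinear_def intro: onorm_pos_le)
  \<comment> \<open>The bandwidth is chosen so that \<open>onorm R * (2 * a) \<le> 1 / 2\<close>;
    adding 1 covers \<open>onorm R = 0\<close>.\<close>
  define a where "a = 1 / (4 * (onorm R + 1))"
  have a: "a > 0" using K by (simp add: a_def)
  have aK: "onorm R * (2 * a) \<le> 1 / 2" using K by (simp add: a_def field_simps)
  have Mu: "Mu \<ge> 0" by (rule bounded_smD(3)[OF U(1)])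
  let ?g = "\<lambda>n. sconv f (band_kernel l a n)"
  \<comment> \<open>This constant does not depend on \<open>n\<close>, so only powers of
    \<open>2 * a\<close> compete with powers of \<open>onorm R\<close>.\<close>
  define C where "C = L1_norm f * ((1 + 4 / a\<^sup>2) * (\<integral>t. 1 / (1 + t\<^sup>2) \<partial>lborel))"
  have fint: "integrable lborel f" using f by (simp add: conv_ideal_def)
  have gL1: "L1_norm (?g n) \<le> (2 * a) ^ n * C" for n
  proof -
    have "L1_norm (?g n) \<le> L1_norm f * L1_norm (band_kernel l a n)"
      by (rule L1_norm_sconv_le[OF fint integrable_band_kernel(1)[OF a]])
    also have "\<dots> \<le> L1_norm f * ((2 * a) ^ n * (1 + 4 / a\<^sup>2) * (\<integral>t. 1 / (1 + t\<^sup>2) \<partial>lborel))"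
      by (intro mult_left_mono integrable_band_kernel(2)[OF a]) simp
    finally show ?thesis by (simp only: C_def ac_simps)
  qed
  have C: "C \<ge> 0" unfolding C_def by (intro mult_nonneg_nonneg add_nonneg_nonneg) auto
  have "restrict (convolution U (?g 0)) J' \<in> F"
  proof (rule approx_mem)
    fix e :: real assume e: "e > 0"
    have "(\<lambda>N. (1 / 2) ^ N * (Mu * C)) \<longlonglongrightarrow> 0 * (Mu * C)"
      by (intro tendsto_intros LIMSEQ_power_zero) simp
    then have "\<forall>\<^sub>F N in sequentially. (1 / 2) ^ N * (Mu * C) < e"
      using order_tendstoD(2) e by fastforce
    then obtain N :: nat where N: "(1 / 2) ^ N * (Mu * C) < e" by (auto simp: eventually_sequentially)
    obtain T where T: "restrict T J' \<in> F"
      "\<And>t. t \<in> J' \<Longrightarrow> norm (convolution U (?g 0) t - T t) \<le> onorm R ^ N * (Mu * L1_norm (?g N))"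
      using neumann_approx[OF R F_op U P ode f(1) a, of 0 N] by auto
    have "onorm R ^ N * (Mu * L1_norm (?g N)) \<le> onorm R ^ N * (Mu * ((2 * a) ^ N * C))"
      by (intro mult_left_mono gL1 Mu zero_le_power K)
    also have "\<dots> = (onorm R * (2 * a)) ^ N * (Mu * C)" by (simp only: power_mult_distrib ac_simps)
    also have "\<dots> \<le> (1 / 2) ^ N * (Mu * C)"
      by (intro mult_right_mono power_mono aK mult_nonneg_nonneg Mu C K) (use a in auto)
    also note N
    finally show "\<exists>T. restrict T J' \<in> F \<and> (\<forall>t\<in>J'. norm (convolution U (?g 0) t - T t) < e)"
      using T by (intro exI[of _ T]) (auto intro: le_less_trans)
  qed
  then have "?g 0 \<in> conv_ideal U"
    by (simp add: conv_ideal_def sconv_integrable[OF fint integrable_band_kernel(1)[OF a]])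
  moreover have "fourier (?g 0) l \<noteq> 0"
    unfolding fourier_sconv(1)[OF fint integrable_band_kernel(1)[OF a]]
    using f(2) fourier_sconv(2)[OF fint fint, of l] band_kernel_integral_nonzero[OF a, of l] by simp
  ultimately show ?thesis by blast
qed

end

section \<open>The reduced spectrum\<close>

lemma integrable_lebesgue_borel_representative:
  fixes f :: "real \<Rightarrow> complex"
  assumes f: "integrable lebesgue f"
  obtains g where "integrable lborel g" "AE t in lebesgue. f t = g t"
proof -
  have m: "f \<in> borel_measurable (completion lborel)" using f by (rule borel_measurable_integrable)
  have re: "(\<lambda>t. Re (f t)) \<in> borel_measurable (completion lborel)"
    and im: "(\<lambda>t. Im (f t)) \<in> borel_measurable (completion lborel)" using m by measurable
  obtain p where p: "p \<in> borel_measurable lborel" "AE t in lborel. Re (f t) = p t"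
    using completion_ex_borel_measurable_real[OF re] by blast
  obtain q where q: "q \<in> borel_measurable lborel" "AE t in lborel. Im (f t) = q t"
    using completion_ex_borel_measurable_real[OF im] by blast
  let ?g = "\<lambda>t. Complex (p t) (q t)"
  have gm: "?g \<in> borel_measurable lborel" 
    using p(1) q(1) by (auto simp: borel_measurable_complex_iff)
  have "AE t in lborel. f t = ?g t" using p(2) q(2) by eventually_elim (simp add: complex_eq_iff)
  then have ae: "AE t in lebesgue. f t = ?g t" by (rule AE_completion)
  have "integrable lebesgue ?g"
    using f by (rule integrable_cong_AE_imp) (use gm ae in \<open>auto simp: measurable_completion eq_commute\<close>)
  then have "integrable lborel ?g" using integrable_completion[OF gm] by simp
  then show ?thesis using ae by (rule that)
qed

lemma convolution_cong_AE:
  fixes \<Phi> :: "real \<Rightarrow> 'a::complex_banach"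
  assumes f: "integrable lebesgue f" and g: "integrable lebesgue g" and P: "bounded_sm M \<Phi>"
    and ae: "AE t in lebesgue. f t = g t"
  shows "convolution \<Phi> f = convolution \<Phi> g"
proof
  fix t
  have "norm (convolution \<Phi> f t - convolution \<Phi> g t) \<le> M * (\<integral>s. norm (f s - g s) \<partial>lebesgue)"
    using norm_convolution_le[OF Bochner_Integration.integrable_diff[OF f g] P, of t]
    by (simp add: convolution_diff[OF f g P])
  also have "(\<integral>s. norm (f s - g s) \<partial>lebesgue) = (\<integral>s. 0 \<partial>(lebesgue :: real measure))"
    using ae f g by (intro integral_cong_AE) (auto dest: borel_measurable_integrable)
  finally show "convolution \<Phi> f t = convolution \<Phi> g t" by simp
qed

text \<open>Both \<open>fourier\<close> and \<open>convolution\<close> depend only on the kernel up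
  to null sets, so a Lebesgue integrable kernel may be replaced by a Borel representative.\<close>

lemma (in invariant_class) not_reduced_spectrum_iff:
  assumes P: "bounded_sm M (\<lambda>t. if t \<in> J' then \<phi> t else 0)"
  shows "l \<notin> reduced_spectrum J' F \<phi> \<longleftrightarrow>
    (\<exists>f \<in> conv_ideal (\<lambda>t. if t \<in> J' then \<phi> t else 0). fourier f l \<noteq> 0)"
proof
  let ?P = "\<lambda>t. if t \<in> J' then \<phi> t else 0"
  assume "l \<notin> reduced_spectrum J' F \<phi>"
  then obtain f where f: "integrable lebesgue f" "restrict (convolution ?P f) J' \<in> F" "fourier f l \<noteq> 0"
    by (auto simp: reduced_spectrum_def Let_def)
  obtain g where g: "integrable lborel g" "AE t in lebesgue. f t = g t"
    using integrable_lebesgue_borel_representative[OF f(1)] .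
  note g' = integrable_lebesgueI[OF g(1)]
  have "fourier f l = fourier g l"
    unfolding fourier_def
  proof (rule integral_cong_AE)
    have [measurable]: "f \<in> borel_measurable lebesgue" "g \<in> borel_measurable lebesgue"
      using f(1) g' by (auto dest: borel_measurable_integrable)
    have [measurable]: "(\<lambda>t. exp (- \<i> * complex_of_real (l * t))) \<in> borel_measurable lebesgue"
      by (intro measurable_completion) measurable
    show "(\<lambda>t. exp (- \<i> * complex_of_real (l * t)) * f t) \<in> borel_measurable lebesgue"
      "(\<lambda>t. exp (- \<i> * complex_of_real (l * t)) * g t) \<in> borel_measurable lebesgue" by measurable
    show "AE t in lebesgue. exp (- \<i> * complex_of_real (l * t)) * f t = exp (- \<i> * complex_of_real (l * t)) * g t"
      using g(2) by eventually_elim simp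
  qed
  moreover have "convolution ?P f = convolution ?P g" by (rule convolution_cong_AE[OF f(1) g' P g(2)])
  ultimately have "g \<in> conv_ideal ?P \<and> fourier g l \<noteq> 0"
    using f g(1) by (simp add: conv_ideal_def)
  then show "\<exists>f \<in> conv_ideal ?P. fourier f l \<noteq> 0" by blast
next
  assume "\<exists>f \<in> conv_ideal (\<lambda>t. if t \<in> J' then \<phi> t else 0). fourier f l \<noteq> 0"
  then show "l \<notin> reduced_spectrum J' F \<phi>"
    using integrable_lebesgueI by (auto simp: reduced_spectrum_def Let_def conv_ideal_def)
qed

lemma integral_exp_short_interval:
  obtains h :: real where "h > 0" "(\<integral>t. exp (- \<i> * of_real (l * t)) * indicator {-h..0} t \<partial>lborel) \<noteq> 0"
proof
  \<comment> \<open>With this \<open>h\<close>, \<open>\<bar>l * t\<bar> \<le> 1 < pi / 2\<close> on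
    the interval, so the real part of the exponential is at least \<open>cos 1 > 0\<close>.\<close>
  define h where "h = 1 / (1 + \<bar>l\<bar>)"
  show h: "h > 0" by (simp add: h_def add_pos_nonneg)
  let ?f = "\<lambda>t. exp (- \<i> * complex_of_real (l * t)) * indicator {-h..0} t"
  have ind: "integrable lborel (indicat_real {-h..0})"
    using h by (intro integrable_real_indicator) auto
  have int: "integrable lborel ?f"
  proof (rule Bochner_Integration.integrable_bound[OF ind])
    show "?f \<in> borel_measurable lborel" by measurable
    show "AE t in lborel. norm (?f t) \<le> norm (indicat_real {-h..0} t)"
      by (intro AE_I2) (simp add: norm_mult indicator_def)
  qed
  have "cos 1 * h = (\<integral>t. cos 1 * indicat_real {-h..0} t \<partial>lborel)" using h by simp
  also have "\<dots> \<le> (\<integral>t. Re (?f t) \<partial>lborel)"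
  proof (rule integral_mono)
    show "integrable lborel (\<lambda>t. cos 1 * indicat_real {-h..0} t)" using ind by simp
    show "integrable lborel (\<lambda>t. Re (?f t))" by (rule integrable_bounded_linear[OF bounded_linear_Re int])
    show "cos 1 * indicat_real {-h..0} t \<le> Re (?f t)" for t
    proof (cases "t \<in> {-h..0}")
      case True
      have "\<bar>l * t\<bar> \<le> \<bar>l\<bar> * h" unfolding abs_mult using True by (intro mult_left_mono) auto
      also have "\<dots> \<le> 1" by (simp add: h_def divide_le_eq add_pos_nonneg)
      finally have "cos 1 \<le> cos \<bar>l * t\<bar>" using pi_gt3 by (intro cos_monotone_0_pi_le) auto
      then show ?thesis using True by (simp add: Re_exp)
    qed simp
  qed
  also have "\<dots> = Re (\<integral>t. ?f t \<partial>lborel)" by (rule integral_bounded_linear[OF bounded_linear_Re int])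
  finally show "(\<integral>t. ?f t \<partial>lborel) \<noteq> 0"
    using h cos_gt_zero[of 1] pi_gt3 by (auto simp: mult_le_0_iff)
qed

text \<open>\<open>M\<^sub>h \<phi>\<close> is the convolution with \<open>(1 / h) 1\<close> on \<open>{-h..0}\<close>, so \<open>\<phi>\<close> has empty spectrum.\<close>

lemma (in invariant_class) reduced_spectrum_mean_class:
  assumes P: "bounded_sm M (\<lambda>t. if t \<in> J' then \<phi> t else 0)"
    and mean: "restrict \<phi> J' \<in> mean_class J' F"
  shows "reduced_spectrum J' F \<phi> = {}"
proof -
  let ?P = "\<lambda>t. if t \<in> J' then \<phi> t else 0"
  have "l \<notin> reduced_spectrum J' F \<phi>" for l
  proof -
    obtain h :: real where h: "h > 0"
      and nz: "(\<integral>t. exp (- \<i> * of_real (l * t)) * indicator {-h..0} t \<partial>lborel) \<noteq> 0"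
      using integral_exp_short_interval .
    define f :: "real \<Rightarrow> complex" where "f t = of_real (1 / h) * indicator {-h..0} t" for t
    have f: "integrable lborel f"
    proof -
      have "integrable lborel (\<lambda>t. complex_of_real (indicat_real {-h..0} t))"
        using h by (intro integrable_of_real integrable_real_indicator) auto
      from integrable_mult_right[OF this, of "of_real (1 / h)"] show ?thesis
        by (simp only: f_def[abs_def] of_real_indicator)
    qed
    have "fourier f l = of_real (1 / h) * (\<integral>t. exp (- \<i> * of_real (l * t)) * indicator {-h..0} t \<partial>lborel)"
      unfolding fourier_sconv(2)[OF f f] f_def
      by (subst integral_mult_right_zero[symmetric]) (simp add: mult.left_commute)
    then have "fourier f l \<noteq> 0" using nz h by simp
    moreover have "convolution ?P f t = mean_op h (restrict \<phi> J') t" if t: "t \<in> J'" for t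
    proof -
      have Pt: "bounded_sm M (\<lambda>s. ?P (t + s))"
        using P strongly_measurable_affine[of ?P 1 t] unfolding mult_1 by (simp add: bounded_sm_def)
      \<comment> \<open>For \<open>t\<close> in \<open>J'\<close> and \<open>s \<ge> 0\<close> the
        point \<open>t + s\<close> stays in \<open>J'\<close>. Hence forward means see neither the
        extension by 0 nor the restriction.\<close>
      have "bochner_set_integral {0..h} (\<lambda>s. restrict \<phi> J' (t + s)) = integral {0..h} (\<lambda>s. ?P (t + s))"
        using t J' by (intro bochner_set_integral_eq[OF Pt]) auto
      moreover have "convolution ?P f t = (1 / h) *\<^sub>R integral {0..h} (\<lambda>s. ?P (t + s))"
      proof -
        have "convolution ?P f t = integral UNIV (\<lambda>s. if s \<in> {-h..0} then (1 / h) *\<^sub>R ?P (t - s) else 0)"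
          unfolding convolution_eq_integral[OF integrable_lebesgueI[OF f] P]
        proof (rule integral_cong)
          show "f s *\<^sub>C ?P (t - s) = (if s \<in> {-h..0} then (1 / h) *\<^sub>R ?P (t - s) else 0)" for s
          proof (cases "s \<in> {-h..0}")
            case True
            then have "f s = of_real (1 / h)" by (simp add: f_def)
            with True show ?thesis by (simp only: scaleC_of_real if_True)
          next
            case False
            then have "f s = 0" by (simp add: f_def)
            with False show ?thesis by (simp only: scaleC.zero_left if_False)
          qed
        qed
        also have "\<dots> = integral {-h..0} (\<lambda>s. (1 / h) *\<^sub>R ?P (t - s))"
          by (rule integral_restrict_UNIV)
        \<comment> \<open>The endpoint is written \<open>- 0\<close> so that the reflection rule
          applies syntactically.\<close>
        also have "\<dots> = (1 / h) *\<^sub>R integral {-h..- 0} (\<lambda>s. ?P (t + - s))"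
          by (simp only: integral_cmul minus_zero diff_conv_add_uminus)
        also have "integral {-h..- 0} (\<lambda>s. ?P (t + - s)) = integral {0..h} (\<lambda>s. ?P (t + s))"
          by (rule Henstock_Kurzweil_Integration.integral_reflect_real[where f = "\<lambda>s. ?P (t + s)"])
        finally show ?thesis .
      qed
      ultimately show ?thesis by (simp only: mean_op_def)
    qed
    then have "restrict (convolution ?P f) J' = restrict (mean_op h (restrict \<phi> J')) J'"
      by (rule restrict_ext)
    then have "restrict (convolution ?P f) J' \<in> F"
      using mean h by (simp add: mean_class_def)
    ultimately show ?thesis
      using f not_reduced_spectrum_iff[OF P] by (auto simp: conv_ideal_def)
  qed
  then show ?thesis by blast
qed

theorem theorem4p3:
  fixes J J' :: "real set"
    and D :: "'a::complex_banach set" and A :: "'a \<Rightarrow> 'a"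
    and \<phi> u :: "real \<Rightarrow> 'a" and x :: 'a
    and F :: "(real \<Rightarrow> 'a) set"
  assumes J: "J \<in> {{0..}, UNIV}" and J': "J' \<in> {{0..}, UNIV}" and sub: "J' \<subseteq> J"
    and A: "closed_operator D A"
    and phi: "\<phi> \<in> L_infinity J"
    and F_L1: "F \<subseteq> L1_loc J'"
    and F_lin: "function_subspace J' F"
    and F_closed: "uniformly_closed J' F"
    and F_inv: "BUC_invariant J' F"
    and F_char: "\<And>(l::real) \<psi>. \<psi> \<in> F \<Longrightarrow> (\<lambda>t\<in>J'. exp (\<i> * complex_of_real (l * t)) *\<^sub>C \<psi> t) \<in> F"
    and F_const: "\<And>c. (\<lambda>t\<in>J'. c) \<in> F"
    and F_op: "\<And>B \<psi>. bounded_clinear B \<Longrightarrow> \<psi> \<in> F \<Longrightarrow> (\<lambda>t\<in>J'. B (\<psi> t)) \<in> F"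
    and u: "u \<in> BC J"
    and mild: "mild_solution J D A \<phi> x u"
  shows "i_times (reduced_spectrum J' F u)
           \<subseteq> (op_spectrum D A \<inter> i_times UNIV) \<union> i_times (reduced_spectrum J' F \<phi>) \<and>
         (restrict \<phi> J' \<in> mean_class J' F \<longrightarrow>
           i_times (reduced_spectrum J' F u) \<subseteq> op_spectrum D A \<inter> i_times UNIV)"
proof -
  interpret invariant_class J' F by (rule invariant_class.intro[OF J' F_lin F_closed F_inv])
  let ?U = "\<lambda>t. if t \<in> J' then u t else 0" and ?P = "\<lambda>t. if t \<in> J' then \<phi> t else 0"
  obtain Mu where U: "bounded_sm Mu ?U"
    using bounded_sm_L_infinity[OF _ J' sub] BC_subset_L_infinity[OF J] u by blast
  obtain M where P: "bounded_sm M ?P"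
    using bounded_sm_L_infinity[OF phi J' sub] .
  have main: "l \<in> reduced_spectrum J' F \<phi>"
    if l: "l \<in> reduced_spectrum J' F u" and res: "\<i> * of_real l \<in> resolvent_set D A" for l
  proof (rule ccontr)
    assume "l \<notin> reduced_spectrum J' F \<phi>"
    then obtain f where f: "f \<in> conv_ideal ?P" "fourier f l \<noteq> 0"
      using not_reduced_spectrum_iff[OF P] by blast
    obtain R where R: "bounded_clinear R" "\<And>x. x \<in> D \<Longrightarrow> R ((\<i> * of_real l) *\<^sub>C x - A x) = x"
      using res by (auto simp: resolvent_set_def)
    have "\<exists>g \<in> conv_ideal ?U. fourier g l \<noteq> 0"
    proof (rule conv_ideal_resolvent[OF R(1) F_op[OF R(1)] U _ P _ _ f])
      show "((\<lambda>t. (\<i> * of_real l) *\<^sub>C R (?U t) + ((-1) *\<^sub>C ?U t + R (?P t))) has_integral (R (?U d) - R (?U c))) {c..d}"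
        if "c \<le> d" "c \<in> J'" for c d
        by (rule mild_solution_resolvent[OF J' mild sub R U _ P _ that]) simp_all
    qed simp_all
    with l show False using not_reduced_spectrum_iff[OF U] by blast
  qed
  then have 1: "i_times (reduced_spectrum J' F u)
      \<subseteq> (op_spectrum D A \<inter> i_times UNIV) \<union> i_times (reduced_spectrum J' F \<phi>)"
    by (auto simp: i_times_def op_spectrum_def)
  moreover have "i_times (reduced_spectrum J' F \<phi>) = {}" if "restrict \<phi> J' \<in> mean_class J' F"
    using reduced_spectrum_mean_class[OF P that] by (simp add: i_times_def)
  ultimately show ?thesis by blast
qed

end
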